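(* Let $D\subset\mathbb{R}^d$ be a Lipschitz domain. For diffusion coefficients $a,b$ and a right side $f$, let $u_a,u_b$ be the corresponding weak solutions, and set $\delta:=a-b$, $E:=u_a-u_b$. Then the following two inequalities hold: (i) For any $a,b\in\mathcal{A}$ and $f\in H^{-1}(D)$, $$\left|\int_D\delta|\nabla u_a|^2\right|\le\Lambda\|f\|_{H^{-1}(D)}\|E\|_{H^1_0(D)}.$$ (ii) For any $a,b\in\mathcal{A}_1$ and $f\in L_\infty(D)$, $$\int_D\frac{\delta^2}{a^2}\bigl(a|\nabla u_a|^2+fu_a\bigr)\le C_0\|E\|_{H^1_0(D)},$$ where $C_0:=C\|f\|_{L_\infty(D)}\bigl(1+\max\{\|\nabla a\|_{L_2(D)},\|\nabla b\|_{L_2(D)}\}\bigr)$ and $C$ is a constant depending only on $D,d,\lambda,\Lambda$.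
   Context: $D\subset\mathbb{R}^d$, $d\ge 2$, is a bounded domain (open, connected). $\lambda,\Lambda$ are fixed positive constants and $\mathcal{A}:=\{a\in L_\infty(D):\lambda\le a\le\Lambda\}$. For $s>0$, $\mathcal{A}_s:=\{a\in\mathcal{A}:\|a\|_{H^s(D)}\le M\}$, where $M>0$ is arbitrary but fixed. $H^1_0(D)$ is equipped with the norm $\|v\|_{H^1_0(D)}=\|\nabla v\|_{L_2(D)}$, and $H^{-1}(D)$ is its dual. For $a\in\mathcal{A}$ and $f\in H^{-1}(D)$, $u_a\in H^1_0(D)$ is the unique weak solution of $-\mathrm{div}(a\nabla u_a)=f$ on $D$, $u_a=0$ on $\partial D$, i.e. $\int_D a\nabla u_a\cdot\nabla v=\langle f,v\rangle_{H^{-1}(D),H^1_0(D)}$ for all $v\in H^1_0(D)$.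
   Formalization: In (i) the constant Λ is replaced by Λ/λ: with Λ the inequality fails whenever λ<1 and λ<Λ (take a=λ, b=Λ constant and f≠0); for λ≥1 the proved bound implies the stated one. *)

theory Defs
  imports "HOL-Analysis.Analysis" "HOL-Probability.Essential_Supremum"
begin

section \<open>Bounded Lipschitz domains\<close>

text \<open>
  The boundary is locally a Lipschitz graph with \<open>D\<close> on one side of it. The unit vector \<open>e\<close> is the
  vertical direction of the rotated local coordinate system, and \<open>x - (x \<bullet> e) *\<^sub>R e\<close> is the horizontal
  part of \<open>x\<close>. Requiring \<open>\<gamma>\<close> to be Lipschitz on the whole space is no restriction, since a Lipschitz
  function on the hyperplane orthogonal to \<open>e\<close> can be composed with the orthogonal projection.
\<close>
definition lipschitz_boundary :: "'a::euclidean_space set \<Rightarrow> bool" where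
  "lipschitz_boundary D \<longleftrightarrow>
     (\<forall>z\<in>frontier D. \<exists>r>0. \<exists>e L. \<exists>\<gamma> :: 'a \<Rightarrow> real. norm e = 1 \<and> L-lipschitz_on UNIV \<gamma> \<and>
        D \<inter> ball z r = {x \<in> ball z r. \<gamma> (x - (x \<bullet> e) *\<^sub>R e) < x \<bullet> e})"

definition lipschitz_domain :: "'a::euclidean_space set \<Rightarrow> bool" where
  "lipschitz_domain D \<longleftrightarrow> open D \<and> connected D \<and> bounded D \<and> lipschitz_boundary D"

section \<open>Test functions\<close>

definition partial_deriv :: "'a::euclidean_space \<Rightarrow> ('a \<Rightarrow> real) \<Rightarrow> 'a \<Rightarrow> real" where
  "partial_deriv i \<phi> x = frechet_derivative \<phi> (at x) i"

primrec C_k :: "nat \<Rightarrow> ('a::euclidean_space \<Rightarrow> real) \<Rightarrow> bool" where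
  "C_k 0 \<phi> \<longleftrightarrow> continuous_on UNIV \<phi>"
| "C_k (Suc k) \<phi> \<longleftrightarrow> (\<forall>x. \<phi> differentiable (at x)) \<and> (\<forall>i\<in>Basis. C_k k (partial_deriv i \<phi>))"

definition test_functions :: "'a::euclidean_space set \<Rightarrow> ('a \<Rightarrow> real) set" where
  "test_functions D =
     {\<phi>. (\<forall>k. C_k k \<phi>) \<and> compact (closure {x. \<phi> x \<noteq> 0}) \<and> closure {x. \<phi> x \<noteq> 0} \<subseteq> D}"

section \<open>Lebesgue and Sobolev spaces\<close>

text \<open>
  Elements of these spaces are represented by functions on the whole space; only their values almost
  everywhere on \<open>D\<close> matter. The norms are meaningful only on the corresponding spaces.
\<close>
definition L2 :: "'a::euclidean_space set \<Rightarrow> ('a \<Rightarrow> 'b::real_normed_vector) set" where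
  "L2 D = {f \<in> borel_measurable (lebesgue_on D). integrable (lebesgue_on D) (\<lambda>x. (norm (f x))\<^sup>2)}"

definition L2_norm :: "'a::euclidean_space set \<Rightarrow> ('a \<Rightarrow> 'b::real_normed_vector) \<Rightarrow> real" where
  "L2_norm D f = sqrt (\<integral>x. (norm (f x))\<^sup>2 \<partial>(lebesgue_on D))"

definition Linf :: "'a::euclidean_space set \<Rightarrow> ('a \<Rightarrow> real) set" where
  "Linf D = {f \<in> borel_measurable (lebesgue_on D). esssup (lebesgue_on D) (\<lambda>x. ereal \<bar>f x\<bar>) < \<infinity>}"

definition Linf_norm :: "'a::euclidean_space set \<Rightarrow> ('a \<Rightarrow> real) \<Rightarrow> real" where
  "Linf_norm D f = real_of_ereal (esssup (lebesgue_on D) (\<lambda>x. ereal \<bar>f x\<bar>))"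

definition has_weak_gradient ::
    "'a::euclidean_space set \<Rightarrow> ('a \<Rightarrow> real) \<Rightarrow> ('a \<Rightarrow> 'a) \<Rightarrow> bool" where
  "has_weak_gradient D u g \<longleftrightarrow> u \<in> L2 D \<and> g \<in> L2 D \<and>
     (\<forall>\<phi>\<in>test_functions D. \<forall>i\<in>Basis.
        (\<integral>x. u x * partial_deriv i \<phi> x \<partial>(lebesgue_on D)) =
        - (\<integral>x. (g x \<bullet> i) * \<phi> x \<partial>(lebesgue_on D)))"

definition H1 :: "'a::euclidean_space set \<Rightarrow> ('a \<Rightarrow> real) set" where
  "H1 D = {u. \<exists>g. has_weak_gradient D u g}"

text \<open>The weak gradient is unique up to null sets; \<open>wgrad\<close> selects a representative.\<close>
definition wgrad :: "'a::euclidean_space set \<Rightarrow> ('a \<Rightarrow> real) \<Rightarrow> 'a \<Rightarrow> 'a" where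
  "wgrad D u = (SOME g. has_weak_gradient D u g)"

definition H1_norm :: "'a::euclidean_space set \<Rightarrow> ('a \<Rightarrow> real) \<Rightarrow> real" where
  "H1_norm D u = sqrt ((L2_norm D u)\<^sup>2 + (L2_norm D (wgrad D u))\<^sup>2)"

text \<open>The closure of the test functions in \<open>H1 D\<close>.\<close>
definition H10 :: "'a::euclidean_space set \<Rightarrow> ('a \<Rightarrow> real) set" where
  "H10 D = {u \<in> H1 D. \<exists>\<phi> :: nat \<Rightarrow> 'a \<Rightarrow> real.
     (\<forall>n. \<phi> n \<in> test_functions D) \<and> (\<lambda>n. H1_norm D (\<lambda>x. \<phi> n x - u x)) \<longlonglongrightarrow> 0}"

definition H10_norm :: "'a::euclidean_space set \<Rightarrow> ('a \<Rightarrow> real) \<Rightarrow> real" where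
  "H10_norm D v = L2_norm D (wgrad D v)"

text \<open>
  The dual of \<open>H10 D\<close>. Linearity and boundedness together force a functional to agree on functions
  that are equal almost everywhere on \<open>D\<close>; its values outside \<open>H10 D\<close> are irrelevant.
\<close>
definition Hminus1 :: "'a::euclidean_space set \<Rightarrow> (('a \<Rightarrow> real) \<Rightarrow> real) set" where
  "Hminus1 D = {F.
     (\<forall>u\<in>H10 D. \<forall>v\<in>H10 D. F (\<lambda>x. u x + v x) = F u + F v) \<and>
     (\<forall>c. \<forall>v\<in>H10 D. F (\<lambda>x. c * v x) = c * F v) \<and>
     (\<exists>K. \<forall>v\<in>H10 D. \<bar>F v\<bar> \<le> K * H10_norm D v)}"

definition Hminus1_norm :: "'a::euclidean_space set \<Rightarrow> (('a \<Rightarrow> real) \<Rightarrow> real) \<Rightarrow> real" where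
  "Hminus1_norm D F = (SUP v\<in>{v \<in> H10 D. H10_norm D v \<le> 1}. \<bar>F v\<bar>)"

definition functional_of :: "'a::euclidean_space set \<Rightarrow> ('a \<Rightarrow> real) \<Rightarrow> ('a \<Rightarrow> real) \<Rightarrow> real" where
  "functional_of D f v = (\<integral>x. f x * v x \<partial>(lebesgue_on D))"

section \<open>The elliptic problem\<close>

definition admissible :: "'a::euclidean_space set \<Rightarrow> real \<Rightarrow> real \<Rightarrow> ('a \<Rightarrow> real) set" where
  "admissible D lam Lam = {a \<in> Linf D. AE x in lebesgue_on D. lam \<le> a x \<and> a x \<le> Lam}"

definition admissible_H1 :: "'a::euclidean_space set \<Rightarrow> real \<Rightarrow> real \<Rightarrow> real \<Rightarrow> ('a \<Rightarrow> real) set" where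
  "admissible_H1 D lam Lam M = {a \<in> admissible D lam Lam. a \<in> H1 D \<and> H1_norm D a \<le> M}"

text \<open>\<open>u\<close> is a weak solution of \<open>- div (a \<nabla>u) = F\<close> on \<open>D\<close>, \<open>u = 0\<close> on the boundary.\<close>
definition weak_solution ::
    "'a::euclidean_space set \<Rightarrow> ('a \<Rightarrow> real) \<Rightarrow> (('a \<Rightarrow> real) \<Rightarrow> real) \<Rightarrow> ('a \<Rightarrow> real) \<Rightarrow> bool" where
  "weak_solution D a F u \<longleftrightarrow> u \<in> H10 D \<and>
     (\<forall>v\<in>H10 D. (\<integral>x. a x * (wgrad D u x \<bullet> wgrad D v x) \<partial>(lebesgue_on D)) = F v)"

text \<open>
  On the constant in the first estimate of the theorem. In the source it reads \<open>\<Lambda>\<close>; here it is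
  \<open>\<Lambda> / \<lambda>\<close>, because the estimate with \<open>\<Lambda>\<close> fails for all \<open>\<lambda> < 1\<close>, \<open>\<lambda> < \<Lambda>\<close>: for the constant
  coefficients \<open>a = \<lambda>\<close>, \<open>b = \<Lambda>\<close> and any \<open>f \<noteq> 0\<close> with \<open>H\<^sup>-\<^sup>1\<close> norm \<open>N\<close> its left side
  is \<open>(\<Lambda> - \<lambda>) N\<^sup>2 / \<lambda>\<^sup>2\<close> and its right side is \<open>(\<Lambda> - \<lambda>) N\<^sup>2 / \<lambda>\<close>. The same example shows that
  \<open>\<Lambda> / \<lambda>\<close> is sharp. For \<open>\<lambda> \<ge> 1\<close> the estimate below implies the one with \<open>\<Lambda>\<close>.
\<close>

end

(*
Both estimates come from the identity int (a - b) grad u_a . grad v = - int b grad E . grad v, valid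
for every test function v. For the first one takes v = u_a and the energy bound for u_a.

For the second one takes v = w u_a with w = (a - b) / a. Testing the equation of u_a also with
w^2 u_a turns the left side into half of the weighted integral, so that this integral equals
- 2 int b grad E . grad (w u_a), and grad (w u_a) = u_a grad w + w grad u_a is controlled as soon as
u_a is bounded. That bound is Stampacchia's iteration; the gain in the measure of the level sets is
supplied by a Nash inequality obtained by averaging the translation estimate over a cube. The
truncations are smooth (dilations of exp (-1 / t)), so the chain rule is needed only for smooth
functions.

That w u_a and w^2 u_a may be used as test functions rests on one lemma: if div sigma = - f weakly
and w is in H^1(D), then the equation may be tested with w phi for every test function phi. With
sigma = u e_i the same lemma is the product rule for bounded functions in H^1(D); the gradient of
1 / a then follows from the geometric series.
*)
theory Submission
  imports Defs
begin

section \<open>Smooth functions\<close>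

text \<open>With \<open>a w = a - b\<close>, expanding \<open>(a - b) grad ua . grad (w ua)\<close>
  gives \<open>a w^2 |grad ua|^2\<close> and the cross term \<open>a w ua grad ua . grad w\<close>,
  which has no sign. Testing with \<open>w^2 ua\<close> produces exactly twice that cross term, so
  the equation of \<open>ua\<close> trades it for \<open>w^2 f ua\<close>. This is why the weight in
  the second estimate is \<open>a |grad ua|^2 + f ua\<close>. The obstacle is that \<open>ua\<close>
  and \<open>w\<close> are merely weakly differentiable. The gradient of \<open>w ua\<close> is
  square integrable only once both factors are bounded, which is what makes the sup bound for
  \<open>ua\<close> unavoidable here, and \<open>w\<close> does not vanish on the boundary. Hence
  the two factors are treated differently: \<open>ua\<close> is reached through test functions,
  while \<open>w\<close> only ever meets a smooth kernel inside a double integral over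
  \<open>D\<close>. For the same reason \<open>w ua\<close> is never placed in \<open>H10\<close>;
  the equation itself is extended to it.\<close>

definition grad :: "('a::euclidean_space \<Rightarrow> real) \<Rightarrow> 'a \<Rightarrow> 'a" where
  "grad f x = (\<Sum>i\<in>Basis. partial_deriv i f x *\<^sub>R i)"

definition smooth :: "('a::euclidean_space \<Rightarrow> real) \<Rightarrow> bool" where
  "smooth f \<longleftrightarrow> (\<forall>k. C_k k f)"

lemma smooth_differentiable: "smooth f \<Longrightarrow> f differentiable (at x)"
  unfolding smooth_def by (metis C_k.simps(2))

lemma smooth_partial_deriv: "smooth f \<Longrightarrow> i \<in> Basis \<Longrightarrow> smooth (partial_deriv i f)"
  unfolding smooth_def by (metis C_k.simps(2))

lemma smooth_continuous: "smooth f \<Longrightarrow> continuous_on S f"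
  unfolding smooth_def by (metis C_k.simps(1) continuous_on_subset subset_UNIV)

lemma partial_deriv_eqI: "(f has_derivative f') (at x) \<Longrightarrow> partial_deriv i f x = f' i"
  by (simp add: partial_deriv_def frechet_derivative_at[symmetric])

lemma grad_inner_Basis: "i \<in> Basis \<Longrightarrow> grad f x \<bullet> i = partial_deriv i f x"
  by (simp add: grad_def inner_sum_left inner_Basis if_distrib cong: if_cong)

lemma grad_eqI:
  assumes "\<And>i. i \<in> Basis \<Longrightarrow> partial_deriv i f x = g \<bullet> i"
  shows "grad f x = g"
  by (rule euclidean_eqI) (simp add: grad_inner_Basis assms)

lemma has_derivative_grad:
  assumes "f differentiable (at x)"
  shows "(f has_derivative (\<lambda>h. grad f x \<bullet> h)) (at x)"
proof -
  have d: "(f has_derivative frechet_derivative f (at x)) (at x)"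
    using assms frechet_derivative_works by blast
  have "frechet_derivative f (at x) h = grad f x \<bullet> h" for h
  proof -
    have "frechet_derivative f (at x) h = frechet_derivative f (at x) (\<Sum>i\<in>Basis. (h \<bullet> i) *\<^sub>R i)"
      by (simp add: euclidean_representation)
    also have "\<dots> = (\<Sum>i\<in>Basis. (h \<bullet> i) * frechet_derivative f (at x) i)"
      using linear_frechet_derivative[OF assms] by (simp add: linear_sum linear_cmul)
    finally show ?thesis
      by (simp add: grad_def inner_sum_left partial_deriv_def inner_commute[of h] mult.commute)
  qed
  then show ?thesis using d by presburger
qed

section \<open>Differentiation rules and closure of \<open>C_k\<close> under the basic
  operations\<close>

lemma C_k_Suc_imp: "C_k (Suc k) f \<Longrightarrow> C_k k f"
  by (induction k arbitrary: f)
     (auto intro!: continuous_at_imp_continuous_on differentiable_imp_continuous_within)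

lemma partial_deriv_add:
  assumes "f differentiable (at x)" "g differentiable (at x)"
  shows "partial_deriv i (\<lambda>x. f x + g x) x = partial_deriv i f x + partial_deriv i g x"
  by (rule trans[OF partial_deriv_eqI[OF has_derivative_add]])
     (use assms frechet_derivative_works in \<open>auto simp: partial_deriv_def\<close>)

lemma partial_deriv_mult:
  assumes "f differentiable (at x)" "g differentiable (at x)"
  shows "partial_deriv i (\<lambda>x. f x * g x) x = f x * partial_deriv i g x + partial_deriv i f x * g x"
  by (rule trans[OF partial_deriv_eqI[OF has_derivative_mult]])
     (use assms frechet_derivative_works in \<open>auto simp: partial_deriv_def\<close>)

lemma partial_deriv_affine:
  assumes "f differentiable (at (c *\<^sub>R x + v))"
  shows "partial_deriv i (\<lambda>x. f (c *\<^sub>R x + v)) x = c * partial_deriv i f (c *\<^sub>R x + v)"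
proof -
  have "((\<lambda>x. f (c *\<^sub>R x + v)) has_derivative (\<lambda>h. frechet_derivative f (at (c *\<^sub>R x + v)) (c *\<^sub>R h))) (at x)"
    by (rule has_derivative_compose[where g = f])
       (use assms frechet_derivative_works in \<open>auto intro!: derivative_eq_intros\<close>)
  from partial_deriv_eqI[OF this, of i] show ?thesis
    using linear_frechet_derivative[OF assms] by (simp add: partial_deriv_def linear_cmul)
qed

lemma partial_deriv_comp:
  assumes "f differentiable (at x)" "(G has_real_derivative G') (at (f x))"
  shows "partial_deriv i (\<lambda>x. G (f x)) x = G' * partial_deriv i f x"
proof -
  have "((\<lambda>x. G (f x)) has_derivative (\<lambda>h. G' * frechet_derivative f (at x) h)) (at x)"
    by (rule has_derivative_compose[where g = G])
      (use assms frechet_derivative_works in \<open>auto simp: has_field_derivative_def\<close>)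
  from partial_deriv_eqI[OF this, of i] show ?thesis by (simp add: partial_deriv_def)
qed

lemma C_k_const: "C_k k (\<lambda>x. c)"
proof (induction k arbitrary: c)
  case (Suc k)
  have "partial_deriv i (\<lambda>x. c) = (\<lambda>x. 0)" for i :: 'a
    by (auto simp: partial_deriv_def)
  then show ?case using Suc by simp
qed simp

lemma C_k_add: "C_k k f \<Longrightarrow> C_k k g \<Longrightarrow> C_k k (\<lambda>x. f x + g x)"
proof (induction k arbitrary: f g)
  case (Suc k)
  have "partial_deriv i (\<lambda>x. f x + g x) = (\<lambda>x. partial_deriv i f x + partial_deriv i g x)" for i
    using Suc.prems by (auto intro!: partial_deriv_add)
  then show ?case using Suc by simp
qed (auto intro: continuous_intros)

lemma C_k_mult: "C_k k f \<Longrightarrow> C_k k g \<Longrightarrow> C_k k (\<lambda>x. f x * g x)"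
proof (induction k arbitrary: f g)
  case (Suc k)
  have "partial_deriv i (\<lambda>x. f x * g x) = (\<lambda>x. f x * partial_deriv i g x + partial_deriv i f x * g x)" for i
    using Suc.prems by (auto intro!: partial_deriv_mult)
  moreover have "C_k k f" "C_k k g" using Suc.prems by (auto intro: C_k_Suc_imp simp del: C_k.simps)
  ultimately show ?case using Suc by (auto intro!: C_k_add)
qed (auto intro: continuous_intros)

lemma C_k_affine: "C_k k f \<Longrightarrow> C_k k (\<lambda>x. f (c *\<^sub>R x + v))"
proof (induction k arbitrary: f)
  case 0
  then show ?case
    by (auto intro!: continuous_on_compose2[where g = f and t = UNIV] continuous_intros)
next
  case (Suc k)
  have "partial_deriv i (\<lambda>x. f (c *\<^sub>R x + v)) = (\<lambda>x. c * partial_deriv i f (c *\<^sub>R x + v))" for i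
    using Suc.prems by (auto intro!: partial_deriv_affine)
  moreover have "(\<lambda>x. f (c *\<^sub>R x + v)) differentiable at x" for x
    by (rule differentiable_compose[where f = f]) (use Suc.prems in \<open>auto intro!: derivative_intros\<close>)
  ultimately show ?case using Suc by (auto intro!: C_k_mult C_k_const)
qed

lemma smooth_const [intro]: "smooth (\<lambda>x. c)" by (simp add: smooth_def C_k_const)
lemma smooth_add: "smooth f \<Longrightarrow> smooth g \<Longrightarrow> smooth (\<lambda>x. f x + g x)"
  by (simp add: smooth_def C_k_add)
lemma smooth_mult: "smooth f \<Longrightarrow> smooth g \<Longrightarrow> smooth (\<lambda>x. f x * g x)"
  by (simp add: smooth_def C_k_mult)
lemma smooth_affine: "smooth f \<Longrightarrow> smooth (\<lambda>x. f (c *\<^sub>R x + v))"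
  by (simp add: smooth_def C_k_affine)
lemma smooth_diff: "smooth f \<Longrightarrow> smooth g \<Longrightarrow> smooth (\<lambda>x. f x - g x)"
  using smooth_add[of f "\<lambda>x. (-1) * g x"] smooth_mult[of "\<lambda>x. -1" g] by auto
lemma smooth_sum: "finite I \<Longrightarrow> (\<And>i. i \<in> I \<Longrightarrow> smooth (f i)) \<Longrightarrow> smooth (\<lambda>x. \<Sum>i\<in>I. f i x)"
  by (induction I rule: finite_induct) (auto intro!: smooth_add)

lemma smooth_inner_left: "smooth (\<lambda>x. x \<bullet> v)"
proof -
  have "((\<lambda>x. x \<bullet> v) has_derivative (\<lambda>h. h \<bullet> v)) (at x)" for x :: 'a
    by (auto intro!: derivative_eq_intros)
  then have "partial_deriv i (\<lambda>x. x \<bullet> v) = (\<lambda>x. i \<bullet> v)" "(\<lambda>x. x \<bullet> v) differentiable at x" for i x :: 'a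
    by (auto dest: partial_deriv_eqI simp: differentiable_def)
  then have "C_k (Suc k) (\<lambda>x. x \<bullet> v)" for k by (simp add: C_k_const)
  then show ?thesis unfolding smooth_def by (metis C_k_Suc_imp)
qed

lemma smooth_norm_sq: "smooth (\<lambda>x. (norm x)\<^sup>2)"
proof -
  have "smooth (\<lambda>x::'a. \<Sum>i\<in>Basis. (x \<bullet> i) * (x \<bullet> i))"
    by (intro smooth_sum smooth_mult smooth_inner_left) auto
  then show ?thesis by (simp add: power2_norm_eq_inner euclidean_inner[symmetric])
qed

text \<open>Smoothness on the real line is encoded by a whole sequence of iterated derivatives, so
  that an induction on the order in \<open>C_k\<close> can pass from \<open>d j\<close> to
  \<open>d (Suc j)\<close>.\<close>

definition smooth_real :: "(real \<Rightarrow> real) \<Rightarrow> bool" where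
  "smooth_real G \<longleftrightarrow> (\<exists>d. d 0 = G \<and> (\<forall>j t. (d j has_real_derivative d (Suc j) t) (at t)))"

text \<open>It suffices to lie in a family closed under differentiation: dependent choice then picks
  the sequence of derivatives inside the family.\<close>

lemma smooth_realI:
  assumes "G \<in> F" "\<And>H. H \<in> F \<Longrightarrow> \<exists>H'\<in>F. \<forall>t. (H has_real_derivative H' t) (at t)"
  shows "smooth_real G"
proof -
  have "\<exists>d. \<forall>n. (d n \<in> F \<and> (n = 0 \<longrightarrow> d n = G)) \<and> (\<forall>t. (d n has_real_derivative d (Suc n) t) (at t))"
    by (rule dependent_nat_choice) (use assms in auto)
  then show ?thesis unfolding smooth_real_def by blast
qed

text \<open>By the chain rule a partial derivative of \<open>d j\<close> composed with
  \<open>f\<close> is \<open>d (Suc j)\<close> composed with \<open>f\<close>, times a smooth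
  factor. The induction on \<open>k\<close> therefore has to treat all \<open>j\<close> at
  once.\<close>

lemma smooth_comp:
  assumes "smooth_real G" "smooth f"
  shows "smooth (\<lambda>x. G (f x))"
proof -
  obtain d where d: "d 0 = G" "\<And>j t. (d j has_real_derivative d (Suc j) t) (at t)"
    using assms(1) unfolding smooth_real_def by blast
  have diff: "f differentiable at x" for x using assms(2) smooth_differentiable by blast
  have "C_k k (\<lambda>x. d j (f x))" for k j
  proof (induction k arbitrary: j)
    case 0
    have "continuous_on UNIV (d j)"
      by (intro continuous_at_imp_continuous_on ballI DERIV_isCont[OF d(2)])
    then show ?case
      using smooth_continuous[OF assms(2)] by (auto intro: continuous_on_compose2)
  next
    case (Suc k)
    have "partial_deriv i (\<lambda>x. d j (f x)) = (\<lambda>x. d (Suc j) (f x) * partial_deriv i f x)" for i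
      by (rule ext) (rule partial_deriv_comp[OF diff d(2)])
    moreover have "(\<lambda>x. d j (f x)) differentiable at x" for x
      by (rule differentiable_compose[where f = "d j"])
        (use diff d(2) in \<open>auto intro: differentiable_at_withinI simp: real_differentiable_def\<close>)
    moreover have "C_k k (\<lambda>x. d (Suc j) (f x) * partial_deriv i f x)" if "i \<in> Basis" for i
      using Suc smooth_partial_deriv[OF assms(2) that] by (intro C_k_mult) (auto simp: smooth_def)
    ultimately show ?case by simp
  qed
  then show ?thesis unfolding smooth_def d(1)[symmetric] by blast
qed

text \<open>The combinations of sine and cosine of one frequency are closed under differentiation.
  The case of interest is the truncation \<open>m sin (t / m)\<close>.\<close>

lemma smooth_real_sin: "smooth_real (\<lambda>t. c * sin (r * t))"
proof (rule smooth_realI[where F = "{\<lambda>t. a * sin (r * t) + b * cos (r * t) | a b. True}"])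
  show "(\<lambda>t. c * sin (r * t)) \<in> {\<lambda>t. a * sin (r * t) + b * cos (r * t) | a b. True}"
    by (intro CollectI exI[of _ c] exI[of _ 0]) auto
next
  fix H assume "H \<in> {\<lambda>t. a * sin (r * t) + b * cos (r * t) | a b. True}"
  then obtain a b where H: "H = (\<lambda>t. a * sin (r * t) + b * cos (r * t))" by blast
  have "(H has_real_derivative ((- b * r) * sin (r * t) + (a * r) * cos (r * t))) (at t)" for t
    unfolding H by (auto intro!: derivative_eq_intros simp: algebra_simps)
  then show "\<exists>H'\<in>{\<lambda>t. a * sin (r * t) + b * cos (r * t) | a b. True}.
      \<forall>t. (H has_real_derivative H' t) (at t)"
    by (intro bexI[of _ "\<lambda>t. (- b * r) * sin (r * t) + (a * r) * cos (r * t)"]) blast+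
qed

text \<open>The classical smooth function that is flat at 0. It serves twice: as the radial profile
  of the mollifiers and, dilated and shifted, as a smooth substitute for the positive part in the
  level set argument.\<close>

definition flat_exp :: "real \<Rightarrow> real" where
  "flat_exp t = (if 0 < t then exp (- (1 / t)) else 0)"

lemma poly_mult_exp_tendsto_0: "((\<lambda>s::real. poly p s * exp (- s)) \<longlongrightarrow> 0) at_top"
proof -
  have "((\<lambda>s::real. \<Sum>k\<le>degree p. coeff p k * (s ^ k * exp (- s))) \<longlongrightarrow> (\<Sum>k\<le>degree p. coeff p k * 0)) at_top"
  proof (intro tendsto_intros)
    fix k
    show "((\<lambda>s::real. s ^ k * exp (- s)) \<longlongrightarrow> 0) at_top"
      using tendsto_power_div_exp_0[of k] by (simp add: exp_minus divide_inverse)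
  qed
  moreover have "(\<lambda>s. \<Sum>k\<le>degree p. coeff p k * (s ^ k * exp (- s))) = (\<lambda>s. poly p s * exp (- s))"
    by (rule ext) (simp add: poly_altdef sum_distrib_right mult.assoc)
  ultimately show ?thesis by simp
qed

text \<open>With \<open>s = 1 / t\<close> the derivative of \<open>s\<close> is
  \<open>- s^2\<close>, so \<open>p(s) exp(-s)\<close> has derivative
  \<open>(p(s) - p'(s)) s^2 exp(-s)\<close>, again a polynomial times the exponential. For
  \<open>t \<le> 0\<close> the factor \<open>flat_exp t\<close> is 0 whatever the polynomial gives,
  including the default \<open>1 / 0 = 0\<close>.\<close>

lemma flat_exp_poly_deriv:
  fixes p :: "real poly"
  defines "q \<equiv> (p - pderiv p) * [:0, 0, 1:]"
  shows "((\<lambda>t. poly p (1 / t) * flat_exp t) has_real_derivative poly q (1 / t) * flat_exp t) (at t)"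
proof -
  let ?h = "\<lambda>t. poly p (1 / t) * flat_exp t"
  consider "t > 0" | "t < 0" | "t = 0" by linarith
  then show ?thesis
  proof cases
    case 1
    have "((\<lambda>t. poly p (1 / t) * exp (- (1 / t))) has_real_derivative
        poly q (1 / t) * flat_exp t) (at t)"
      using 1 by (auto intro!: derivative_eq_intros poly_DERIV DERIV_chain2[of "poly p"]
          simp: q_def flat_exp_def field_simps power2_eq_square)
    then show ?thesis
      by (rule has_field_derivative_transform_within_open[of _ _ _ "{0<..}"])
         (use 1 in \<open>auto simp: flat_exp_def\<close>)
  next
    case 2
    have "((\<lambda>t. 0) has_real_derivative poly q (1 / t) * flat_exp t) (at t)"
      using 2 by (auto simp: flat_exp_def)
    then show ?thesis
      by (rule has_field_derivative_transform_within_open[of _ _ _ "{..<0}"])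
         (use 2 in \<open>auto simp: flat_exp_def\<close>)
  next
    case 3
    \<comment> \<open>From the right the difference quotient is again a polynomial in
      \<open>1 / h\<close> times the exponential; \<open>pCons 0 p\<close> absorbs the extra factor
      \<open>1 / h\<close>.\<close>
    have r: "((\<lambda>h. (1 / h) * (poly p (1 / h) * flat_exp h)) \<longlongrightarrow> 0) (at_right 0)"
    proof -
      have "((\<lambda>h::real. poly (pCons 0 p) (inverse h) * exp (- inverse h)) \<longlongrightarrow> 0) (at_right 0)"
        by (rule filterlim_compose[OF poly_mult_exp_tendsto_0 filterlim_inverse_at_top_right])
      then show ?thesis
        by (rule Lim_transform_eventually)
           (auto simp: eventually_at_filter flat_exp_def divide_inverse)
    qed
    have l: "((\<lambda>h. (1 / h) * (poly p (1 / h) * flat_exp h)) \<longlongrightarrow> 0) (at_left 0)"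
      by (rule Lim_transform_eventually[OF tendsto_const])
         (auto simp: eventually_at_filter flat_exp_def)
    have "((\<lambda>h. (1 / h) * (poly p (1 / h) * flat_exp h)) \<longlongrightarrow> 0) (at 0)"
      using l r filterlim_split_at by blast
    then show ?thesis
      unfolding DERIV_def 3 by (simp add: flat_exp_def)
  qed
qed

lemma smooth_real_flat_exp: "smooth_real (\<lambda>t. flat_exp t)"
proof (rule smooth_realI[where F = "range (\<lambda>p t. poly p (1 / t) * flat_exp t)"])
  show "flat_exp \<in> range (\<lambda>p t. poly p (1 / t) * flat_exp t)"
    by (rule range_eqI[of _ _ 1]) auto
qed (use flat_exp_poly_deriv in fastforce)

section \<open>Difference quotients, test functions and mollifiers\<close>

text \<open>The function spaces live on \<open>lebesgue_on D\<close>, while translation invariance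
  is available for \<open>lborel\<close>; functions vanishing off \<open>D\<close> can be moved from
  one to the other.\<close>

lemma integral_lebesgue_on_open:
  fixes f :: "'a::euclidean_space \<Rightarrow> real"
  assumes "open D" "f \<in> borel_measurable borel" "\<And>x. x \<notin> D \<Longrightarrow> f x = 0"
  shows "integral\<^sup>L (lebesgue_on D) f = integral\<^sup>L lborel f"
proof -
  have "integral\<^sup>L (lebesgue_on D) f = integral\<^sup>L lebesgue (\<lambda>x. indicator D x *\<^sub>R f x)"
    using assms(1) by (intro integral_restrict_space) auto
  also have "(\<lambda>x. indicator D x *\<^sub>R f x) = f"
    using assms(3) by (fastforce simp: indicator_def)
  finally show ?thesis using assms(2) by (simp add: integral_completion)
qed

lemma integrable_lebesgue_on_open:
  fixes f :: "'a::euclidean_space \<Rightarrow> real"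
  assumes "open D" "integrable lborel f"
  shows "integrable (lebesgue_on D) f"
proof -
  have "integrable lebesgue f" using assms(2) integrable_completion[of f lborel]
    by (metis borel_measurable_integrable measurable_lborel1)
  then show ?thesis
    using assms(1) by (subst integrable_restrict_space) (auto intro!: integrable_mult_indicator[where 'b = real, simplified])
qed

section \<open>Integrals on the whole space: translations, compact supports, difference
  quotients\<close>

lemma lborel_integral_translate:
  fixes f :: "'a::euclidean_space \<Rightarrow> real"
  assumes [measurable]: "f \<in> borel_measurable borel"
  shows "(\<integral>x. f (x + c) \<partial>lborel) = integral\<^sup>L lborel f"
proof -
  have "integral\<^sup>L lborel f = integral\<^sup>L (distr lborel borel ((+) c)) f"
    by (simp add: lborel_distr_plus)
  also have "\<dots> = (\<integral>x. f (c + x) \<partial>lborel)"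
    by (rule integral_distr) auto
  finally show ?thesis by (simp add: add.commute)
qed

lemma lborel_integrable_translate:
  fixes f :: "'a::euclidean_space \<Rightarrow> real"
  assumes [measurable]: "f \<in> borel_measurable borel" and "integrable lborel f"
  shows "integrable lborel (\<lambda>x. f (x + c))"
proof -
  have "integrable (distr lborel borel ((+) c)) f" using assms by (simp add: lborel_distr_plus)
  then show ?thesis by (subst (asm) integrable_distr_eq) (auto simp: add.commute)
qed

lemma continuous_compact_support_bounded:
  fixes f :: "'a::euclidean_space \<Rightarrow> real"
  assumes "continuous_on UNIV f" "compact K" "\<And>x. x \<notin> K \<Longrightarrow> f x = 0"
  obtains B where "B > 0" "\<And>x. \<bar>f x\<bar> \<le> B"
proof -
  have "bounded (f ` K)"
    using assms by (meson compact_continuous_image compact_imp_bounded continuous_on_subset subset_UNIV)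
  then obtain B where "B > 0" "\<And>x. x \<in> K \<Longrightarrow> \<bar>f x\<bar> \<le> B"
    unfolding bounded_pos by auto
  then show ?thesis using assms(3) by (intro that[of B]) (metis abs_zero less_imp_le)+
qed

lemma continuous_compact_support_integrable:
  fixes f :: "'a::euclidean_space \<Rightarrow> real"
  assumes "continuous_on UNIV f" "compact K" "\<And>x. x \<notin> K \<Longrightarrow> f x = 0"
  shows "integrable lborel f"
proof -
  obtain B where "B > 0" "\<And>x. \<bar>f x\<bar> \<le> B" using continuous_compact_support_bounded[OF assms] by blast
  moreover have "f \<in> borel_measurable borel" using assms(1) by (rule borel_measurable_continuous_onI)
  moreover have "K \<in> sets lborel" "emeasure lborel K < \<infinity>"
    using emeasure_bounded_finite[OF compact_imp_bounded[OF assms(2)]] assms(2)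
    by (auto intro: borel_closed compact_imp_closed)
  ultimately show ?thesis
    using assms(3) by (intro integrableI_bounded_set[of K _ _ B]) auto
qed

lemma zero_outside_support: "x \<notin> closure {x. f x \<noteq> 0} \<Longrightarrow> f x = 0"
  using closure_subset[of "{x. f x \<noteq> 0}"] by blast

lemma partial_deriv_zero_outside:
  assumes "x \<notin> closure {x. f x \<noteq> 0}"
  shows "partial_deriv i f x = 0"
proof -
  have "((\<lambda>x. 0) has_derivative (\<lambda>h. 0)) (at x)" by simp
  then have "(f has_derivative (\<lambda>h. 0)) (at x)"
    by (rule has_derivative_transform_within_open[of _ _ _ _ "- closure {x. f x \<noteq> 0}"])
       (use assms closure_subset[of "{x. f x \<noteq> 0}"] in auto)
  then show ?thesis using partial_deriv_eqI by blast
qed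

lemma grad_zero_outside: "x \<notin> closure {x. f x \<noteq> 0} \<Longrightarrow> grad f x = 0"
  unfolding grad_def by (simp add: partial_deriv_zero_outside)

lemma smooth_continuous_grad: "smooth f \<Longrightarrow> continuous_on S (grad f)"
  unfolding grad_def by (intro continuous_intros smooth_continuous smooth_partial_deriv)

lemma smooth_grad_bounded:
  assumes "smooth f" "compact (closure {x. f x \<noteq> 0})"
  obtains B where "B > 0" "\<And>x. norm (grad f x) \<le> B"
proof -
  obtain B where "B > 0" "\<And>x. \<bar>norm (grad f x)\<bar> \<le> B"
  proof (rule continuous_compact_support_bounded[OF _ assms(2), of "\<lambda>x. norm (grad f x)"])
    show "continuous_on UNIV (\<lambda>x. norm (grad f x))"
      using smooth_continuous_grad[OF assms(1)] by (intro continuous_intros)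
  qed (use grad_zero_outside in auto)
  then show ?thesis using that by auto
qed

lemma lipschitz_of_grad_bounded:
  assumes "\<And>x. f differentiable at x" "\<And>x. norm (grad f x) \<le> B"
  shows "\<bar>f y - f x\<bar> \<le> B * norm (y - x)"
proof -
  have "norm (f y - f x) \<le> B * norm (y - x)"
  proof (rule differentiable_bound[of UNIV f "\<lambda>x h. grad f x \<bullet> h"])
    fix x
    show "(f has_derivative (\<lambda>h. grad f x \<bullet> h)) (at x within UNIV)"
      using has_derivative_grad assms(1) by auto
    show "onorm (\<lambda>h. grad f x \<bullet> h) \<le> B"
    proof (rule onorm_le)
      fix h show "norm (grad f x \<bullet> h) \<le> B * norm h"
        using Cauchy_Schwarz_ineq2[of "grad f x" h] assms(2)[of x]
        by (smt (verit) mult_right_mono norm_ge_zero real_norm_def)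
    qed
  qed auto
  then show ?thesis by simp
qed

lemma difference_quotient_tendsto:
  assumes "f differentiable at x"
  shows "(\<lambda>n. real (Suc n) * (f (x + (1 / real (Suc n)) *\<^sub>R h) - f x)) \<longlonglongrightarrow> grad f x \<bullet> h"
proof -
  have "((\<lambda>t. f (x + t *\<^sub>R h)) has_derivative (\<lambda>t. grad f x \<bullet> (t *\<^sub>R h))) (at 0)"
    by (rule has_derivative_compose[where g = f]) 
      (use has_derivative_grad[OF assms] in \<open>auto intro!: derivative_eq_intros\<close>)
  then have "((\<lambda>t. f (x + t *\<^sub>R h)) has_real_derivative (grad f x \<bullet> h)) (at 0)"
    by (simp add: has_field_derivative_def) (metis mult_commute_abs)
  then have "((\<lambda>t. (f (x + t *\<^sub>R h) - f x) / t) \<longlongrightarrow> grad f x \<bullet> h) (at 0)"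
    by (simp add: DERIV_def)
  moreover have "filterlim (\<lambda>n. 1 / real (Suc n)) (at 0) sequentially"
    unfolding filterlim_at using LIMSEQ_Suc[OF lim_1_over_n] by auto
  ultimately have "(\<lambda>n. (f (x + (1 / real (Suc n)) *\<^sub>R h) - f x) / (1 / real (Suc n))) \<longlonglongrightarrow> grad f x \<bullet> h"
    by (rule filterlim_compose)
  then show ?thesis by (simp add: mult.commute)
qed

text \<open>A majorant independent of \<open>n\<close>: the step \<open>1 / (n + 1)\<close> is at
  most 1, so every shifted support stays in a ball enlarged by \<open>norm h\<close>. The
  \<open>+ 1\<close> in the witness for \<open>B\<close> keeps it positive when
  \<open>h = 0\<close>.\<close>

lemma difference_quotient_bound:
  assumes "smooth f" "compact (closure {x. f x \<noteq> 0})"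
  obtains B R where "B > 0" "R > 0"
    "\<And>n x. \<bar>real (Suc n) * (f (x + (1 / real (Suc n)) *\<^sub>R h) - f x)\<bar> \<le> B * indicator (cball 0 R) x"
proof -
  obtain B where B: "B > 0" "\<And>x. norm (grad f x) \<le> B" using smooth_grad_bounded[OF assms] by metis
  obtain R where R: "R > 0" "closure {x. f x \<noteq> 0} \<subseteq> cball 0 R"
    using assms(2) by (meson bounded_subset_ballD compact_imp_bounded ball_subset_cball subset_trans)
  have out: "f x = 0" if "norm x > R" for x
    using R(2) closure_subset[of "{x. f x \<noteq> 0}"] that by force
  show ?thesis
  proof (rule that[of "B * (norm h + 1)" "R + norm h"])
    fix n x
    show "\<bar>real (Suc n) * (f (x + (1 / real (Suc n)) *\<^sub>R h) - f x)\<bar> \<le> (B * (norm h + 1)) * indicator (cball 0 (R + norm h)) x"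
    proof (cases "norm x \<le> R + norm h")
      case True
      have "\<bar>f (x + (1 / real (Suc n)) *\<^sub>R h) - f x\<bar> \<le> B * norm ((1 / real (Suc n)) *\<^sub>R h)"
        using lipschitz_of_grad_bounded[OF smooth_differentiable[OF assms(1)] B(2), of "x + (1 / real (Suc n)) *\<^sub>R h" x] by simp
      then have "real (Suc n) * \<bar>f (x + (1 / real (Suc n)) *\<^sub>R h) - f x\<bar> \<le> real (Suc n) * (B * norm ((1 / real (Suc n)) *\<^sub>R h))"
        by (intro mult_left_mono) auto
      also have "\<dots> = B * norm h" by simp
      also have "\<dots> \<le> B * (norm h + 1)" using B(1) by simp
      finally show ?thesis using True by (simp add: abs_mult)
    next
      case False
      have "norm x \<le> norm (x + (1 / real (Suc n)) *\<^sub>R h) + norm ((1 / real (Suc n)) *\<^sub>R h)"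
        using norm_triangle_ineq4[of "x + (1 / real (Suc n)) *\<^sub>R h" "(1 / real (Suc n)) *\<^sub>R h"] by simp
      moreover have "norm ((1 / real (Suc n)) *\<^sub>R h) \<le> norm h"
        by (simp add: divide_le_eq mult_le_cancel_left1 algebra_simps)
      ultimately have "norm (x + (1 / real (Suc n)) *\<^sub>R h) > R" "norm x > R"
        using False norm_ge_zero[of h] by linarith+
      then show ?thesis using False out by simp
    qed
  next
    show "0 < B * (norm h + 1)" using B(1) by (simp add: add_nonneg_pos)
    show "0 < R + norm h" using R(1) by (simp add: add_pos_nonneg)
  qed
qed

text \<open>Each difference quotient has integral 0 by translation invariance, and the quotients
  converge to the partial derivative under a common majorant. This is the source of integration by
  parts for smooth functions.\<close>

lemma integral_partial_deriv_eq_0: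
  fixes f :: "'a::euclidean_space \<Rightarrow> real"
  assumes "smooth f" "compact (closure {x. f x \<noteq> 0})" "i \<in> Basis"
  shows "(\<integral>x. partial_deriv i f x \<partial>lborel) = 0"
proof -
  obtain B R where BR: "B > 0" "R > 0"
    "\<And>n x. \<bar>real (Suc n) * (f (x + (1 / real (Suc n)) *\<^sub>R i) - f x)\<bar> \<le> B * indicator (cball 0 R) x"
    using difference_quotient_bound[OF assms(1,2)] by metis
  have [measurable]: "f \<in> borel_measurable borel"
    using assms(1) by (intro borel_measurable_continuous_onI smooth_continuous)
  have [measurable]: "partial_deriv i f \<in> borel_measurable borel"
    using assms by (intro borel_measurable_continuous_onI smooth_continuous smooth_partial_deriv)
  have int: "integrable lborel f"
    by (rule continuous_compact_support_integrable[OF smooth_continuous[OF assms(1)] assms(2)])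
       (use closure_subset[of "{x. f x \<noteq> 0}"] in auto)
  have "(\<lambda>n. \<integral>x. real (Suc n) * (f (x + (1 / real (Suc n)) *\<^sub>R i) - f x) \<partial>lborel)
      \<longlonglongrightarrow> (\<integral>x. partial_deriv i f x \<partial>lborel)"
  proof (rule integral_dominated_convergence)
    show "integrable lborel (\<lambda>x::'a. B * indicator (cball 0 R) x)"
      using emeasure_bounded_finite[of "cball (0::'a) R"]
      by (intro integrable_mult_right integrable_real_indicator) auto
    show "AE x in lborel. (\<lambda>n. real (Suc n) * (f (x + (1 / real (Suc n)) *\<^sub>R i) - f x)) \<longlonglongrightarrow> partial_deriv i f x"
      using difference_quotient_tendsto[OF smooth_differentiable[OF assms(1)], of _ i] grad_inner_Basis[OF assms(3)]
      by auto
    show "AE x in lborel. norm (real (Suc n) * (f (x + (1 / real (Suc n)) *\<^sub>R i) - f x)) \<le> B * indicator (cball 0 R) x" for n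
      using BR(3) by (auto simp del: of_nat_Suc)
  qed measurable
  moreover have "(\<integral>x. real (Suc n) * (f (x + (1 / real (Suc n)) *\<^sub>R i) - f x) \<partial>lborel) = 0" for n
    by (simp only: integral_mult_right_zero Bochner_Integration.integral_diff[OF lborel_integrable_translate[OF _ int] int]
        lborel_integral_translate[of f] \<open>f \<in> borel_measurable borel\<close>) simp
  ultimately have "(\<lambda>n. 0) \<longlonglongrightarrow> (\<integral>x. partial_deriv i f x \<partial>lborel)" by simp
  then show ?thesis using LIMSEQ_unique tendsto_const by blast
qed

section \<open>Closure properties of test functions\<close>

lemma test_functions_iff:
  "f \<in> test_functions D \<longleftrightarrow> smooth f \<and> compact (closure {x. f x \<noteq> 0}) \<and> closure {x. f x \<noteq> 0} \<subseteq> D"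
  by (simp add: test_functions_def smooth_def)

lemma test_functionsD:
  assumes "f \<in> test_functions D"
  shows "smooth f" "compact (closure {x. f x \<noteq> 0})" "closure {x. f x \<noteq> 0} \<subseteq> D" "x \<notin> D \<Longrightarrow> f x = 0"
    "x \<notin> D \<Longrightarrow> grad f x = 0"
  using assms closure_subset[of "{x. f x \<noteq> 0}"] grad_zero_outside[of x f] by (auto simp: test_functions_iff)

lemma test_functionsI:
  assumes "smooth f" "compact K" "K \<subseteq> D" "\<And>x. x \<notin> K \<Longrightarrow> f x = 0"
  shows "f \<in> test_functions D"
proof -
  have "closure {x. f x \<noteq> 0} \<subseteq> K"
    using assms(2,4) by (intro closure_minimal compact_imp_closed) auto
  moreover from this have "compact (closure {x. f x \<noteq> 0})"
    using assms(2) bounded_subset[of K] by (simp only: compact_eq_bounded_closed closed_closure)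
  ultimately show ?thesis using assms by (auto simp: test_functions_iff)
qed

lemma test_functions_mult:
  assumes "f \<in> test_functions D" "smooth g"
  shows "(\<lambda>x. f x * g x) \<in> test_functions D"
proof (rule test_functionsI[of _ "closure {x. f x \<noteq> 0}"])
  show "smooth (\<lambda>x. f x * g x)" using test_functionsD(1)[OF assms(1)] assms(2) by (rule smooth_mult)
  show "f x * g x = 0" if "x \<notin> closure {x. f x \<noteq> 0}" for x
    using zero_outside_support[OF that] by simp
qed (use test_functionsD[OF assms(1)] in blast)+

lemma test_functions_comp:
  assumes "f \<in> test_functions D" "smooth_real G" "G 0 = 0"
  shows "(\<lambda>x. G (f x)) \<in> test_functions D"
proof (rule test_functionsI[of _ "closure {x. f x \<noteq> 0}"])
  show "smooth (\<lambda>x. G (f x))" using assms(2) test_functionsD(1)[OF assms(1)] by (rule smooth_comp)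
  show "G (f x) = 0" if "x \<notin> closure {x. f x \<noteq> 0}" for x
    using zero_outside_support[OF that] assms(3) by simp
qed (use test_functionsD[OF assms(1)] in blast)+

section \<open>Mollifiers\<close>

definition bump :: "nat \<Rightarrow> 'a::euclidean_space \<Rightarrow> real" where
  "bump n x = flat_exp ((1 / real (Suc n))\<^sup>2 - (norm x)\<^sup>2)"

text \<open>The kernel is even because \<open>bump\<close> is radial; hence the same kernel, as a
  function of \<open>x - y\<close>, has mass 1 in either variable.\<close>

definition mollifier :: "nat \<Rightarrow> 'a::euclidean_space \<Rightarrow> real" where
  "mollifier n x = bump n x * (1 / (\<integral>x. bump n (x::'a) \<partial>lborel))"

lemma bump_smooth: "smooth (bump n)"
  unfolding bump_def by (intro smooth_comp[OF smooth_real_flat_exp] smooth_diff smooth_const smooth_norm_sq)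

lemma bump_zero: "norm x \<ge> 1 / real (Suc n) \<Longrightarrow> bump n x = 0"
  using power_mono[of "1 / real (Suc n)" "norm x" 2] by (auto simp: bump_def flat_exp_def not_less simp del: of_nat_Suc)

text \<open>If the integral were 0, the nonnegative \<open>bump n\<close> would vanish almost
  everywhere, although it is positive on a ball, and balls are not negligible.\<close>

lemma bump_integral_pos: "(\<integral>x. bump n (x::'a::euclidean_space) \<partial>lborel) > 0"
proof -
  have int: "integrable lborel (bump n :: 'a \<Rightarrow> real)"
    by (rule continuous_compact_support_integrable[of _ "cball 0 (1 / real (Suc n))"])
       (auto intro: smooth_continuous[OF bump_smooth] bump_zero)
  have nn: "bump n x \<ge> 0" for x :: 'a by (simp add: bump_def flat_exp_def)
  have "(\<integral>x. bump n (x::'a) \<partial>lborel) \<noteq> 0"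
  proof
    assume "(\<integral>x. bump n (x::'a) \<partial>lborel) = 0"
    then have ae: "AE x in lborel. bump n (x::'a) = 0"
      using integral_nonneg_eq_0_iff_AE[OF int] nn by simp
    have "AE x in lborel. x \<notin> ball (0::'a) (1 / real (Suc n))"
      using ae
    proof eventually_elim
      case (elim x)
      have "bump n x > 0" if "norm x < 1 / real (Suc n)"
        using power_strict_mono[OF that, of 2] by (simp add: bump_def flat_exp_def)
      then show ?case using elim by auto
    qed
    then have "ball (0::'a) (1 / real (Suc n)) \<in> null_sets lborel"
      by (subst (asm) AE_iff_null_sets[symmetric]) auto
    then have "negligible (ball (0::'a) (1 / real (Suc n)))"
      by (simp add: negligible_iff_null_sets null_sets_completionI)
    then show False using open_not_negligible[of "ball (0::'a) (1 / real (Suc n))"] by simp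
  qed
  moreover have "(\<integral>x. bump n (x::'a) \<partial>lborel) \<ge> 0" using nn by simp
  ultimately show ?thesis by simp
qed

lemma mollifier_smooth: "smooth (mollifier n)"
  unfolding mollifier_def by (intro smooth_mult bump_smooth smooth_const)

lemma mollifier_zero: "norm x \<ge> 1 / real (Suc n) \<Longrightarrow> mollifier n x = 0"
  by (simp add: mollifier_def bump_zero)

lemma mollifier_nonneg: "mollifier n x \<ge> 0"
  unfolding mollifier_def using bump_integral_pos[of n, where 'a = 'a] by (simp add: bump_def flat_exp_def)

lemma mollifier_symmetric: "mollifier n (x - y) = mollifier n (y - x)"
  by (simp add: mollifier_def bump_def norm_minus_commute)

lemma mollifier_integrable: "integrable lborel (mollifier n)"
  by (rule continuous_compact_support_integrable[of _ "cball 0 (1 / real (Suc n))"])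
     (auto intro: smooth_continuous[OF mollifier_smooth] mollifier_zero)

lemma mollifier_measurable [measurable]: "mollifier n \<in> borel_measurable borel"
  by (intro borel_measurable_continuous_onI smooth_continuous mollifier_smooth)

lemma mollifier_integral: "(\<integral>y. mollifier n (x - y) \<partial>lborel) = 1"
proof -
  have "(\<integral>y. mollifier n (x - y) \<partial>lborel) = (\<integral>y. mollifier n (y + (- x)) \<partial>lborel)"
    by (rule Bochner_Integration.integral_cong) (auto simp: mollifier_symmetric[of n x])
  also have "\<dots> = (\<integral>y. mollifier n (y::'a) \<partial>lborel)" by (rule lborel_integral_translate) measurable
  also have "\<dots> = (\<integral>y. bump n (y::'a) \<partial>lborel) * (1 / (\<integral>x. bump n (x::'a) \<partial>lborel))"
    unfolding mollifier_def by simp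
  also have "\<dots> = 1" using bump_integral_pos[of n, where 'a = 'a] by simp
  finally show ?thesis .
qed

section \<open>The space of square integrable functions\<close>

lemma null_squeeze:
  fixes f g :: "nat \<Rightarrow> real"
  assumes "\<And>n. 0 \<le> f n" "\<And>n. f n \<le> g n" "g \<longlonglongrightarrow> 0"
  shows "f \<longlonglongrightarrow> 0"
  by (rule tendsto_sandwich[OF _ _ tendsto_const assms(3)]) (use assms in auto)

lemma L2_measurable: "u \<in> L2 D \<Longrightarrow> u \<in> borel_measurable (lebesgue_on D)"
  by (simp add: L2_def)

lemma L2_integrable_sq: "u \<in> L2 D \<Longrightarrow> integrable (lebesgue_on D) (\<lambda>x. (norm (u x))\<^sup>2)"
  by (simp add: L2_def)

lemma L2_norm_nonneg [simp]: "L2_norm D u \<ge> 0"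
  by (simp add: L2_norm_def)

lemma L2_norm_sq: "(L2_norm D u)\<^sup>2 = (\<integral>x. (norm (u x))\<^sup>2 \<partial>(lebesgue_on D))"
  by (simp add: L2_norm_def)

lemma L2_norm_minus: "L2_norm D (\<lambda>x. - u x) = L2_norm D u"
  by (simp add: L2_norm_def)

lemma L2_norm_diff_commute: "L2_norm D (\<lambda>x. u x - v x) = L2_norm D (\<lambda>x. v x - u x)"
  by (simp add: L2_norm_def norm_minus_commute)

lemma L2_norm_scaleR: "L2_norm D (\<lambda>x. c *\<^sub>R u x) = \<bar>c\<bar> * L2_norm D u"
proof -
  have "(\<integral>x. (norm (c *\<^sub>R u x))\<^sup>2 \<partial>(lebesgue_on D)) = c\<^sup>2 * (\<integral>x. (norm (u x))\<^sup>2 \<partial>(lebesgue_on D))"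
    by (simp add: power_mult_distrib)
  then show ?thesis by (simp add: L2_norm_def real_sqrt_mult)
qed

lemma L2_norm_cong_AE:
  fixes u v :: "'a::euclidean_space \<Rightarrow> 'b::euclidean_space"
  assumes "u \<in> borel_measurable (lebesgue_on D)" "v \<in> borel_measurable (lebesgue_on D)"
    "AE x in lebesgue_on D. u x = v x"
  shows "L2_norm D u = L2_norm D v"
  unfolding L2_norm_def
  by (rule arg_cong[where f = sqrt], rule integral_cong_AE) (use assms in auto)

lemma L2_dominated:
  fixes u :: "'a::euclidean_space \<Rightarrow> 'b::euclidean_space"
  assumes v: "v \<in> L2 D" and u: "u \<in> borel_measurable (lebesgue_on D)"
    and le: "AE x in lebesgue_on D. norm (u x) \<le> norm (v x)"
  shows "u \<in> L2 D"
proof -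
  have "integrable (lebesgue_on D) (\<lambda>x. (norm (u x))\<^sup>2)"
    by (rule Bochner_Integration.integrable_bound[OF L2_integrable_sq[OF v]])
       (use u le in \<open>auto elim!: eventually_mono intro!: power_mono\<close>)
  then show ?thesis using u by (simp add: L2_def)
qed

lemma L2_norm_mono:
  fixes u :: "'a::euclidean_space \<Rightarrow> 'b::euclidean_space"
  assumes v: "v \<in> L2 D" and u: "u \<in> borel_measurable (lebesgue_on D)"
    and le: "AE x in lebesgue_on D. norm (u x) \<le> norm (v x)"
  shows "L2_norm D u \<le> L2_norm D v"
  unfolding L2_norm_def
  by (rule real_sqrt_le_mono, rule integral_mono_AE)
     (use L2_integrable_sq[OF v] L2_integrable_sq[OF L2_dominated[OF assms]] le
       in \<open>auto elim!: eventually_mono intro!: power_mono\<close>)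

lemma L2_norm:
  fixes u :: "'a::euclidean_space \<Rightarrow> 'b::euclidean_space"
  shows "u \<in> L2 D \<Longrightarrow> (\<lambda>x. norm (u x)) \<in> L2 D"
  by (auto simp: L2_def)

lemma L2_zero: "(\<lambda>x. 0) \<in> L2 D"
  by (simp add: L2_def)

lemma L2_scaleR:
  fixes u :: "'a::euclidean_space \<Rightarrow> 'b::euclidean_space"
  shows "u \<in> L2 D \<Longrightarrow> (\<lambda>x. c *\<^sub>R u x) \<in> L2 D"
  by (auto simp: L2_def power_mult_distrib)

lemma L2_add:
  fixes u v :: "'a::euclidean_space \<Rightarrow> 'b::euclidean_space"
  assumes "u \<in> L2 D" "v \<in> L2 D"
  shows "(\<lambda>x. u x + v x) \<in> L2 D"
proof -
  have m: "(\<lambda>x. u x + v x) \<in> borel_measurable (lebesgue_on D)"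
    using assms by (auto simp: L2_def)
  have "integrable (lebesgue_on D) (\<lambda>x. 2 * (norm (u x))\<^sup>2 + 2 * (norm (v x))\<^sup>2)"
    using assms by (auto simp: L2_def)
  then have "integrable (lebesgue_on D) (\<lambda>x. (norm (u x + v x))\<^sup>2)"
  proof (rule Bochner_Integration.integrable_bound)
    have "(norm (u x + v x))\<^sup>2 \<le> 2 * (norm (u x))\<^sup>2 + 2 * (norm (v x))\<^sup>2" for x
    proof -
      have "(norm (u x + v x))\<^sup>2 \<le> (norm (u x) + norm (v x))\<^sup>2"
        by (intro power_mono norm_triangle_ineq) auto
      also have "\<dots> \<le> 2 * (norm (u x))\<^sup>2 + 2 * (norm (v x))\<^sup>2"
        using sum_squares_bound[of "norm (u x)" "norm (v x)"] by (simp add: power2_sum)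
      finally show ?thesis .
    qed
    then show "AE x in lebesgue_on D. norm ((norm (u x + v x))\<^sup>2) \<le> norm (2 * (norm (u x))\<^sup>2 + 2 * (norm (v x))\<^sup>2)"
      by auto
  qed (use m in auto)
  then show ?thesis using m by (simp add: L2_def)
qed

lemma L2_diff:
  fixes u v :: "'a::euclidean_space \<Rightarrow> 'b::euclidean_space"
  assumes "u \<in> L2 D" "v \<in> L2 D"
  shows "(\<lambda>x. u x - v x) \<in> L2 D"
  using L2_add[OF assms(1) L2_scaleR[OF assms(2), of "-1"]] by simp

lemma L2_bounded_scaleR:
  fixes u :: "'a::euclidean_space \<Rightarrow> 'b::euclidean_space"
  assumes u: "u \<in> L2 D" and c: "c \<in> borel_measurable (lebesgue_on D)"
    and b: "AE x in lebesgue_on D. \<bar>c x\<bar> \<le> K"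
  shows "(\<lambda>x. c x *\<^sub>R u x) \<in> L2 D" and "0 \<le> K \<Longrightarrow> L2_norm D (\<lambda>x. c x *\<^sub>R u x) \<le> K * L2_norm D u"
proof -
  have m: "(\<lambda>x. c x *\<^sub>R u x) \<in> borel_measurable (lebesgue_on D)"
    using L2_measurable[OF u] c by measurable
  have le: "AE x in lebesgue_on D. norm (c x *\<^sub>R u x) \<le> norm (K *\<^sub>R u x)"
    using b by eventually_elim (auto intro!: mult_right_mono)
  show "(\<lambda>x. c x *\<^sub>R u x) \<in> L2 D"
    by (rule L2_dominated[OF L2_scaleR[OF u] m le])
  show "L2_norm D (\<lambda>x. c x *\<^sub>R u x) \<le> K * L2_norm D u" if "0 \<le> K"
    using L2_norm_mono[OF L2_scaleR[OF u] m le] that by (simp add: L2_norm_scaleR)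
qed

lemma L2_inner_Basis:
  fixes u :: "'a::euclidean_space \<Rightarrow> 'b::euclidean_space"
  assumes "u \<in> L2 D" "i \<in> Basis"
  shows "(\<lambda>x. u x \<bullet> i) \<in> L2 D"
  by (rule L2_dominated[OF assms(1)])
     (use L2_measurable[OF assms(1)] Basis_le_norm[OF assms(2)] in auto)

lemma L2_norm_mult_integrable:
  fixes u :: "'a::euclidean_space \<Rightarrow> 'b::euclidean_space" and v :: "'a \<Rightarrow> 'c::euclidean_space"
  assumes "u \<in> L2 D" "v \<in> L2 D"
  shows "integrable (lebesgue_on D) (\<lambda>x. norm (u x) * norm (v x))"
proof -
  have "integrable (lebesgue_on D) (\<lambda>x. (norm (u x))\<^sup>2 + (norm (v x))\<^sup>2)"
    using assms by (auto simp: L2_def)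
  then show ?thesis
  proof (rule Bochner_Integration.integrable_bound)
    show "(\<lambda>x. norm (u x) * norm (v x)) \<in> borel_measurable (lebesgue_on D)"
      using assms by (auto simp: L2_def)
    have "norm (u x) * norm (v x) \<le> (norm (u x))\<^sup>2 + (norm (v x))\<^sup>2" for x
      using sum_squares_bound[of "norm (u x)" "norm (v x)"]
        mult_nonneg_nonneg[OF norm_ge_zero[of "u x"] norm_ge_zero[of "v x"]] by linarith
    then show "AE x in lebesgue_on D. norm (norm (u x) * norm (v x)) \<le> norm ((norm (u x))\<^sup>2 + (norm (v x))\<^sup>2)"
      by (auto simp: abs_mult)
  qed
qed

lemma L2_inner_integrable:
  fixes u v :: "'a::euclidean_space \<Rightarrow> 'b::euclidean_space"
  assumes "u \<in> L2 D" "v \<in> L2 D"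
  shows "integrable (lebesgue_on D) (\<lambda>x. u x \<bullet> v x)"
  by (rule Bochner_Integration.integrable_bound[OF L2_norm_mult_integrable[OF assms]])
     (use assms Cauchy_Schwarz_ineq2 in \<open>auto simp: L2_def\<close>)

lemma L2_mult_integrable:
  fixes u v :: "'a::euclidean_space \<Rightarrow> real"
  shows "u \<in> L2 D \<Longrightarrow> v \<in> L2 D \<Longrightarrow> integrable (lebesgue_on D) (\<lambda>x. u x * v x)"
  using L2_inner_integrable[of u D v] by simp

text \<open>The integral of the square of \<open>norm (u x) - t * norm (v x)\<close> is nonnegative
  for every \<open>t\<close>, and a good \<open>t\<close> gives the claim. Working with norms lets
  \<open>u\<close> and \<open>v\<close> take values in different spaces.\<close>

lemma L2_Cauchy_Schwarz_norm:
  fixes u :: "'a::euclidean_space \<Rightarrow> 'b::euclidean_space" and v :: "'a \<Rightarrow> 'c::euclidean_space"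
  assumes u: "u \<in> L2 D" and v: "v \<in> L2 D"
  shows "(\<integral>x. norm (u x) * norm (v x) \<partial>(lebesgue_on D)) \<le> L2_norm D u * L2_norm D v"
proof -
  let ?M = "lebesgue_on D" and ?p = "\<lambda>x. norm (u x)" and ?q = "\<lambda>x. norm (v x)"
  let ?W = "\<integral>x. ?p x * ?q x \<partial>?M" and ?U = "L2_norm D u" and ?V = "L2_norm D v"
  have key: "2 * t * ?W \<le> ?U\<^sup>2 + t\<^sup>2 * ?V\<^sup>2" for t
  proof -
    have "0 \<le> (\<integral>x. (?p x - t * ?q x)\<^sup>2 \<partial>?M)" by simp
    also have "\<dots> = (\<integral>x. (?p x)\<^sup>2 - 2 * t * (?p x * ?q x) + t\<^sup>2 * (?q x)\<^sup>2 \<partial>?M)"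
      by (simp add: power2_diff power_mult_distrib algebra_simps)
    also have "\<dots> = ?U\<^sup>2 - 2 * t * ?W + t\<^sup>2 * ?V\<^sup>2"
      using L2_integrable_sq[OF u] L2_integrable_sq[OF v] L2_norm_mult_integrable[OF u v]
      by (simp add: L2_norm_sq)
    finally show ?thesis by simp
  qed
  show ?thesis
  proof (rule ccontr)
    assume "\<not> ?thesis"
    then have W: "?W > ?U * ?V" "?W > 0"
      using mult_nonneg_nonneg[OF L2_norm_nonneg[of D u] L2_norm_nonneg[of D v]] by linarith+
    show False
    proof (cases "?V = 0")
      case True
      \<comment> \<open>With \<open>?V = 0\<close> the right side of \<open>key\<close> no longer
        depends on \<open>t\<close>; this \<open>t\<close> makes the left side
        \<open>?U\<^sup>2 + 1\<close>, a contradiction.\<close>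
      have "2 * ((?U\<^sup>2 + 1) / (2 * ?W)) * ?W = ?U\<^sup>2 + 1" using W(2) by simp
      then show False using key[of "(?U\<^sup>2 + 1) / (2 * ?W)"] True by simp
    next
      case False
      \<comment> \<open>The minimiser \<open>t = ?W / ?V\<^sup>2\<close> of the quadratic, with the
        inequality multiplied by \<open>?V\<^sup>2\<close>.\<close>
      have "2 * (?W / ?V\<^sup>2) * ?W * ?V\<^sup>2 \<le> (?U\<^sup>2 + (?W / ?V\<^sup>2)\<^sup>2 * ?V\<^sup>2) * ?V\<^sup>2"
        using key[of "?W / ?V\<^sup>2"] by (rule mult_right_mono) simp
      moreover have "2 * (?W / ?V\<^sup>2) * ?W * ?V\<^sup>2 = 2 * ?W\<^sup>2" "(?W / ?V\<^sup>2)\<^sup>2 * ?V\<^sup>2 * ?V\<^sup>2 = ?W\<^sup>2"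
        using False by (simp_all add: power2_eq_square field_simps)
      ultimately have "?W\<^sup>2 \<le> (?U * ?V)\<^sup>2" by (simp add: power_mult_distrib distrib_right)
      then have "?W \<le> ?U * ?V" by (rule power2_le_imp_le) simp
      then show False using W by simp
    qed
  qed
qed

lemma L2_Cauchy_Schwarz:
  fixes u v :: "'a::euclidean_space \<Rightarrow> 'b::euclidean_space"
  assumes "u \<in> L2 D" "v \<in> L2 D"
  shows "\<bar>\<integral>x. u x \<bullet> v x \<partial>(lebesgue_on D)\<bar> \<le> L2_norm D u * L2_norm D v"
proof -
  have "\<bar>\<integral>x. u x \<bullet> v x \<partial>(lebesgue_on D)\<bar> \<le> (\<integral>x. \<bar>u x \<bullet> v x\<bar> \<partial>(lebesgue_on D))"
    using integral_norm_bound[of "lebesgue_on D" "\<lambda>x. u x \<bullet> v x"] by simp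
  also have "\<dots> \<le> (\<integral>x. norm (u x) * norm (v x) \<partial>(lebesgue_on D))"
    using L2_inner_integrable[OF assms] L2_norm_mult_integrable[OF assms]
    by (intro integral_mono) (auto intro: Cauchy_Schwarz_ineq2)
  also have "\<dots> \<le> L2_norm D u * L2_norm D v" by (rule L2_Cauchy_Schwarz_norm[OF assms])
  finally show ?thesis .
qed

lemma L2_norm_triangle:
  fixes u v :: "'a::euclidean_space \<Rightarrow> 'b::euclidean_space"
  assumes u: "u \<in> L2 D" and v: "v \<in> L2 D"
  shows "L2_norm D (\<lambda>x. u x + v x) \<le> L2_norm D u + L2_norm D v"
proof (rule power2_le_imp_le)
  have "(L2_norm D (\<lambda>x. u x + v x))\<^sup>2
      = (\<integral>x. (norm (u x))\<^sup>2 + 2 * (u x \<bullet> v x) + (norm (v x))\<^sup>2 \<partial>(lebesgue_on D))"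
    unfolding L2_norm_sq
    by (simp add: power2_norm_eq_inner inner_add_left inner_add_right inner_commute algebra_simps)
  also have "\<dots> = (L2_norm D u)\<^sup>2 + 2 * (\<integral>x. u x \<bullet> v x \<partial>(lebesgue_on D)) + (L2_norm D v)\<^sup>2"
    using L2_integrable_sq[OF u] L2_integrable_sq[OF v] L2_inner_integrable[OF u v]
    by (simp add: L2_norm_sq)
  also have "\<dots> \<le> (L2_norm D u + L2_norm D v)\<^sup>2"
    using L2_Cauchy_Schwarz[OF u v] by (simp add: power2_sum)
  finally show "(L2_norm D (\<lambda>x. u x + v x))\<^sup>2 \<le> (L2_norm D u + L2_norm D v)\<^sup>2" .
qed simp

lemma L2_norm_triangle_diff:
  fixes u v :: "'a::euclidean_space \<Rightarrow> 'b::euclidean_space"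
  assumes u: "u \<in> L2 D" and v: "v \<in> L2 D"
  shows "\<bar>L2_norm D u - L2_norm D v\<bar> \<le> L2_norm D (\<lambda>x. u x - v x)"
  using L2_norm_triangle[OF L2_diff[OF u v] v] L2_norm_triangle[OF L2_diff[OF v u] u]
    L2_norm_diff_commute[of D u v] by simp

text \<open>Membership is part of the notion because \<open>L2_norm\<close> is meaningless outside
  the space: a divergent integral is 0 by default.\<close>

definition L2_tendsto ::
  "'a::euclidean_space set \<Rightarrow> (nat \<Rightarrow> 'a \<Rightarrow> 'b::euclidean_space) \<Rightarrow> ('a \<Rightarrow> 'b) \<Rightarrow> bool" where
  "L2_tendsto D f g \<longleftrightarrow> (\<forall>n. f n \<in> L2 D) \<and> g \<in> L2 D \<and> (\<lambda>n. L2_norm D (\<lambda>x. f n x - g x)) \<longlonglongrightarrow> 0"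

lemma L2_tendstoD:
  assumes "L2_tendsto D f g"
  shows "f n \<in> L2 D" "g \<in> L2 D" "(\<lambda>n. L2_norm D (\<lambda>x. f n x - g x)) \<longlonglongrightarrow> 0"
  using assms by (auto simp: L2_tendsto_def)

lemma L2_tendsto_subseq: "L2_tendsto D f g \<Longrightarrow> strict_mono r \<Longrightarrow> L2_tendsto D (\<lambda>n. f (r n)) g"
  unfolding L2_tendsto_def
  using LIMSEQ_subseq_LIMSEQ[of "\<lambda>n. L2_norm D (\<lambda>x. f n x - g x)" 0 r] by (simp add: o_def)

lemma L2_tendsto_inner:
  assumes "L2_tendsto D f g" "w \<in> L2 D"
  shows "(\<lambda>n. \<integral>x. f n x \<bullet> w x \<partial>(lebesgue_on D)) \<longlonglongrightarrow> (\<integral>x. g x \<bullet> w x \<partial>(lebesgue_on D))"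
proof (rule LIM_zero_cancel, rule Lim_null_comparison)
  note L = L2_tendstoD[OF assms(1)]
  have "(\<integral>x. f n x \<bullet> w x \<partial>(lebesgue_on D)) - (\<integral>x. g x \<bullet> w x \<partial>(lebesgue_on D))
      = (\<integral>x. (f n x - g x) \<bullet> w x \<partial>(lebesgue_on D))" for n
    using L2_inner_integrable[OF L(1) assms(2)] L2_inner_integrable[OF L(2) assms(2)]
    by (simp add: inner_diff_left)
  then show "\<forall>\<^sub>F n in sequentially.
      norm ((\<integral>x. f n x \<bullet> w x \<partial>(lebesgue_on D)) - (\<integral>x. g x \<bullet> w x \<partial>(lebesgue_on D)))
      \<le> L2_norm D (\<lambda>x. f n x - g x) * L2_norm D w"
    using L2_Cauchy_Schwarz[OF L2_diff[OF L(1) L(2)] assms(2)] by simp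
  show "(\<lambda>n. L2_norm D (\<lambda>x. f n x - g x) * L2_norm D w) \<longlonglongrightarrow> 0"
    using tendsto_mult_right[OF L(3)] by simp
qed

lemma L2_tendsto_mult:
  fixes f :: "nat \<Rightarrow> 'a::euclidean_space \<Rightarrow> real"
  assumes "L2_tendsto D f g" "w \<in> L2 D"
  shows "(\<lambda>n. \<integral>x. f n x * w x \<partial>(lebesgue_on D)) \<longlonglongrightarrow> (\<integral>x. g x * w x \<partial>(lebesgue_on D))"
  using L2_tendsto_inner[OF assms] by simp

lemma L2_tendsto_norm:
  assumes "L2_tendsto D f g"
  shows "(\<lambda>n. L2_norm D (f n)) \<longlonglongrightarrow> L2_norm D g"
proof (rule LIM_zero_cancel, rule Lim_null_comparison)
  note L = L2_tendstoD[OF assms(1)]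
  show "\<forall>\<^sub>F n in sequentially. norm (L2_norm D (f n) - L2_norm D g) \<le> L2_norm D (\<lambda>x. f n x - g x)"
    using L2_norm_triangle_diff[OF L(1) L(2)] by simp
qed (rule L2_tendstoD[OF assms])

lemma L2_tendsto_abs:
  assumes "L2_tendsto D f g"
  shows "L2_tendsto D (\<lambda>n x. norm (f n x)) (\<lambda>x. norm (g x))"
proof -
  note L = L2_tendstoD[OF assms]
  have "L2_norm D (\<lambda>x. norm (f n x) - norm (g x)) \<le> L2_norm D (\<lambda>x. f n x - g x)" for n
    by (rule L2_norm_mono[OF L2_diff[OF L(1,2)]])
       (use L2_measurable[OF L(1)] L2_measurable[OF L(2)] norm_triangle_ineq3 in auto)
  then have "(\<lambda>n. L2_norm D (\<lambda>x. norm (f n x) - norm (g x))) \<longlonglongrightarrow> 0"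
    by (intro Lim_null_comparison[OF _ L(3)]) auto
  then show ?thesis using L by (auto simp: L2_tendsto_def intro: L2_norm)
qed

text \<open>Convergence in \<open>L2\<close> is convergence of the squared distances in the mean, to
  which the subsequence theorem for integrable functions applies.\<close>

lemma L2_tendsto_AE_subseq:
  assumes "L2_tendsto D f g"
  obtains r :: "nat \<Rightarrow> nat" where "strict_mono r" "AE x in lebesgue_on D. (\<lambda>n. f (r n) x) \<longlonglongrightarrow> g x"
proof -
  note L = L2_tendstoD[OF assms]
  have "\<exists>r::nat\<Rightarrow>nat. strict_mono r \<and>
      (AE x in lebesgue_on D. (\<lambda>n. (norm (f (r n) x - g x))\<^sup>2) \<longlonglongrightarrow> 0)"
  proof (rule tendsto_L1_AE_subseq)
    show "integrable (lebesgue_on D) (\<lambda>x. (norm (f n x - g x))\<^sup>2)" for n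
      by (rule L2_integrable_sq[OF L2_diff[OF L(1,2)]])
    show "(\<lambda>n. \<integral>x. norm ((norm (f n x - g x))\<^sup>2) \<partial>(lebesgue_on D)) \<longlonglongrightarrow> 0"
      using tendsto_power[OF L(3), of 2] by (simp add: L2_norm_sq)
  qed
  then obtain r where r: "strict_mono r" "AE x in lebesgue_on D. (\<lambda>n. (norm (f (r n) x - g x))\<^sup>2) \<longlonglongrightarrow> 0"
    by blast
  from r(2) have "AE x in lebesgue_on D. (\<lambda>n. f (r n) x) \<longlonglongrightarrow> g x"
  proof eventually_elim
    case (elim x)
    from tendsto_real_sqrt[OF elim] show ?case
      by (simp add: tendsto_norm_zero_iff LIM_zero_iff)
  qed
  with r(1) show ?thesis by (rule that)
qed

lemma L2_tendsto_dominated: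
  fixes f :: "nat \<Rightarrow> 'a::euclidean_space \<Rightarrow> 'b::euclidean_space"
  assumes h: "h \<in> L2 D" and f: "\<And>n. f n \<in> borel_measurable (lebesgue_on D)"
    and g: "g \<in> borel_measurable (lebesgue_on D)"
    and lim: "AE x in lebesgue_on D. (\<lambda>n. f n x) \<longlonglongrightarrow> g x"
    and le: "\<And>n. AE x in lebesgue_on D. norm (f n x) \<le> norm (h x)"
  shows "L2_tendsto D f g"
proof -
  have fL: "f n \<in> L2 D" for n by (rule L2_dominated[OF h f le])
  have leg: "AE x in lebesgue_on D. norm (g x) \<le> norm (h x)"
  proof -
    have "AE x in lebesgue_on D. \<forall>n. norm (f n x) \<le> norm (h x)" using le by (simp add: AE_all_countable)
    with lim show ?thesis
      by eventually_elim (rule Lim_norm_ubound, auto)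
  qed
  have gL: "g \<in> L2 D" by (rule L2_dominated[OF h g leg])
  have "(\<lambda>n. \<integral>x. (norm (f n x - g x))\<^sup>2 \<partial>(lebesgue_on D)) \<longlonglongrightarrow> (\<integral>x. 0 \<partial>(lebesgue_on D))"
  proof (rule integral_dominated_convergence)
    show "integrable (lebesgue_on D) (\<lambda>x. 4 * (norm (h x))\<^sup>2)"
      using L2_integrable_sq[OF h] by simp
    show "AE x in lebesgue_on D. (\<lambda>n. (norm (f n x - g x))\<^sup>2) \<longlonglongrightarrow> 0"
      using lim
    proof eventually_elim
      case (elim x)
      have "(\<lambda>n. (norm (f n x - g x))\<^sup>2) \<longlonglongrightarrow> (norm (g x - g x))\<^sup>2"
        by (intro tendsto_intros elim)
      then show ?case by simp
    qed
    show "AE x in lebesgue_on D. norm ((norm (f n x - g x))\<^sup>2) \<le> 4 * (norm (h x))\<^sup>2" for n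
      using le[of n] leg
    proof eventually_elim
      case (elim x)
      have "norm (f n x - g x) \<le> 2 * norm (h x)"
        using norm_triangle_ineq4[of "f n x" "g x"] elim by linarith
      then have "(norm (f n x - g x))\<^sup>2 \<le> (2 * norm (h x))\<^sup>2" by (rule power_mono) auto
      then show ?case by (simp add: power_mult_distrib)
    qed
  qed (use f g in auto)
  then have "(\<lambda>n. L2_norm D (\<lambda>x. f n x - g x)) \<longlonglongrightarrow> 0"
    unfolding L2_norm_def
    using tendsto_real_sqrt[of "\<lambda>n. \<integral>x. (norm (f n x - g x))\<^sup>2 \<partial>(lebesgue_on D)" 0] by simp
  then show ?thesis using fL gL by (simp add: L2_tendsto_def)
qed

lemma L2_tendsto_bounded_scaleR:
  assumes "L2_tendsto D f g" and c: "c \<in> borel_measurable (lebesgue_on D)"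
    and b: "AE x in lebesgue_on D. \<bar>c x\<bar> \<le> K" and K: "0 \<le> K"
  shows "L2_tendsto D (\<lambda>n x. c x *\<^sub>R f n x) (\<lambda>x. c x *\<^sub>R g x)"
proof -
  note L = L2_tendstoD[OF assms(1)]
  have "L2_norm D (\<lambda>x. c x *\<^sub>R f n x - c x *\<^sub>R g x) \<le> K * L2_norm D (\<lambda>x. f n x - g x)" for n
    using L2_bounded_scaleR(2)[OF L2_diff[OF L(1,2)] c b K] by (simp add: scaleR_diff_right)
  moreover have "(\<lambda>n. K * L2_norm D (\<lambda>x. f n x - g x)) \<longlonglongrightarrow> 0"
    using tendsto_mult_left[OF L(3)] by simp
  ultimately have "(\<lambda>n. L2_norm D (\<lambda>x. c x *\<^sub>R f n x - c x *\<^sub>R g x)) \<longlonglongrightarrow> 0"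
    by (rule null_squeeze[rotated]) simp
  then show ?thesis using L2_bounded_scaleR(1)[OF L(1) c b] L2_bounded_scaleR(1)[OF L(2) c b]
    by (simp add: L2_tendsto_def)
qed

lemma L2_tendsto_add:
  assumes "L2_tendsto D f g" "L2_tendsto D f' g'"
  shows "L2_tendsto D (\<lambda>n x. f n x + f' n x) (\<lambda>x. g x + g' x)"
proof -
  note L = L2_tendstoD[OF assms(1)] and L' = L2_tendstoD[OF assms(2)]
  have "L2_norm D (\<lambda>x. (f n x + f' n x) - (g x + g' x))
      \<le> L2_norm D (\<lambda>x. f n x - g x) + L2_norm D (\<lambda>x. f' n x - g' x)" for n
    using L2_norm_triangle[OF L2_diff[OF L(1,2)] L2_diff[OF L'(1,2)]] by (simp add: algebra_simps)
  moreover have "(\<lambda>n. L2_norm D (\<lambda>x. f n x - g x) + L2_norm D (\<lambda>x. f' n x - g' x)) \<longlonglongrightarrow> 0"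
    using tendsto_add[OF L(3) L'(3)] by simp
  ultimately have "(\<lambda>n. L2_norm D (\<lambda>x. (f n x + f' n x) - (g x + g' x))) \<longlonglongrightarrow> 0"
    by (rule null_squeeze[rotated]) simp
  then show ?thesis using L L' by (auto simp: L2_tendsto_def intro: L2_add)
qed

lemma L2_finite_measureI:
  fixes u :: "'a::euclidean_space \<Rightarrow> 'b::euclidean_space"
  assumes "D \<in> lmeasurable" "u \<in> borel_measurable (lebesgue_on D)" "AE x in lebesgue_on D. norm (u x) \<le> K"
  shows "u \<in> L2 D"
proof (rule L2_dominated[OF _ assms(2)])
  show "(\<lambda>x. K) \<in> L2 D"
    using finite_measure.integrable_const[OF finite_measure_lebesgue_on[OF assms(1)]] by (simp add: L2_def)
  show "AE x in lebesgue_on D. norm (u x) \<le> norm K" using assms(3) by eventually_elim simp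
qed

lemma L2_imp_integrable:
  fixes u :: "'a::euclidean_space \<Rightarrow> real"
  assumes "D \<in> lmeasurable" "u \<in> L2 D"
  shows "integrable (lebesgue_on D) u"
  using L2_mult_integrable[OF assms(2) L2_finite_measureI[OF assms(1), of "\<lambda>x. 1" 1]] by simp

section \<open>Mollification and the fundamental lemma\<close>

lemma ident_measurable_lebesgue_on: "(\<lambda>x. x) \<in> borel_measurable (lebesgue_on D)"
  by (intro measurable_restrict_space1 measurable_completion) simp

lemma borel_measurable_lebesgue_on:
  "f \<in> borel_measurable borel \<Longrightarrow> f \<in> borel_measurable (lebesgue_on D)"
  by (intro measurable_restrict_space1 measurable_completion) simp

lemma abs_integral_le:
  fixes f g :: "'a \<Rightarrow> real"
  assumes "integrable M f" "integrable M g" "\<And>x. \<bar>f x\<bar> \<le> g x"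
  shows "\<bar>integral\<^sup>L M f\<bar> \<le> integral\<^sup>L M g"
proof -
  have "\<bar>integral\<^sup>L M f\<bar> \<le> (\<integral>x. \<bar>f x\<bar> \<partial>M)"
    using integral_norm_bound[of M f] by simp
  also have "\<dots> \<le> integral\<^sup>L M g"
    using assms by (intro integral_mono) auto
  finally show ?thesis .
qed

locale bounded_open =
  fixes D :: "'a::euclidean_space set"
  assumes open_D: "open D" and bounded_D: "bounded D"
begin

section \<open>Finite measure of the domain and density of bounded continuous functions\<close>

abbreviation M :: "'a measure" where "M \<equiv> lebesgue_on D"

lemma lmeasurable_D: "D \<in> lmeasurable"
  by (rule lmeasurable_open[OF bounded_D open_D])

lemma finite_measure_D: "finite_measure M"
  by (rule finite_measure_lebesgue_on[OF lmeasurable_D])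

lemma pair_sigma_finite_D: "pair_sigma_finite M M"
  using finite_measure_D by (simp add: pair_sigma_finite_def finite_measure_def)

lemma L2_const: "(\<lambda>x. c :: 'b::euclidean_space) \<in> L2 D"
  by (rule L2_finite_measureI[OF lmeasurable_D, of _ "norm c"]) auto

lemma L2_continuous_bounded:
  fixes k :: "'a \<Rightarrow> real"
  assumes "continuous_on UNIV k" "\<And>x. \<bar>k x\<bar> \<le> C"
  shows "k \<in> L2 D"
  by (rule L2_finite_measureI[OF lmeasurable_D, of _ C])
     (use assms in \<open>auto intro!: borel_measurable_lebesgue_on borel_measurable_continuous_onI\<close>)

text \<open>Measurability on \<open>D\<close> supplies continuous functions converging almost
  everywhere. Clamping them to \<open>[-m, m]\<close> keeps continuity, does not change the limit,
  and yields a constant majorant, which is in \<open>L2\<close> since \<open>D\<close> has finite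
  measure.\<close>

lemma L2_bounded_dense:
  fixes B :: "'a \<Rightarrow> real"
  assumes B: "B \<in> borel_measurable M" "\<And>x. \<bar>B x\<bar> \<le> m"
  obtains g where "\<And>n. continuous_on UNIV (g n)" "\<And>n x. \<bar>g n x\<bar> \<le> m" "L2_tendsto D g B"
proof -
  have m: "m \<ge> 0" using B(2)[of undefined] by linarith
  have "B measurable_on D"
    using B(1) lmeasurable_D by (simp add: measurable_on_iff_borel_measurable fmeasurableD)
  then obtain N g where N: "negligible N" and g: "\<And>n. continuous_on UNIV (g n)"
    "\<And>x. x \<notin> N \<Longrightarrow> (\<lambda>n. g n x) \<longlonglongrightarrow> (if x \<in> D then B x else 0)"
    unfolding measurable_on_def by metis
  define h where "h n x = max (-m) (min m (g n x))" for n x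
  have h: "continuous_on UNIV (h n)" "\<bar>h n x\<bar> \<le> m" for n x
    unfolding h_def using g(1) m by (auto intro!: continuous_intros)
  have lim: "AE x in M. (\<lambda>n. h n x) \<longlonglongrightarrow> B x"
  proof -
    have "AE x in lebesgue. x \<notin> N"
      using N by (auto simp: negligible_iff_null_sets intro: AE_not_in)
    then have "AE x in lebesgue. x \<in> D \<longrightarrow> (\<lambda>n. h n x) \<longlonglongrightarrow> B x"
    proof eventually_elim
      case (elim x)
      show ?case
      proof
        assume "x \<in> D"
        then have "(\<lambda>n. g n x) \<longlonglongrightarrow> B x" using g(2)[OF elim] by simp
        then have "(\<lambda>n. h n x) \<longlonglongrightarrow> max (-m) (min m (B x))"
          unfolding h_def by (intro tendsto_max tendsto_min tendsto_const)
        moreover have "max (-m) (min m (B x)) = B x" using B(2)[of x] by auto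
        ultimately show "(\<lambda>n. h n x) \<longlonglongrightarrow> B x" by simp
      qed
    qed
    then show ?thesis
      using lmeasurable_D by (subst AE_restrict_space_iff) auto
  qed
  have "L2_tendsto D h B"
    by (rule L2_tendsto_dominated[OF L2_const[of m] _ B(1) lim])
       (use h m in \<open>auto intro!: borel_measurable_lebesgue_on borel_measurable_continuous_onI\<close>)
  with h show ?thesis by (rule that)
qed

text \<open>Clamping \<open>B\<close> at a large height \<open>n\<close> costs \<open>e / 2\<close>,
  and the bounded case approximates the clamped function at the cost of another
  \<open>e / 2\<close>.\<close>

lemma L2_dense:
  fixes B :: "'a \<Rightarrow> real"
  assumes B: "B \<in> L2 D" and "e > 0"
  obtains k C where "continuous_on UNIV k" "\<And>x. \<bar>k x\<bar> \<le> C" "L2_norm D (\<lambda>x. B x - k x) < e"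
proof -
  define b where "b n x = max (- real n) (min (real n) (B x))" for n x
  have [measurable]: "B \<in> borel_measurable M" by (rule L2_measurable[OF B])
  have bm: "b n \<in> borel_measurable M" for n unfolding b_def by measurable
  have bb: "\<bar>b n x\<bar> \<le> real n" for n x by (auto simp: b_def)
  have "L2_tendsto D b B"
  proof (rule L2_tendsto_dominated[OF B bm])
    show "AE x in M. (\<lambda>n. b n x) \<longlonglongrightarrow> B x"
    proof (rule AE_I2)
      fix x
      have "eventually (\<lambda>n. b n x = B x) sequentially"
        using eventually_ge_at_top[of "nat \<lceil>\<bar>B x\<bar>\<rceil>"]
      proof eventually_elim
        case (elim n)
        then have "\<bar>B x\<bar> \<le> real n" by linarith
        then show ?case by (auto simp: b_def)
      qed
      then show "(\<lambda>n. b n x) \<longlonglongrightarrow> B x" by (rule tendsto_eventually)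
    qed
    show "AE x in M. norm (b n x) \<le> norm (B x)" for n
      by (auto simp: b_def max_def min_def)
  qed measurable
  note L = L2_tendstoD[OF this]
  have "eventually (\<lambda>n. L2_norm D (\<lambda>x. b n x - B x) < e / 2) sequentially"
    using \<open>e > 0\<close> by (intro order_tendstoD(2)[OF L(3)]) simp
  then obtain n where n: "L2_norm D (\<lambda>x. b n x - B x) < e / 2"
    using eventually_happens'[OF sequentially_bot] by blast
  obtain g where g: "\<And>j. continuous_on UNIV (g j)" "\<And>j x. \<bar>g j x\<bar> \<le> real n" "L2_tendsto D g (b n)"
    using L2_bounded_dense[OF bm bb] by blast
  note G = L2_tendstoD[OF g(3)]
  have "eventually (\<lambda>j. L2_norm D (\<lambda>x. g j x - b n x) < e / 2) sequentially"
    using \<open>e > 0\<close> by (intro order_tendstoD(2)[OF G(3)]) simp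
  then obtain j where j: "L2_norm D (\<lambda>x. g j x - b n x) < e / 2"
    using eventually_happens'[OF sequentially_bot] by blast
  have "L2_norm D (\<lambda>x. B x - g j x) = L2_norm D (\<lambda>x. g j x - B x)" by (rule L2_norm_diff_commute)
  also have "\<dots> \<le> L2_norm D (\<lambda>x. g j x - b n x) + L2_norm D (\<lambda>x. b n x - B x)"
    using L2_norm_triangle[OF L2_diff[OF G(1,2), of j] L2_diff[OF L(1,2), of n]] by simp
  finally show ?thesis using g(1,2) n j by (intro that[of "g j" "real n"]) auto
qed

section \<open>Double integrals against the mollifier\<close>

lemma product_kernel_integrable:
  fixes A B :: "'a \<Rightarrow> real"
  assumes A: "integrable M A" and B: "integrable M B"
    and k: "continuous_on UNIV k" "\<And>x. \<bar>k x\<bar> \<le> (C::real)"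
  shows "integrable (M \<Otimes>\<^sub>M M) (\<lambda>(x, y). A x * B y * k (x - y))"
proof -
  interpret pair_sigma_finite M M by (rule pair_sigma_finite_D)
  note [measurable] = borel_measurable_integrable[OF A] borel_measurable_integrable[OF B]
    ident_measurable_lebesgue_on[of D] borel_measurable_continuous_onI[OF k(1)]
  have "integrable (M \<Otimes>\<^sub>M M) (\<lambda>(x, y). A x * B y)"
  proof (rule Fubini_integrable)
    show "integrable M (\<lambda>x. \<integral>y. norm (case (x, y) of (x, y) \<Rightarrow> A x * B y) \<partial>M)"
      using A by (simp add: abs_mult)
    show "AE x in M. integrable M (\<lambda>y. case (x, y) of (x, y) \<Rightarrow> A x * B y)"
      using B by simp
  qed measurable
  then have "integrable (M \<Otimes>\<^sub>M M) (\<lambda>p. C * (case p of (x, y) \<Rightarrow> A x * B y))"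
    by simp
  then show ?thesis
  proof (rule Bochner_Integration.integrable_bound)
    have [measurable]: "(\<lambda>p. fst p - snd p) \<in> borel_measurable (M \<Otimes>\<^sub>M M)"
      by measurable
    show "(\<lambda>(x, y). A x * B y * k (x - y)) \<in> borel_measurable (M \<Otimes>\<^sub>M M)"
      unfolding split_beta by measurable
    have "\<bar>A x * B y * k z\<bar> \<le> \<bar>C * (A x * B y)\<bar>" for x y z
      using mult_left_mono[OF k(2)[of z], of "\<bar>A x * B y\<bar>"] k(2)[of z]
      by (simp add: abs_mult mult.commute)
    then show "AE p in M \<Otimes>\<^sub>M M.
        norm (case p of (x, y) \<Rightarrow> A x * B y * k (x - y)) \<le> norm (C * (case p of (x, y) \<Rightarrow> A x * B y))"
      by (auto simp: split_beta)
  qed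
qed

lemma mollifier_bounded: "\<exists>C. \<forall>x::'a. \<bar>mollifier n x\<bar> \<le> C"
proof -
  have "mollifier n x = 0" if "x \<notin> cball 0 (1 / real (Suc n))" for x :: 'a
    using that by (intro mollifier_zero) simp
  from continuous_compact_support_bounded[OF smooth_continuous[OF mollifier_smooth] compact_cball this]
  show ?thesis by metis
qed

lemma mollified_product_integrable:
  fixes A B :: "'a \<Rightarrow> real"
  assumes "integrable M A" "integrable M B"
  shows "integrable (M \<Otimes>\<^sub>M M) (\<lambda>(x, y). A x * B y * mollifier n (x - y))"
proof -
  obtain C where "\<And>x::'a. \<bar>mollifier n x\<bar> \<le> C" using mollifier_bounded[of n] by blast
  then show ?thesis by (rule product_kernel_integrable[OF assms smooth_continuous[OF mollifier_smooth]])
qed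

text \<open>The pairing of \<open>A\<close> with the mollification of \<open>B\<close>. As a double
  integral over \<open>D\<close> it asks for no extension of either function beyond
  \<open>D\<close>, and Fubini lets either factor carry the kernel.\<close>

definition mollified_form :: "nat \<Rightarrow> ('a \<Rightarrow> real) \<Rightarrow> ('a \<Rightarrow> real) \<Rightarrow> real" where
  "mollified_form n A B = (\<integral>x. \<integral>y. A x * B y * mollifier n (x - y) \<partial>M \<partial>M)"

lemma mollifier_shift_integrable: "integrable lborel (\<lambda>y. mollifier n (x - y :: 'a))"
proof -
  have "integrable lborel (\<lambda>y. mollifier n (y + (- x) :: 'a))"
    by (rule lborel_integrable_translate[OF _ mollifier_integrable]) measurable
  then show ?thesis by (simp add: mollifier_symmetric[of n x])
qed

text \<open>Only an inequality: close to the boundary part of the unit mass of the kernel may lie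
  outside \<open>D\<close>.\<close>

lemma mollifier_integral_le: "(\<integral>y. mollifier n (x - y) \<partial>M) \<le> 1"
proof -
  have i: "integrable lebesgue (\<lambda>y. mollifier n (x - y))"
    using mollifier_shift_integrable[of n x] by (subst integrable_completion) auto
  have D: "D \<in> sets lebesgue" using lmeasurable_D by auto
  have "(\<integral>y. mollifier n (x - y) \<partial>M) = (\<integral>y. indicator D y *\<^sub>R mollifier n (x - y) \<partial>lebesgue)"
    using D by (intro integral_restrict_space) auto
  also have "\<dots> \<le> (\<integral>y. mollifier n (x - y) \<partial>lebesgue)"
    using i D by (intro integral_mono integrable_mult_indicator) (auto simp: indicator_def mollifier_nonneg)
  also have "\<dots> = (\<integral>y. mollifier n (x - y) \<partial>lborel)"
    by (rule integral_completion) measurable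
  finally show ?thesis by (simp add: mollifier_integral)
qed

text \<open>A Schur test: \<open>|A(x) B(y)|\<close> is at most half the sum of the squares, and
  integrating the kernel in the free variable costs at most a factor 1.\<close>

lemma mollified_form_bound:
  assumes A: "A \<in> L2 D" and B: "B \<in> L2 D"
  shows "\<bar>mollified_form n A B\<bar> \<le> ((L2_norm D A)\<^sup>2 + (L2_norm D B)\<^sup>2) / 2"
proof -
  interpret P: pair_sigma_finite M M by (rule pair_sigma_finite_D)
  let ?\<rho> = "\<lambda>x y. mollifier n (x - y)"
  note iA = L2_imp_integrable[OF lmeasurable_D A] and iB = L2_imp_integrable[OF lmeasurable_D B]
  have i1: "integrable M (\<lambda>x. 1::real)" by (rule L2_imp_integrable[OF lmeasurable_D L2_const])
  have sA: "integrable M (\<lambda>x. (A x)\<^sup>2)" and sB: "integrable M (\<lambda>x. (B x)\<^sup>2)"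
    using A B L2_integrable_sq by fastforce+
  note IA = mollified_product_integrable[OF sA i1, of n, simplified]
  note IB = mollified_product_integrable[OF i1 sB, of n, simplified]
  note IAB = mollified_product_integrable[OF iA iB, of n]
  have "mollified_form n A B = (\<integral>p. (case p of (x, y) \<Rightarrow> A x * B y * ?\<rho> x y) \<partial>(M \<Otimes>\<^sub>M M))"
    unfolding mollified_form_def by (rule P.integral_fst[OF IAB])
  also have "\<bar>\<dots>\<bar> \<le> (\<integral>p. \<bar>case p of (x, y) \<Rightarrow> A x * B y * ?\<rho> x y\<bar> \<partial>(M \<Otimes>\<^sub>M M))"
    using integral_norm_bound[of "M \<Otimes>\<^sub>M M" "\<lambda>p. case p of (x, y) \<Rightarrow> A x * B y * ?\<rho> x y"] by simp
  also have "\<dots> \<le> (\<integral>p. ((case p of (x, y) \<Rightarrow> (A x)\<^sup>2 * ?\<rho> x y) + (case p of (x, y) \<Rightarrow> (B y)\<^sup>2 * ?\<rho> x y)) / 2 \<partial>(M \<Otimes>\<^sub>M M))"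
  proof (rule integral_mono)
    fix p :: "'a \<times> 'a"
    obtain x y where p: "p = (x, y)" by (cases p)
    have "\<bar>A x * B y\<bar> * ?\<rho> x y \<le> ((A x)\<^sup>2 + (B y)\<^sup>2) / 2 * ?\<rho> x y"
      using sum_squares_bound[of "\<bar>A x\<bar>" "\<bar>B y\<bar>"] mollifier_nonneg[of n "x - y"]
      by (intro mult_right_mono) (auto simp: abs_mult)
    then show "\<bar>case p of (x, y) \<Rightarrow> A x * B y * ?\<rho> x y\<bar>
        \<le> ((case p of (x, y) \<Rightarrow> (A x)\<^sup>2 * ?\<rho> x y) + (case p of (x, y) \<Rightarrow> (B y)\<^sup>2 * ?\<rho> x y)) / 2"
      using mollifier_nonneg[of n "x - y"] by (simp add: p abs_mult algebra_simps)
  qed (use IA IB IAB in auto)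
  also have "\<dots> = ((\<integral>p. (case p of (x, y) \<Rightarrow> (A x)\<^sup>2 * ?\<rho> x y) \<partial>(M \<Otimes>\<^sub>M M))
      + (\<integral>p. (case p of (x, y) \<Rightarrow> (B y)\<^sup>2 * ?\<rho> x y) \<partial>(M \<Otimes>\<^sub>M M))) / 2"
    using IA IB by simp
  also have "(\<integral>p. (case p of (x, y) \<Rightarrow> (A x)\<^sup>2 * ?\<rho> x y) \<partial>(M \<Otimes>\<^sub>M M)) \<le> (L2_norm D A)\<^sup>2"
  proof -
    have "(\<integral>p. (case p of (x, y) \<Rightarrow> (A x)\<^sup>2 * ?\<rho> x y) \<partial>(M \<Otimes>\<^sub>M M)) = (\<integral>x. (\<integral>y. (A x)\<^sup>2 * ?\<rho> x y \<partial>M) \<partial>M)"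
      by (rule P.integral_fst[OF IA, symmetric])
    also have "\<dots> \<le> (\<integral>x. (A x)\<^sup>2 \<partial>M)"
    proof (rule integral_mono[OF P.integrable_fst[OF IA] sA])
      fix x
      show "(\<integral>y. (A x)\<^sup>2 * ?\<rho> x y \<partial>M) \<le> (A x)\<^sup>2"
        using mult_left_mono[OF mollifier_integral_le[of n x], of "(A x)\<^sup>2"] by simp
    qed
    finally show ?thesis by (simp add: L2_norm_sq)
  qed
  also have "(\<integral>p. (case p of (x, y) \<Rightarrow> (B y)\<^sup>2 * ?\<rho> x y) \<partial>(M \<Otimes>\<^sub>M M)) \<le> (L2_norm D B)\<^sup>2"
  proof -
    have "(\<integral>p. (case p of (x, y) \<Rightarrow> (B y)\<^sup>2 * ?\<rho> x y) \<partial>(M \<Otimes>\<^sub>M M)) = (\<integral>y. (\<integral>x. (B y)\<^sup>2 * ?\<rho> x y \<partial>M) \<partial>M)"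
      by (rule P.integral_snd[OF IB, symmetric])
    also have "\<dots> \<le> (\<integral>y. (B y)\<^sup>2 \<partial>M)"
    proof (rule integral_mono[OF P.integrable_snd[OF IB] sB])
      fix y
      show "(\<integral>x. (B y)\<^sup>2 * ?\<rho> x y \<partial>M) \<le> (B y)\<^sup>2"
        using mult_left_mono[OF mollifier_integral_le[of n y], of "(B y)\<^sup>2"]
        by (simp add: mollifier_symmetric[of n _ y])
    qed
    finally show ?thesis by (simp add: L2_norm_sq)
  qed
  finally show ?thesis by simp
qed

lemma mollified_form_scale:
  "s \<noteq> 0 \<Longrightarrow> mollified_form n (\<lambda>x. s * A x) (\<lambda>x. B x / s) = mollified_form n A B"
  by (simp add: mollified_form_def)

text \<open>The bound by a sum of squares becomes small with \<open>B\<close> after rescaling: the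
  form is unchanged when \<open>A\<close> is multiplied and \<open>B\<close> divided by
  \<open>sqrt e\<close>, and then both squares carry a factor \<open>e\<close>.\<close>

lemma mollified_form_bound_small:
  assumes A: "A \<in> L2 D" and B: "B \<in> L2 D" and e: "L2_norm D B \<le> e" "e > 0"
  shows "\<bar>mollified_form n A B\<bar> \<le> e * ((L2_norm D A)\<^sup>2 + 1) / 2"
proof -
  let ?s = "sqrt e"
  have s: "?s > 0" "?s\<^sup>2 = e" using e by auto
  have "\<bar>mollified_form n A B\<bar> = \<bar>mollified_form n (\<lambda>x. ?s * A x) (\<lambda>x. B x / ?s)\<bar>"
    using s by (subst mollified_form_scale) auto
  also have "\<dots> \<le> ((L2_norm D (\<lambda>x. ?s * A x))\<^sup>2 + (L2_norm D (\<lambda>x. B x / ?s))\<^sup>2) / 2"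
    using L2_scaleR[OF A, of ?s] L2_scaleR[OF B, of "1 / ?s"] by (intro mollified_form_bound) auto
  also have "L2_norm D (\<lambda>x. ?s * A x) = ?s * L2_norm D A"
    using L2_norm_scaleR[of D ?s A] s by simp
  also have "L2_norm D (\<lambda>x. B x / ?s) = L2_norm D B / ?s"
    using L2_norm_scaleR[of D "1 / ?s" B] s by simp
  also have "(?s * L2_norm D A)\<^sup>2 = e * (L2_norm D A)\<^sup>2" using e by (simp add: power_mult_distrib)
  also have "(L2_norm D B / ?s)\<^sup>2 \<le> e"
  proof -
    have "(L2_norm D B)\<^sup>2 \<le> e\<^sup>2" using e by (intro power_mono) auto
    then show ?thesis using e by (simp add: power_divide divide_le_eq power2_eq_square)
  qed
  finally show ?thesis by (simp add: distrib_left)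
qed

text \<open>At an interior point the kernel eventually fits into \<open>D\<close>, so it has full
  mass 1 there and averages \<open>k\<close> over ever smaller balls.\<close>

lemma mollified_continuous_tendsto:
  assumes k: "continuous_on UNIV k" "\<And>x. \<bar>k x\<bar> \<le> C" and x: "x \<in> D"
  shows "(\<lambda>n. \<integral>y. k y * mollifier n (x - y) \<partial>M) \<longlonglongrightarrow> k x"
proof (rule LIMSEQ_I)
  fix e :: real assume "e > 0"
  have [measurable]: "k \<in> borel_measurable borel" by (rule borel_measurable_continuous_onI[OF k(1)])
  obtain r where r: "r > 0" "ball x r \<subseteq> D" using open_D x by (auto simp: open_contains_ball)
  have "isCont k x" using k(1) by (simp add: continuous_on_eq_continuous_at)
  then obtain d where d: "d > 0" "\<And>y. dist y x < d \<Longrightarrow> \<bar>k y - k x\<bar> < e / 2"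
    using \<open>e > 0\<close> unfolding continuous_at_eps_delta
    by (metis dist_real_def half_gt_zero)
  obtain N where N: "1 / real (Suc N) < min r d"
    using r d reals_Archimedean[of "min r d"] by (auto simp: inverse_eq_divide)
  show "\<exists>N. \<forall>n\<ge>N. norm ((\<integral>y. k y * mollifier n (x - y) \<partial>M) - k x) < e"
  proof (intro exI allI impI)
    fix n assume "n \<ge> N"
    then have "1 / real (Suc n) \<le> 1 / real (Suc N)" by (intro divide_left_mono) auto
    with N have n: "1 / real (Suc n) < r" "1 / real (Suc n) < d" by auto
    have out: "mollifier n (x - y) = 0" if "dist y x \<ge> 1 / real (Suc n)" for y
      using that by (intro mollifier_zero) (simp add: dist_norm norm_minus_commute)
    have int_m: "integrable lborel (\<lambda>y. mollifier n (x - y))" by (rule mollifier_shift_integrable)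
    have int_k: "integrable lborel (\<lambda>y. k y * mollifier n (x - y))"
    proof (rule Bochner_Integration.integrable_bound)
      show "integrable lborel (\<lambda>y. C * mollifier n (x - y))" using int_m by simp
      show "AE y in lborel. norm (k y * mollifier n (x - y)) \<le> norm (C * mollifier n (x - y))"
        using k(2) mollifier_nonneg[of n] by (auto simp: abs_mult intro!: mult_right_mono order_trans[OF k(2)])
    qed measurable
    have "(\<integral>y. k y * mollifier n (x - y) \<partial>M) - k x
        = (\<integral>y. k y * mollifier n (x - y) \<partial>lborel) - k x * (\<integral>y. mollifier n (x - y) \<partial>lborel)"
    proof -
      have "(\<integral>y. k y * mollifier n (x - y) \<partial>M) = (\<integral>y. k y * mollifier n (x - y) \<partial>lborel)"
      proof (rule integral_lebesgue_on_open[OF open_D])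
        fix y assume "y \<notin> D"
        then have "dist y x \<ge> r" using r(2) by (auto simp: dist_commute subset_iff not_less)
        then show "k y * mollifier n (x - y) = 0" using out[of y] n by simp
      qed measurable
      then show ?thesis by (simp add: mollifier_integral)
    qed
    also have "\<dots> = (\<integral>y. (k y - k x) * mollifier n (x - y) \<partial>lborel)"
      using int_m int_k by (simp add: left_diff_distrib)
    also have "\<bar>\<dots>\<bar> \<le> (\<integral>y. e / 2 * mollifier n (x - y) \<partial>lborel)"
    proof -
      have "\<bar>(k y - k x) * mollifier n (x - y)\<bar> \<le> e / 2 * mollifier n (x - y)" for y
      proof (cases "dist y x < 1 / real (Suc n)")
        case True
        then have "\<bar>k y - k x\<bar> \<le> e / 2" using d(2)[of y] n by linarith
        from mult_right_mono[OF this mollifier_nonneg[of n "x - y"]] show ?thesis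
          using mollifier_nonneg[of n "x - y"] by (simp add: abs_mult)
      qed (use out[of y] in auto)
      then show ?thesis
        using int_m int_k by (intro abs_integral_le) (simp_all add: left_diff_distrib)
    qed
    also have "\<dots> = e / 2" by (simp add: mollifier_integral)
    finally show "norm ((\<integral>y. k y * mollifier n (x - y) \<partial>M) - k x) < e"
      using \<open>e > 0\<close> by simp
  qed
qed

text \<open>The inner averages of \<open>k\<close> converge pointwise on \<open>D\<close> and stay
  below \<open>C\<close> because the kernel has mass at most 1; so \<open>C * |A|\<close> is a
  majorant.\<close>

lemma mollified_form_continuous_tendsto:
  assumes A: "A \<in> L2 D" and k: "continuous_on UNIV k" "\<And>x. \<bar>k x\<bar> \<le> C"
  shows "(\<lambda>n. mollified_form n A k) \<longlonglongrightarrow> (\<integral>x. A x * k x \<partial>M)"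
proof -
  interpret P: pair_sigma_finite M M by (rule pair_sigma_finite_D)
  have C: "C \<ge> 0" using k(2)[of undefined] by linarith
  note iA = L2_imp_integrable[OF lmeasurable_D A]
  have kL: "k \<in> L2 D" by (rule L2_continuous_bounded[OF k])
  have eq: "mollified_form n A k = (\<integral>x. A x * (\<integral>y. k y * mollifier n (x - y) \<partial>M) \<partial>M)" for n
    by (simp add: mollified_form_def mult.assoc)
  have bd: "\<bar>\<integral>y. k y * mollifier n (x - y) \<partial>M\<bar> \<le> C" for n x
  proof -
    have im: "integrable M (\<lambda>y. mollifier n (x - y))"
      by (rule integrable_lebesgue_on_open[OF open_D mollifier_shift_integrable])
    have "\<bar>\<integral>y. k y * mollifier n (x - y) \<partial>M\<bar> \<le> (\<integral>y. C * mollifier n (x - y) \<partial>M)"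
    proof -
      have le: "\<bar>k y * mollifier n (x - y)\<bar> \<le> C * mollifier n (x - y)" for y
        using mult_right_mono[OF k(2)[of y] mollifier_nonneg[of n "x - y"]] mollifier_nonneg[of n "x - y"]
        by (simp add: abs_mult)
      have "integrable M (\<lambda>y. k y * mollifier n (x - y))"
      proof (rule Bochner_Integration.integrable_bound[OF integrable_mult_right[OF im, of C]])
        show "(\<lambda>y. k y * mollifier n (x - y)) \<in> borel_measurable M"
          using borel_measurable_integrable[OF im] L2_measurable[OF kL] by measurable
        show "AE y in M. norm (k y * mollifier n (x - y)) \<le> norm (C * mollifier n (x - y))"
          using order_trans[OF le abs_ge_self] unfolding real_norm_def by (rule AE_I2)
      qed
      then show ?thesis
        using im le by (intro abs_integral_le) auto
    qed
    also have "\<dots> \<le> C" using mult_left_mono[OF mollifier_integral_le[of n x] C] by simp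
    finally show ?thesis .
  qed
  show ?thesis unfolding eq
  proof (rule integral_dominated_convergence)
    show "integrable M (\<lambda>x. C * \<bar>A x\<bar>)" using iA by simp
    show "(\<lambda>x. A x * (\<integral>y. k y * mollifier n (x - y) \<partial>M)) \<in> borel_measurable M" for n
      using borel_measurable_integrable[OF P.integrable_fst[OF mollified_product_integrable[OF iA L2_imp_integrable[OF lmeasurable_D kL], of n]]]
      by (simp add: mult.assoc)
    show "(\<lambda>x. A x * k x) \<in> borel_measurable M"
      using L2_measurable[OF A] L2_measurable[OF kL] by measurable
    show "AE x in M. (\<lambda>n. A x * (\<integral>y. k y * mollifier n (x - y) \<partial>M)) \<longlonglongrightarrow> A x * k x"
      using mollified_continuous_tendsto[OF k] by (intro AE_I2 tendsto_mult_left) simp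
    show "AE x in M. norm (A x * (\<integral>y. k y * mollifier n (x - y) \<partial>M)) \<le> C * \<bar>A x\<bar>" for n
      using mult_left_mono[OF bd abs_ge_zero] by (auto simp: abs_mult mult.commute)
  qed
qed

lemma mollified_form_diff:
  assumes A: "A \<in> L2 D" and B: "B \<in> L2 D" and k: "k \<in> L2 D"
  shows "mollified_form n A (\<lambda>x. B x - k x) = mollified_form n A B - mollified_form n A k"
proof -
  interpret P: pair_sigma_finite M M by (rule pair_sigma_finite_D)
  note i = L2_imp_integrable[OF lmeasurable_D]
  note IB = mollified_product_integrable[OF i[OF A] i[OF B], of n]
  note Ik = mollified_product_integrable[OF i[OF A] i[OF k], of n]
  note ID = mollified_product_integrable[OF i[OF A] i[OF L2_diff[OF B k]], of n]
  show ?thesis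
    unfolding mollified_form_def P.integral_fst[OF IB] P.integral_fst[OF Ik] P.integral_fst[OF ID]
    by (subst Bochner_Integration.integral_diff[OF IB Ik, symmetric])
       (auto intro!: Bochner_Integration.integral_cong simp: split_beta algebra_simps)
qed

text \<open>Only \<open>B\<close> is replaced by a continuous function. The resulting error in the
  form is bounded uniformly in \<open>n\<close>, so the limit may be taken with the continuous
  function in place of \<open>B\<close>.\<close>

proposition mollified_form_tendsto:
  assumes A: "A \<in> L2 D" and B: "B \<in> L2 D"
  shows "(\<lambda>n. mollified_form n A B) \<longlonglongrightarrow> (\<integral>x. A x * B x \<partial>M)"
proof (rule LIMSEQ_I)
  fix e :: real assume "e > 0"
  \<comment> \<open>These choices make the three errors add up to less than \<open>e\<close>: below
    \<open>e / 2\<close> in the form, at most \<open>e / 3\<close> in the limit integral, and below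
    \<open>e / 6\<close> for the continuous function.\<close>
  define c where "c = (L2_norm D A)\<^sup>2 + 1"
  have c: "c > 0" "L2_norm D A \<le> c"
    using sum_squares_bound[of "L2_norm D A" 1] L2_norm_nonneg[of D A] unfolding c_def
    by (auto intro: add_nonneg_pos) (smt (verit) L2_norm_nonneg)
  define d where "d = e / (3 * c)"
  have d: "d > 0" "d * c = e / 3" using \<open>e > 0\<close> c by (auto simp: d_def)
  obtain k C where k: "continuous_on UNIV k" "\<And>x. \<bar>k x\<bar> \<le> C" "L2_norm D (\<lambda>x. B x - k x) < d"
    using L2_dense[OF B d(1)] by blast
  have kL: "k \<in> L2 D" by (rule L2_continuous_bounded[OF k(1,2)])
  have 1: "\<bar>mollified_form n A B - mollified_form n A k\<bar> < e / 2" for n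
    using mollified_form_bound_small[OF A L2_diff[OF B kL], of d n] k(3) d \<open>e > 0\<close>
    by (simp add: mollified_form_diff[OF A B kL] c_def[symmetric])
  have 2: "\<bar>(\<integral>x. A x * B x \<partial>M) - (\<integral>x. A x * k x \<partial>M)\<bar> \<le> e / 3"
  proof -
    have "(\<integral>x. A x * B x \<partial>M) - (\<integral>x. A x * k x \<partial>M) = (\<integral>x. A x * (B x - k x) \<partial>M)"
      using L2_mult_integrable[OF A B] L2_mult_integrable[OF A kL] by (simp add: right_diff_distrib)
    also have "\<bar>\<dots>\<bar> \<le> L2_norm D A * L2_norm D (\<lambda>x. B x - k x)"
      using L2_Cauchy_Schwarz[OF A L2_diff[OF B kL]] by simp
    also have "\<dots> \<le> c * d" using c k(3) by (intro mult_mono) auto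
    finally show ?thesis using d by (simp add: mult.commute)
  qed
  obtain N where N: "\<And>n. n \<ge> N \<Longrightarrow> \<bar>mollified_form n A k - (\<integral>x. A x * k x \<partial>M)\<bar> < e / 6"
    using LIMSEQ_D[OF mollified_form_continuous_tendsto[OF A k(1,2)], of "e / 6"] \<open>e > 0\<close> by auto
  show "\<exists>N. \<forall>n\<ge>N. norm (mollified_form n A B - (\<integral>x. A x * B x \<partial>M)) < e"
  proof (intro exI allI impI)
    fix n assume "n \<ge> N"
    from N[OF this] 1[of n] 2 show "norm (mollified_form n A B - (\<integral>x. A x * B x \<partial>M)) < e"
      unfolding real_norm_def by linarith
  qed
qed

text \<open>With \<open>y\<close> outside, the inner integral pairs \<open>A\<close> with a
  translate of the kernel, which is a test function when \<open>y\<close> stays in a compact subset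
  of \<open>D\<close> and \<open>n\<close> is large. This is the place where a weak equation for
  \<open>A\<close> can be inserted.\<close>

lemma mollified_form_swap:
  assumes A: "A \<in> L2 D" and B: "B \<in> L2 D"
  shows "mollified_form n A B = (\<integral>y. B y * (\<integral>x. A x * mollifier n (x - y) \<partial>M) \<partial>M)"
proof -
  interpret P: pair_sigma_finite M M by (rule pair_sigma_finite_D)
  note i = L2_imp_integrable[OF lmeasurable_D]
  have "mollified_form n A B = (\<integral>y. \<integral>x. A x * B y * mollifier n (x - y) \<partial>M \<partial>M)"
    unfolding mollified_form_def
    by (rule P.Fubini_integral[OF mollified_product_integrable[OF i[OF A] i[OF B]], symmetric])
  then show ?thesis by (simp add: mult.assoc mult.left_commute[of "A _"])
qed

section \<open>The fundamental lemma of the calculus of variations\<close>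

lemma mollifier_test_function:
  assumes "compact K" "K \<subseteq> D"
  obtains N where "\<And>n y. n \<ge> N \<Longrightarrow> y \<in> K \<Longrightarrow> (\<lambda>x. mollifier n (x - y)) \<in> test_functions D"
proof -
  obtain e where e: "e > 0" "(\<Union>x\<in>K. cball x e) \<subseteq> D"
    using compact_subset_open_imp_cball_epsilon_subset[OF assms(1) open_D assms(2)] by blast
  obtain N where N: "1 / real (Suc N) < e"
    using e reals_Archimedean[of e] by (auto simp: inverse_eq_divide)
  show ?thesis
  proof (rule that)
    fix n y assume n: "n \<ge> N" and y: "y \<in> K"
    from n have "1 / real (Suc n) \<le> 1 / real (Suc N)" by (intro divide_left_mono) auto
    with N have n: "1 / real (Suc n) < e" by simp
    show "(\<lambda>x. mollifier n (x - y)) \<in> test_functions D"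
    proof (rule test_functionsI[where K = "cball y e"])
      show "smooth (\<lambda>x. mollifier n (x - y))"
        using smooth_affine[OF mollifier_smooth, of n 1 "- y"] by simp
      show "mollifier n (x - y) = 0" if "x \<notin> cball y e" for x
        using that n by (intro mollifier_zero) (simp add: dist_norm norm_minus_commute)
    qed (use e y in auto)
  qed
qed

text \<open>For compact \<open>K\<close> in \<open>D\<close> let \<open>B\<close> be
  \<open>u\<close> on \<open>K\<close> and 0 elsewhere. The mollified form of \<open>u\<close> and
  \<open>B\<close> only sees \<open>u\<close> tested with translates of the kernel, hence is 0 for
  large \<open>n\<close>, while its limit is the integral of \<open>u^2\<close> over
  \<open>K\<close>. Countably many such \<open>K\<close> fill \<open>D\<close>.\<close>

lemma fundamental_lemma:
  fixes u :: "'a \<Rightarrow> real"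
  assumes u: "u \<in> L2 D" and test: "\<And>\<psi>. \<psi> \<in> test_functions D \<Longrightarrow> (\<integral>x. u x * \<psi> x \<partial>M) = 0"
  shows "AE x in M. u x = 0"
proof -
  have compact_zero: "AE x in M. x \<in> K \<longrightarrow> u x = 0" if K: "compact K" "K \<subseteq> D" for K
  proof -
    obtain N where N: "\<And>n y. n \<ge> N \<Longrightarrow> y \<in> K \<Longrightarrow> (\<lambda>x. mollifier n (x - y)) \<in> test_functions D"
      using mollifier_test_function[OF K] by blast
    define B where "B x = indicator K x * u x" for x
    have [measurable]: "indicat_real K \<in> borel_measurable M"
      using K(1) by (intro borel_measurable_lebesgue_on) (auto intro: borel_measurable_indicator borel_closed compact_imp_closed)
    have B: "B \<in> L2 D" unfolding B_def
    proof (rule L2_dominated[OF u])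
      show "(\<lambda>x. indicator K x * u x) \<in> borel_measurable M"
        using L2_measurable[OF u] by measurable
    qed (auto simp: indicator_def)
    have zero: "mollified_form n u B = 0" if "n \<ge> N" for n
    proof -
      have "B y * (\<integral>x. u x * mollifier n (x - y) \<partial>M) = 0" for y
        using test[OF N[OF that]] by (cases "y \<in> K") (auto simp: B_def)
      then show ?thesis unfolding mollified_form_swap[OF u B] by (simp only: Bochner_Integration.integral_zero)
    qed
    have "(\<lambda>n. mollified_form n u B) \<longlonglongrightarrow> 0"
      using zero by (intro tendsto_eventually eventually_sequentiallyI)
    then have "(\<integral>x. u x * B x \<partial>M) = 0"
      using mollified_form_tendsto[OF u B] LIMSEQ_unique by blast
    moreover have "0 \<le> u x * B x" for x by (simp add: B_def indicator_def)
    ultimately have "AE x in M. u x * B x = 0"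
      using integral_nonneg_eq_0_iff_AE[OF L2_mult_integrable[OF u B]] by simp
    then show ?thesis by eventually_elim (auto simp: B_def)
  qed
  obtain C :: "nat \<Rightarrow> 'a set" where C: "\<And>n. compact (C n)" "\<And>n. C n \<subseteq> D" "\<Union>(range C) = D"
  proof (rule open_Union_compact_subsets[OF open_D])
    fix C :: "nat \<Rightarrow> 'a set"
    assume "\<And>n. compact (C n)" "\<And>n. C n \<subseteq> D" "\<Union>(range C) = D"
    then show thesis by (rule that)
  qed
  have "AE x in M. \<forall>n::nat. x \<in> C n \<longrightarrow> u x = 0"
    unfolding AE_all_countable using compact_zero[OF C(1,2)] by blast
  moreover have "AE x in M. x \<in> D" by (rule AE_I2) simp
  ultimately show ?thesis by eventually_elim (use C(3) in blast)
qed

end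

section \<open>Weak gradients and the first estimate\<close>

lemma has_weak_gradientD:
  assumes "has_weak_gradient D u g"
  shows "u \<in> L2 D" "g \<in> L2 D"
    "\<phi> \<in> test_functions D \<Longrightarrow> i \<in> Basis \<Longrightarrow>
      (\<integral>x. u x * partial_deriv i \<phi> x \<partial>lebesgue_on D) = - (\<integral>x. (g x \<bullet> i) * \<phi> x \<partial>lebesgue_on D)"
  using assms by (auto simp: has_weak_gradient_def)

lemma wgrad: "u \<in> H1 D \<Longrightarrow> has_weak_gradient D u (wgrad D u)"
  unfolding H1_def wgrad_def using someI_ex[of "has_weak_gradient D u"] by simp

lemma H1I: "has_weak_gradient D u g \<Longrightarrow> u \<in> H1 D"
  by (auto simp: H1_def)

context bounded_open
begin

section \<open>Weak gradients: test functions, uniqueness, linearity\<close>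

lemma test_functions_L2:
  assumes "\<phi> \<in> test_functions D"
  shows "\<phi> \<in> L2 D" "grad \<phi> \<in> L2 D" "partial_deriv i \<phi> \<in> L2 D"
proof -
  note t = test_functionsD(1-3)[OF assms]
  obtain C where "\<And>x. \<bar>\<phi> x\<bar> \<le> C"
    using continuous_compact_support_bounded[OF smooth_continuous[OF t(1)] t(2) zero_outside_support[of _ \<phi>]] by metis
  then show "\<phi> \<in> L2 D" by (rule L2_continuous_bounded[OF smooth_continuous[OF t(1)]])
  obtain B where "\<And>x. norm (grad \<phi> x) \<le> B" using smooth_grad_bounded[OF t(1,2)] by metis
  then show g: "grad \<phi> \<in> L2 D"
    by (intro L2_finite_measureI[OF lmeasurable_D, of _ B] borel_measurable_lebesgue_on
        borel_measurable_continuous_onI smooth_continuous_grad[OF t(1)]) auto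
  have "partial_deriv i \<phi> = (\<lambda>x. grad \<phi> x \<bullet> i)"
    using linear_frechet_derivative[OF smooth_differentiable[OF t(1)]]
      frechet_derivative_at[OF has_derivative_grad[OF smooth_differentiable[OF t(1)]]]
    by (auto simp: partial_deriv_def fun_eq_iff)
  moreover have "(\<lambda>x. grad \<phi> x \<bullet> i) \<in> L2 D"
    by (rule L2_dominated[OF L2_scaleR[OF g, of "norm i"]])
       (use L2_measurable[OF g] Cauchy_Schwarz_ineq2[of "grad \<phi> _" i] in \<open>auto simp: mult.commute\<close>)
  ultimately show "partial_deriv i \<phi> \<in> L2 D" by simp
qed

text \<open>A partial derivative of the product of two test functions has integral 0; the Leibniz
  rule turns this into the defining identity.\<close>

lemma test_function_weak_gradient:
  assumes "\<phi> \<in> test_functions D"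
  shows "has_weak_gradient D \<phi> (grad \<phi>)"
  unfolding has_weak_gradient_def
proof (intro conjI ballI)
  fix \<psi> and i :: 'a assume \<psi>: "\<psi> \<in> test_functions D" and i: "i \<in> Basis"
  note t = test_functionsD[OF assms] and s = test_functionsD[OF \<psi>]
  have "\<phi> differentiable at x" "\<psi> differentiable at x" for x
    using smooth_differentiable[OF t(1)] smooth_differentiable[OF s(1)] by auto
  then have pd: "partial_deriv i (\<lambda>x. \<phi> x * \<psi> x) x = \<phi> x * partial_deriv i \<psi> x + (grad \<phi> x \<bullet> i) * \<psi> x" for x
    by (simp add: partial_deriv_mult grad_inner_Basis[OF i])
  note m = test_functionsD[OF test_functions_mult[OF assms s(1)]]
  have "(\<integral>x. partial_deriv i (\<lambda>x. \<phi> x * \<psi> x) x \<partial>M) = (\<integral>x. partial_deriv i (\<lambda>x. \<phi> x * \<psi> x) x \<partial>lborel)"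
  proof (rule integral_lebesgue_on_open[OF open_D])
    show "partial_deriv i (\<lambda>x. \<phi> x * \<psi> x) \<in> borel_measurable borel"
      by (intro borel_measurable_continuous_onI smooth_continuous smooth_partial_deriv m(1) i)
    show "partial_deriv i (\<lambda>x. \<phi> x * \<psi> x) x = 0" if "x \<notin> D" for x
      using m(3) that by (intro partial_deriv_zero_outside) blast
  qed
  also have "\<dots> = 0" by (rule integral_partial_deriv_eq_0[OF m(1,2) i])
  finally have "(\<integral>x. \<phi> x * partial_deriv i \<psi> x + (grad \<phi> x \<bullet> i) * \<psi> x \<partial>M) = 0"
    by (simp add: pd)
  moreover have "(\<integral>x. \<phi> x * partial_deriv i \<psi> x + (grad \<phi> x \<bullet> i) * \<psi> x \<partial>M)
      = (\<integral>x. \<phi> x * partial_deriv i \<psi> x \<partial>M) + (\<integral>x. (grad \<phi> x \<bullet> i) * \<psi> x \<partial>M)"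
    by (intro Bochner_Integration.integral_add L2_mult_integrable test_functions_L2[OF assms] test_functions_L2[OF \<psi>]
        L2_inner_Basis i)
  ultimately show "(\<integral>x. \<phi> x * partial_deriv i \<psi> x \<partial>M) = - (\<integral>x. (grad \<phi> x \<bullet> i) * \<psi> x \<partial>M)"
    by simp
qed (use test_functions_L2[OF assms] in auto)

text \<open>Each coordinate of the difference is orthogonal to all test functions. This makes the
  choice inside \<open>wgrad\<close> harmless: any explicit weak gradient may replace it under
  integrals and norms.\<close>

lemma weak_gradient_unique:
  assumes "has_weak_gradient D u g" "has_weak_gradient D u h"
  shows "AE x in M. g x = h x"
proof -
  note G = has_weak_gradientD[OF assms(1)] and H = has_weak_gradientD[OF assms(2)]
  have "AE x in M. (g x - h x) \<bullet> i = 0" if i: "i \<in> Basis" for i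
  proof (rule fundamental_lemma)
    show "(\<lambda>x. (g x - h x) \<bullet> i) \<in> L2 D" by (intro L2_inner_Basis L2_diff G H i)
    fix \<psi> assume \<psi>: "\<psi> \<in> test_functions D"
    have "(\<integral>x. ((g x - h x) \<bullet> i) * \<psi> x \<partial>M)
        = (\<integral>x. (g x \<bullet> i) * \<psi> x \<partial>M) - (\<integral>x. (h x \<bullet> i) * \<psi> x \<partial>M)"
      unfolding inner_diff_left left_diff_distrib
      by (intro Bochner_Integration.integral_diff L2_mult_integrable L2_inner_Basis G H i test_functions_L2[OF \<psi>])
    then show "(\<integral>x. ((g x - h x) \<bullet> i) * \<psi> x \<partial>M) = 0"
      using G(3)[OF \<psi> i] H(3)[OF \<psi> i] by simp
  qed
  then have "AE x in M. \<forall>i\<in>Basis. (g x - h x) \<bullet> i = 0"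
    by (simp add: AE_ball_countable countable_finite)
  then show ?thesis
    by eventually_elim (auto intro: euclidean_eqI simp: inner_diff_left)
qed

lemma wgrad_unique: "has_weak_gradient D u g \<Longrightarrow> AE x in M. wgrad D u x = g x"
  by (rule weak_gradient_unique[OF wgrad[OF H1I]])

lemma L2_norm_wgrad:
  assumes "has_weak_gradient D u g"
  shows "L2_norm D (wgrad D u) = L2_norm D g"
  by (rule L2_norm_cong_AE[OF L2_measurable L2_measurable wgrad_unique[OF assms]])
     (use has_weak_gradientD[OF wgrad[OF H1I[OF assms]]] has_weak_gradientD[OF assms] in blast)+

lemma weak_gradient_linear:
  assumes "has_weak_gradient D u g" "has_weak_gradient D v h"
  shows "has_weak_gradient D (\<lambda>x. c * u x + d * v x) (\<lambda>x. c *\<^sub>R g x + d *\<^sub>R h x)"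
  unfolding has_weak_gradient_def
proof (intro conjI ballI)
  note G = has_weak_gradientD[OF assms(1)] and H = has_weak_gradientD[OF assms(2)]
  show "(\<lambda>x. c * u x + d * v x) \<in> L2 D"
    using L2_add[OF L2_scaleR[OF G(1), of c] L2_scaleR[OF H(1), of d]] by simp
  show "(\<lambda>x. c *\<^sub>R g x + d *\<^sub>R h x) \<in> L2 D" by (intro L2_add L2_scaleR G H)
  fix \<phi> and i :: 'a assume t: "\<phi> \<in> test_functions D" "i \<in> Basis"
  have I: "integrable M (\<lambda>x. u x * partial_deriv i \<phi> x)" "integrable M (\<lambda>x. v x * partial_deriv i \<phi> x)"
    "integrable M (\<lambda>x. (g x \<bullet> i) * \<phi> x)" "integrable M (\<lambda>x. (h x \<bullet> i) * \<phi> x)"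
    by (intro L2_mult_integrable G H L2_inner_Basis test_functions_L2 t)+
  have "(\<integral>x. (c * u x + d * v x) * partial_deriv i \<phi> x \<partial>M)
      = c * (\<integral>x. u x * partial_deriv i \<phi> x \<partial>M) + d * (\<integral>x. v x * partial_deriv i \<phi> x \<partial>M)"
    using I by (simp add: distrib_right mult.assoc)
  also have "\<dots> = - (c * (\<integral>x. (g x \<bullet> i) * \<phi> x \<partial>M) + d * (\<integral>x. (h x \<bullet> i) * \<phi> x \<partial>M))"
    using G(3)[OF t] H(3)[OF t] by simp
  also have "\<dots> = - (\<integral>x. ((c *\<^sub>R g x + d *\<^sub>R h x) \<bullet> i) * \<phi> x \<partial>M)"
    using I by (simp add: inner_add_left distrib_right mult.assoc)
  finally show "(\<integral>x. (c * u x + d * v x) * partial_deriv i \<phi> x \<partial>M)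
      = - (\<integral>x. ((c *\<^sub>R g x + d *\<^sub>R h x) \<bullet> i) * \<phi> x \<partial>M)" .
qed

lemma weak_gradient_diff:
  assumes "has_weak_gradient D u g" "has_weak_gradient D v h"
  shows "has_weak_gradient D (\<lambda>x. u x - v x) (\<lambda>x. g x - h x)"
  using weak_gradient_linear[OF assms, of 1 "-1"] by simp

lemma weak_gradient_scale:
  assumes "has_weak_gradient D u g"
  shows "has_weak_gradient D (\<lambda>x. c * u x) (\<lambda>x. c *\<^sub>R g x)"
  using weak_gradient_linear[OF assms assms, of c 0] by simp

lemma weak_gradient_const: "has_weak_gradient D (\<lambda>x. c) (\<lambda>x. 0)"
  unfolding has_weak_gradient_def
proof (intro conjI ballI L2_const)
  fix \<phi> and i :: 'a assume t: "\<phi> \<in> test_functions D" "i \<in> Basis"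
  note m = test_functionsD[OF t(1)]
  have "(\<integral>x. partial_deriv i \<phi> x \<partial>M) = (\<integral>x. partial_deriv i \<phi> x \<partial>lborel)"
  proof (rule integral_lebesgue_on_open[OF open_D])
    show "partial_deriv i \<phi> \<in> borel_measurable borel"
      by (intro borel_measurable_continuous_onI smooth_continuous smooth_partial_deriv m(1) t)
    show "partial_deriv i \<phi> x = 0" if "x \<notin> D" for x
      using m(3) that by (intro partial_deriv_zero_outside) blast
  qed
  also have "\<dots> = 0" by (rule integral_partial_deriv_eq_0[OF m(1,2) t(2)])
  finally show "(\<integral>x. c * partial_deriv i \<phi> x \<partial>M) = - (\<integral>x. (0 \<bullet> i) * \<phi> x \<partial>M)"
    by simp
qed

lemma H1_norm_scale:
  assumes "v \<in> H1 D"
  shows "H1_norm D (\<lambda>x. c * v x) = \<bar>c\<bar> * H1_norm D v"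
proof -
  have "L2_norm D (wgrad D (\<lambda>x. c * v x)) = \<bar>c\<bar> * L2_norm D (wgrad D v)"
    using L2_norm_wgrad[OF weak_gradient_scale[OF wgrad[OF assms], of c]] by (simp add: L2_norm_scaleR)
  moreover have "L2_norm D (\<lambda>x. c * v x) = \<bar>c\<bar> * L2_norm D v"
    using L2_norm_scaleR[of D c v] by simp
  ultimately have "(L2_norm D (\<lambda>x. c * v x))\<^sup>2 + (L2_norm D (wgrad D (\<lambda>x. c * v x)))\<^sup>2
      = c\<^sup>2 * ((L2_norm D v)\<^sup>2 + (L2_norm D (wgrad D v))\<^sup>2)"
    by (simp add: power_mult_distrib distrib_left)
  then show ?thesis by (simp add: H1_norm_def real_sqrt_mult)
qed

section \<open>Scaling in \<open>H10\<close> and the dual norm\<close>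

lemma H10_imp_H1: "u \<in> H10 D \<Longrightarrow> u \<in> H1 D" by (simp add: H10_def)

lemma test_functions_scale: "\<phi> \<in> test_functions D \<Longrightarrow> (\<lambda>x. c * \<phi> x) \<in> test_functions D"
  using test_functions_mult[of \<phi> D "\<lambda>x. c"] by (simp add: mult.commute smooth_const)

lemma H10_scale:
  assumes "u \<in> H10 D"
  shows "(\<lambda>x. c * u x) \<in> H10 D"
proof -
  obtain \<phi> where \<phi>: "\<And>n::nat. \<phi> n \<in> test_functions D" "(\<lambda>n. H1_norm D (\<lambda>x. \<phi> n x - u x)) \<longlonglongrightarrow> 0"
    using assms by (auto simp: H10_def)
  have "H1_norm D (\<lambda>x. c * \<phi> n x - c * u x) = \<bar>c\<bar> * H1_norm D (\<lambda>x. \<phi> n x - u x)" for n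
    using H1_norm_scale[OF H1I[OF weak_gradient_diff[OF test_function_weak_gradient[OF \<phi>(1)] wgrad[OF H10_imp_H1[OF assms]]]], of c n]
    by (simp add: right_diff_distrib)
  then have "(\<lambda>n. H1_norm D (\<lambda>x. c * \<phi> n x - c * u x)) \<longlonglongrightarrow> 0"
    using tendsto_mult_left[OF \<phi>(2), of "\<bar>c\<bar>"] by simp
  moreover have "(\<lambda>x. c * u x) \<in> H1 D"
    by (rule H1I[OF weak_gradient_scale[OF wgrad[OF H10_imp_H1[OF assms]]]])
  ultimately show ?thesis
    using test_functions_scale[OF \<phi>(1)] by (auto simp: H10_def intro!: exI[of _ "\<lambda>n x. c * \<phi> n x"])
qed

lemma H10_norm_scale: "u \<in> H10 D \<Longrightarrow> H10_norm D (\<lambda>x. c * u x) = \<bar>c\<bar> * H10_norm D u"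
  using L2_norm_wgrad[OF weak_gradient_scale[OF wgrad[OF H10_imp_H1], of u c]]
  by (simp add: H10_norm_def L2_norm_scaleR)

text \<open>Scaling \<open>u\<close> to norm 1 turns the supremum into the usual bound. The
  boundedness of \<open>F\<close> makes the supremum finite, and it also gives
  \<open>F u = 0\<close> when \<open>u\<close> has norm 0. Nonnegativity comes from the zero
  function, written as a multiple of \<open>u\<close>.\<close>

lemma Hminus1_bound:
  assumes F: "F \<in> Hminus1 D" and u: "u \<in> H10 D"
  shows "\<bar>F u\<bar> \<le> Hminus1_norm D F * H10_norm D u" "0 \<le> Hminus1_norm D F"
proof -
  have nn: "H10_norm D v \<ge> 0" for v by (simp add: H10_norm_def)
  obtain K where K: "\<And>v. v \<in> H10 D \<Longrightarrow> \<bar>F v\<bar> \<le> K * H10_norm D v"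
    using F unfolding Hminus1_def by blast
  have scale: "F (\<lambda>x. c * v x) = c * F v" if "v \<in> H10 D" for c v
    using F that by (auto simp: Hminus1_def)
  have "bdd_above ((\<lambda>v. \<bar>F v\<bar>) ` {v \<in> H10 D. H10_norm D v \<le> 1})"
  proof (rule bdd_aboveI2)
    fix v assume "v \<in> {v \<in> H10 D. H10_norm D v \<le> 1}"
    then have v: "v \<in> H10 D" "H10_norm D v \<le> 1" by auto
    have "\<bar>F v\<bar> \<le> K * H10_norm D v" by (rule K[OF v(1)])
    also have "\<dots> \<le> \<bar>K\<bar> * 1" using v nn by (intro mult_mono) auto
    finally show "\<bar>F v\<bar> \<le> \<bar>K\<bar>" by simp
  qed
  then have le: "\<bar>F v\<bar> \<le> Hminus1_norm D F" if "v \<in> H10 D" "H10_norm D v \<le> 1" for v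
    unfolding Hminus1_norm_def using that by (intro cSUP_upper) auto
  show "0 \<le> Hminus1_norm D F"
    using le[OF H10_scale[OF u, of 0]] H10_norm_scale[OF u, of 0] by simp
  show "\<bar>F u\<bar> \<le> Hminus1_norm D F * H10_norm D u"
  proof (cases "H10_norm D u = 0")
    case True
    then show ?thesis using K[OF u] by simp
  next
    case False
    then have pos: "H10_norm D u > 0" using nn[of u] by simp
    have "\<bar>F (\<lambda>x. (1 / H10_norm D u) * u x)\<bar> \<le> Hminus1_norm D F"
      using pos by (intro le H10_scale u) (simp add: H10_norm_scale[OF u, of "1 / H10_norm D u", simplified])
    then have "\<bar>F u\<bar> / H10_norm D u \<le> Hminus1_norm D F"
      unfolding scale[OF u] using pos by (simp add: abs_mult)
    then show ?thesis using pos by (simp add: pos_divide_le_eq)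
  qed
qed

section \<open>Coercivity and the first estimate\<close>

lemma admissibleD:
  assumes "a \<in> admissible D lam Lam"
  shows "a \<in> borel_measurable M" "AE x in M. lam \<le> a x \<and> a x \<le> Lam"
    "0 < lam \<Longrightarrow> AE x in M. \<bar>a x\<bar> \<le> Lam"
proof -
  show "a \<in> borel_measurable M" and b: "AE x in M. lam \<le> a x \<and> a x \<le> Lam"
    using assms by (auto simp: admissible_def Linf_def)
  show "AE x in M. \<bar>a x\<bar> \<le> Lam" if "0 < lam"
    using b by eventually_elim (use that in auto)
qed

lemma coercive:
  fixes p :: "'a \<Rightarrow> 'a"
  assumes a: "a \<in> admissible D lam Lam" "0 < lam" and p: "p \<in> L2 D"
  shows "lam * (L2_norm D p)\<^sup>2 \<le> (\<integral>x. a x * (p x \<bullet> p x) \<partial>M)"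
proof -
  note A = admissibleD[OF a(1)]
  have "(\<integral>x. lam * (norm (p x))\<^sup>2 \<partial>M) \<le> (\<integral>x. a x * (p x \<bullet> p x) \<partial>M)"
  proof (rule integral_mono_AE)
    show "integrable M (\<lambda>x. a x * (p x \<bullet> p x))"
      using L2_inner_integrable[OF L2_bounded_scaleR(1)[OF p A(1) A(3)[OF a(2)]] p] by simp
    show "AE x in M. lam * (norm (p x))\<^sup>2 \<le> a x * (p x \<bullet> p x)"
      using A(2) by eventually_elim (simp add: power2_norm_eq_inner mult_right_mono)
  qed (use L2_integrable_sq[OF p] in simp)
  then show ?thesis by (simp add: L2_norm_sq)
qed

lemma weak_solutionD:
  assumes "weak_solution D a F u"
  shows "u \<in> H10 D" "u \<in> H1 D" "wgrad D u \<in> L2 D"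
    "v \<in> H10 D \<Longrightarrow> (\<integral>x. a x * (wgrad D u x \<bullet> wgrad D v x) \<partial>M) = F v"
  using assms has_weak_gradientD(2)[OF wgrad[of u D]] by (auto simp: weak_solution_def H10_imp_H1)

text \<open>The factor \<open>Lam\<close> bounds \<open>b\<close> in the Cauchy-Schwarz step, and
  \<open>1 / lam\<close> comes from the energy estimate for \<open>ua\<close>.\<close>

theorem stability_estimate:
  assumes lam: "0 < lam" "0 < Lam"
    and a: "a \<in> admissible D lam Lam" and b: "b \<in> admissible D lam Lam" and F: "F \<in> Hminus1 D"
    and ua: "weak_solution D a F ua" and ub: "weak_solution D b F ub"
  shows "\<bar>\<integral>x. (a x - b x) * (norm (wgrad D ua x))\<^sup>2 \<partial>M\<bar>
          \<le> (Lam / lam) * Hminus1_norm D F * H10_norm D (\<lambda>x. ua x - ub x)"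
proof -
  define p q where "p = wgrad D ua" and "q = wgrad D ub"
  note A = admissibleD[OF a] and B = admissibleD[OF b]
  note Ua = weak_solutionD[OF ua, folded p_def] and Ub = weak_solutionD[OF ub, folded q_def]
  have E: "H10_norm D (\<lambda>x. ua x - ub x) = L2_norm D (\<lambda>x. p x - q x)"
    unfolding H10_norm_def p_def q_def
    by (rule L2_norm_wgrad[OF weak_gradient_diff[OF wgrad[OF Ua(2)] wgrad[OF Ub(2)]]])
  have int: "integrable M (\<lambda>x. c x * (v x \<bullet> w x))"
    if "c \<in> admissible D lam Lam" "v \<in> L2 D" "w \<in> L2 D" for c and v w :: "'a \<Rightarrow> 'a"
    using L2_inner_integrable[OF L2_bounded_scaleR(1)[OF that(2) admissibleD(1)[OF that(1)] admissibleD(3)[OF that(1) lam(1)]] that(3)]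
    by simp
  \<comment> \<open>Both equations are tested with \<open>ua\<close>. Their common right side lets
    the integral of \<open>b q . p\<close> replace that of \<open>a p . p\<close>.\<close>
  have eqa: "(\<integral>x. a x * (p x \<bullet> p x) \<partial>M) = F ua" and eqb: "(\<integral>x. b x * (q x \<bullet> p x) \<partial>M) = F ua"
    using Ua(4)[OF Ua(1)] Ub(4)[OF Ua(1)] by (simp_all add: p_def q_def)
  have "(\<integral>x. (a x - b x) * (norm (p x))\<^sup>2 \<partial>M) = (\<integral>x. a x * (p x \<bullet> p x) - b x * (p x \<bullet> p x) \<partial>M)"
    by (simp add: power2_norm_eq_inner left_diff_distrib)
  also have "\<dots> = (\<integral>x. b x * (q x \<bullet> p x) \<partial>M) - (\<integral>x. b x * (p x \<bullet> p x) \<partial>M)"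
    using int[OF a Ua(3) Ua(3)] int[OF b Ua(3) Ua(3)] eqa eqb by simp
  also have "\<dots> = - (\<integral>x. (b x *\<^sub>R (p x - q x)) \<bullet> p x \<partial>M)"
    using int[OF b Ua(3) Ua(3)] int[OF b Ub(3) Ua(3)] by (simp add: inner_diff_left right_diff_distrib)
  finally have "\<bar>\<integral>x. (a x - b x) * (norm (p x))\<^sup>2 \<partial>M\<bar> = \<bar>\<integral>x. (b x *\<^sub>R (p x - q x)) \<bullet> p x \<partial>M\<bar>"
    by simp
  also have "\<dots> \<le> L2_norm D (\<lambda>x. b x *\<^sub>R (p x - q x)) * L2_norm D p"
    by (rule L2_Cauchy_Schwarz[OF L2_bounded_scaleR(1)[OF L2_diff[OF Ua(3) Ub(3)] B(1) B(3)[OF lam(1)]] Ua(3)])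
  also have "\<dots> \<le> (Lam * L2_norm D (\<lambda>x. p x - q x)) * (Hminus1_norm D F / lam)"
  proof (rule mult_mono)
    show "L2_norm D (\<lambda>x. b x *\<^sub>R (p x - q x)) \<le> Lam * L2_norm D (\<lambda>x. p x - q x)"
      using lam by (intro L2_bounded_scaleR(2)[OF L2_diff[OF Ua(3) Ub(3)] B(1) B(3)[OF lam(1)]]) simp
    \<comment> \<open>Coercivity and the dual norm give \<open>lam |p|^2 \<le> N |p|\<close> with
      \<open>N\<close> the dual norm of \<open>F\<close>; cancelling \<open>|p|\<close> requires the
      case distinction.\<close>
    show "L2_norm D p \<le> Hminus1_norm D F / lam"
    proof (cases "L2_norm D p = 0")
      case True
      then show ?thesis using Hminus1_bound(2)[OF F Ua(1)] lam by simp
    next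
      case False
      then have pos: "L2_norm D p > 0" using L2_norm_nonneg[of D p] by linarith
      have "lam * (L2_norm D p)\<^sup>2 \<le> \<bar>F ua\<bar>" using coercive[OF a lam(1) Ua(3)] eqa by simp
      also have "\<dots> \<le> Hminus1_norm D F * L2_norm D p"
        using Hminus1_bound(1)[OF F Ua(1)] by (simp add: H10_norm_def p_def)
      finally show ?thesis using pos lam by (simp add: field_simps power2_eq_square)
    qed
  qed (use lam in auto)
  finally show ?thesis by (simp add: E p_def[symmetric] mult_ac)
qed

end

section \<open>Products in weak equations\<close>

lemma test_functions_partial_deriv:
  assumes "\<phi> \<in> test_functions D" "i \<in> Basis"
  shows "partial_deriv i \<phi> \<in> test_functions D"
proof (rule test_functionsI[of _ "closure {x. \<phi> x \<noteq> 0}"])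
  show "smooth (partial_deriv i \<phi>)" by (rule smooth_partial_deriv[OF test_functionsD(1)[OF assms(1)] assms(2)])
  show "partial_deriv i \<phi> x = 0" if "x \<notin> closure {x. \<phi> x \<noteq> 0}" for x
    by (rule partial_deriv_zero_outside[OF that])
qed (use test_functionsD[OF assms(1)] in blast)+

lemma test_functions_bounded:
  assumes "\<phi> \<in> test_functions D"
  obtains C where "C \<ge> 0" "\<And>x. \<bar>\<phi> x\<bar> \<le> C"
proof -
  note t = test_functionsD(1-3)[OF assms]
  obtain C where "C > 0" "\<And>x. \<bar>\<phi> x\<bar> \<le> C"
    using continuous_compact_support_bounded[OF smooth_continuous[OF t(1)] t(2) zero_outside_support[of _ \<phi>]] by metis
  then show ?thesis by (intro that[of C]) simp_all
qed

lemma L2_scaleR_bounded: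
  fixes w :: "'a::euclidean_space \<Rightarrow> real" and h :: "'a \<Rightarrow> 'b::euclidean_space"
  assumes w: "w \<in> L2 D" and h: "h \<in> borel_measurable (lebesgue_on D)" "AE x in lebesgue_on D. norm (h x) \<le> B"
  shows "(\<lambda>x. w x *\<^sub>R h x) \<in> L2 D"
proof (rule L2_dominated[OF L2_scaleR[OF w, of B]])
  show "(\<lambda>x. w x *\<^sub>R h x) \<in> borel_measurable (lebesgue_on D)"
    using L2_measurable[OF w] h(1) by measurable
  show "AE x in lebesgue_on D. norm (w x *\<^sub>R h x) \<le> norm (B *\<^sub>R w x)"
    using h(2)
  proof eventually_elim
    case (elim x)
    then have "norm (h x) \<le> \<bar>B\<bar>" by simp
    from mult_left_mono[OF this abs_ge_zero[of "w x"]] show ?case by (simp add: abs_mult mult.commute)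
  qed
qed

lemma integral_inner_Basis:
  fixes u v :: "'a::euclidean_space \<Rightarrow> 'b::euclidean_space"
  assumes "u \<in> L2 D" "v \<in> L2 D"
  shows "(\<integral>x. u x \<bullet> v x \<partial>lebesgue_on D) = (\<Sum>i\<in>Basis. \<integral>x. (u x \<bullet> i) * (v x \<bullet> i) \<partial>lebesgue_on D)"
proof -
  have "(\<integral>x. u x \<bullet> v x \<partial>lebesgue_on D) = (\<integral>x. (\<Sum>i\<in>Basis. (u x \<bullet> i) * (v x \<bullet> i)) \<partial>lebesgue_on D)"
    by (rule Bochner_Integration.integral_cong[OF refl]) (rule euclidean_inner)
  also have "\<dots> = (\<Sum>i\<in>Basis. \<integral>x. (u x \<bullet> i) * (v x \<bullet> i) \<partial>lebesgue_on D)"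
    by (rule Bochner_Integration.integral_sum) (intro L2_mult_integrable L2_inner_Basis assms)
  finally show ?thesis .
qed

context bounded_open
begin

lemma test_scaleR_L2:
  fixes u :: "'a \<Rightarrow> 'b::euclidean_space"
  assumes "\<phi> \<in> test_functions D" "u \<in> L2 D"
  shows "(\<lambda>x. \<phi> x *\<^sub>R u x) \<in> L2 D"
proof (rule test_functions_bounded[OF assms(1)])
  fix C assume "\<And>x. \<bar>\<phi> x\<bar> \<le> C"
  then have "AE x in M. \<bar>\<phi> x\<bar> \<le> C" by simp
  then show ?thesis
    by (rule L2_bounded_scaleR(1)[OF assms(2) L2_measurable[OF test_functions_L2(1)[OF assms(1)]]])
qed

lemma scaleR_grad_L2:
  assumes "\<phi> \<in> test_functions D" "w \<in> L2 D"
  shows "(\<lambda>x. w x *\<^sub>R grad \<phi> x) \<in> L2 D"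
proof -
  obtain B where "\<And>x. norm (grad \<phi> x) \<le> B"
    using smooth_grad_bounded[OF test_functionsD(1,2)[OF assms(1)]] by metis
  then show ?thesis
    by (rule L2_scaleR_bounded[OF assms(2) L2_measurable[OF test_functions_L2(2)[OF assms(1)]] AE_I2])
qed

lemma product_gradient_L2:
  assumes w: "has_weak_gradient D w g" and \<phi>: "\<phi> \<in> test_functions D"
  shows "(\<lambda>x. \<phi> x *\<^sub>R g x + w x *\<^sub>R grad \<phi> x) \<in> L2 D"
  by (intro L2_add test_scaleR_L2 scaleR_grad_L2 \<phi> has_weak_gradientD[OF w])

section \<open>Moving derivatives onto the mollifier\<close>

lemma partial_deriv_mollifier_reflect:
  "partial_deriv i (\<lambda>y. mollifier n (x - y)) y = - partial_deriv i (mollifier n) (x - y)"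
  using partial_deriv_affine[OF smooth_differentiable[OF mollifier_smooth], of i n "-1" x y] by simp

lemma partial_deriv_mollifier_translate:
  "partial_deriv i (\<lambda>x. mollifier n (x - y)) x = partial_deriv i (mollifier n) (x - y)"
  using partial_deriv_affine[OF smooth_differentiable[OF mollifier_smooth], of i n 1 "- y" x] by simp

lemma mollifier_reflect_smooth: "smooth (\<lambda>y. mollifier n (x - y))"
  using smooth_affine[OF mollifier_smooth, of n "-1" x] by simp

text \<open>The weak gradient of \<open>w\<close> is tested with \<open>\<phi>\<close> times the
  reflected kernel, where \<open>\<phi>\<close> provides the compact support in \<open>D\<close>.
  Reflection contributes a second minus sign, so the derivative arrives on the kernel with a
  plus.\<close>

lemma mollified_product_gradient:
  assumes w: "has_weak_gradient D w g" and \<phi>: "\<phi> \<in> test_functions D" and i: "i \<in> Basis"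
  shows "(\<integral>y. ((\<phi> y *\<^sub>R g y + w y *\<^sub>R grad \<phi> y) \<bullet> i) * mollifier n (x - y) \<partial>M)
    = (\<integral>y. w y * \<phi> y * partial_deriv i (mollifier n) (x - y) \<partial>M)"
proof -
  let ?\<chi> = "\<lambda>y. mollifier n (x - y)" and M = M
  note W = has_weak_gradientD[OF w]
  note s = mollifier_reflect_smooth[of n x]
  have pd: "partial_deriv i (\<lambda>y. \<phi> y * ?\<chi> y) y = partial_deriv i \<phi> y * ?\<chi> y - \<phi> y * partial_deriv i (mollifier n) (x - y)" for y
    using partial_deriv_mult[OF smooth_differentiable[OF test_functionsD(1)[OF \<phi>]] smooth_differentiable[OF s], of i y]
    by (simp add: partial_deriv_mollifier_reflect)
  have I1: "integrable M (\<lambda>y. w y * (partial_deriv i \<phi> y * ?\<chi> y))"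
    by (intro L2_mult_integrable W test_functions_L2 test_functions_mult test_functions_partial_deriv \<phi> i s)
  have "(\<lambda>y. \<phi> y * (- partial_deriv i ?\<chi> y)) \<in> test_functions D"
    using test_functions_scale[OF test_functions_mult[OF \<phi> smooth_partial_deriv[OF s i]], of "-1"] by simp
  then have I2: "integrable M (\<lambda>y. w y * (\<phi> y * partial_deriv i (mollifier n) (x - y)))"
    using L2_mult_integrable[OF W(1) test_functions_L2(1)] by (simp add: partial_deriv_mollifier_reflect)
  have I3: "integrable M (\<lambda>y. (g y \<bullet> i) * (\<phi> y * ?\<chi> y))"
    by (intro L2_mult_integrable L2_inner_Basis W test_functions_L2 test_functions_mult \<phi> i s)
  have "(\<integral>y. w y * partial_deriv i (\<lambda>y. \<phi> y * ?\<chi> y) y \<partial>M) = - (\<integral>y. (g y \<bullet> i) * (\<phi> y * ?\<chi> y) \<partial>M)"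
    by (rule W(3)[OF test_functions_mult[OF \<phi> s] i])
  then have "(\<integral>y. w y * (partial_deriv i \<phi> y * ?\<chi> y) \<partial>M) - (\<integral>y. w y * (\<phi> y * partial_deriv i (mollifier n) (x - y)) \<partial>M)
      = - (\<integral>y. (g y \<bullet> i) * (\<phi> y * ?\<chi> y) \<partial>M)"
    using I1 I2 by (simp add: pd right_diff_distrib)
  moreover have "(\<integral>y. ((\<phi> y *\<^sub>R g y + w y *\<^sub>R grad \<phi> y) \<bullet> i) * ?\<chi> y \<partial>M)
      = (\<integral>y. (g y \<bullet> i) * (\<phi> y * ?\<chi> y) \<partial>M) + (\<integral>y. w y * (partial_deriv i \<phi> y * ?\<chi> y) \<partial>M)"
    unfolding Bochner_Integration.integral_add[OF I3 I1, symmetric]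
    by (rule Bochner_Integration.integral_cong[OF refl])
       (simp add: inner_add_left grad_inner_Basis[OF i] algebra_simps)
  ultimately show ?thesis by (simp add: mult.assoc)
qed

lemma partial_deriv_mollifier_bounded:
  assumes "i \<in> Basis"
  obtains C where "\<And>x::'a. \<bar>partial_deriv i (mollifier n) x\<bar> \<le> C"
proof -
  have s: "smooth (partial_deriv i (mollifier n) :: 'a \<Rightarrow> real)"
    by (rule smooth_partial_deriv[OF mollifier_smooth assms])
  have "mollifier n x = 0" if "x \<notin> cball 0 (1 / real (Suc n))" for x :: 'a
    using that by (intro mollifier_zero) simp
  then have "(mollifier n :: 'a \<Rightarrow> real) \<in> test_functions UNIV"
    by (intro test_functionsI[OF mollifier_smooth compact_cball[of 0 "1 / real (Suc n)"]]) auto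
  from test_functions_bounded[OF test_functions_partial_deriv[OF this assms]] show ?thesis
    using that by metis
qed

text \<open>Testing the equation with the translates of the mollifier and integrating against \<open>w \<phi>\<close>
  replaces the regularisation of the product \<open>w \<phi>\<close>, so that \<open>w\<close> itself is never approximated.\<close>

proposition weak_divergence_product:
  fixes \<sigma> :: "'a \<Rightarrow> 'a"
  assumes \<sigma>: "\<sigma> \<in> L2 D" and f: "f \<in> L2 D"
    and eq: "\<And>\<psi>. \<psi> \<in> test_functions D \<Longrightarrow> (\<integral>x. \<sigma> x \<bullet> grad \<psi> x \<partial>M) = (\<integral>x. f x * \<psi> x \<partial>M)"
    and w: "has_weak_gradient D w g" and \<phi>: "\<phi> \<in> test_functions D"
  shows "(\<integral>x. \<sigma> x \<bullet> (\<phi> x *\<^sub>R g x + w x *\<^sub>R grad \<phi> x) \<partial>M) = (\<integral>x. f x * (w x * \<phi> x) \<partial>M)"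
proof -
  let ?d\<rho> = "\<lambda>n i. partial_deriv i (mollifier n :: 'a \<Rightarrow> real)"
  interpret P: pair_sigma_finite M M by (rule pair_sigma_finite_D)
  define z G where "z x = w x * \<phi> x" and "G x = \<phi> x *\<^sub>R g x + w x *\<^sub>R grad \<phi> x" for x
  define K where "K = closure {x. \<phi> x \<noteq> 0}"
  have zL: "z \<in> L2 D"
    using test_scaleR_L2[OF \<phi> has_weak_gradientD(1)[OF w]] by (simp add: z_def[abs_def] mult.commute)
  have GL: "G \<in> L2 D" using product_gradient_L2[OF w \<phi>] by (simp add: G_def[abs_def])
  note int = L2_imp_integrable[OF lmeasurable_D]
  obtain N where N: "\<And>n y. n \<ge> N \<Longrightarrow> y \<in> K \<Longrightarrow> (\<lambda>x. mollifier n (x - y)) \<in> test_functions D"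
    using mollifier_test_function[of K] test_functionsD(2,3)[OF \<phi>] unfolding K_def by metis
  have zK: "z y = 0" if "y \<notin> K" for y
    using zero_outside_support[of y \<phi>] that by (simp add: z_def K_def)
  have kern: "integrable (M \<Otimes>\<^sub>M M) (\<lambda>(x, y). (\<sigma> x \<bullet> i) * z y * ?d\<rho> n i (x - y))" if i: "i \<in> Basis" for i n
  proof -
    obtain C where C: "\<And>x::'a. \<bar>?d\<rho> n i x\<bar> \<le> C" using partial_deriv_mollifier_bounded[OF i] by metis
    show ?thesis
      by (rule product_kernel_integrable[OF int[OF L2_inner_Basis[OF \<sigma> i]] int[OF zL] _ C])
        (rule smooth_continuous[OF smooth_partial_deriv[OF mollifier_smooth i]])
  qed
  \<comment> \<open>The derivative passes from the product onto the kernel, and Fubini brings the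
    \<open>y\<close> integral outside. Since the kernel depends on \<open>x - y\<close>, its
    derivative can now be read as one in \<open>x\<close>, of a translate.\<close>
  have form: "mollified_form n (\<lambda>x. \<sigma> x \<bullet> i) (\<lambda>x. G x \<bullet> i)
      = (\<integral>y. z y * (\<integral>x. (\<sigma> x \<bullet> i) * ?d\<rho> n i (x - y) \<partial>M) \<partial>M)" if i: "i \<in> Basis" for i n
  proof -
    have "mollified_form n (\<lambda>x. \<sigma> x \<bullet> i) (\<lambda>x. G x \<bullet> i)
        = (\<integral>x. (\<sigma> x \<bullet> i) * (\<integral>y. (G y \<bullet> i) * mollifier n (x - y) \<partial>M) \<partial>M)"
      by (simp add: mollified_form_def mult.assoc)
    also have "\<dots> = (\<integral>x. (\<sigma> x \<bullet> i) * (\<integral>y. z y * ?d\<rho> n i (x - y) \<partial>M) \<partial>M)"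
      unfolding G_def z_def mollified_product_gradient[OF w \<phi> i] ..
    also have "\<dots> = (\<integral>x. \<integral>y. (\<sigma> x \<bullet> i) * z y * ?d\<rho> n i (x - y) \<partial>M \<partial>M)"
      by (simp add: mult.assoc)
    also have "\<dots> = (\<integral>y. \<integral>x. (\<sigma> x \<bullet> i) * z y * ?d\<rho> n i (x - y) \<partial>M \<partial>M)"
      by (rule P.Fubini_integral[OF kern[OF i], symmetric])
    also have "\<dots> = (\<integral>y. z y * (\<integral>x. (\<sigma> x \<bullet> i) * ?d\<rho> n i (x - y) \<partial>M) \<partial>M)"
      by (simp add: mult.assoc mult.left_commute[of "_ \<bullet> i"])
    finally show ?thesis .
  qed
  have int_z: "integrable M (\<lambda>y. z y * (\<integral>x. (\<sigma> x \<bullet> i) * ?d\<rho> n i (x - y) \<partial>M))" if i: "i \<in> Basis" for i n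
    using P.integrable_snd[OF kern[OF i, of n]] by (simp add: mult.assoc mult.left_commute[of "_ \<bullet> i"])
  have eq_n: "(\<Sum>i\<in>Basis. mollified_form n (\<lambda>x. \<sigma> x \<bullet> i) (\<lambda>x. G x \<bullet> i)) = mollified_form n f z" if "n \<ge> N" for n
  proof -
    have "(\<Sum>i\<in>Basis. mollified_form n (\<lambda>x. \<sigma> x \<bullet> i) (\<lambda>x. G x \<bullet> i))
        = (\<integral>y. (\<Sum>i\<in>Basis. z y * (\<integral>x. (\<sigma> x \<bullet> i) * ?d\<rho> n i (x - y) \<partial>M)) \<partial>M)"
      by (subst Bochner_Integration.integral_sum) (use int_z form in auto)
    also have "\<dots> = (\<integral>y. z y * (\<integral>x. f x * mollifier n (x - y) \<partial>M) \<partial>M)"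
    proof (rule Bochner_Integration.integral_cong[OF refl])
      fix y
      show "(\<Sum>i\<in>Basis. z y * (\<integral>x. (\<sigma> x \<bullet> i) * ?d\<rho> n i (x - y) \<partial>M)) = z y * (\<integral>x. f x * mollifier n (x - y) \<partial>M)"
      proof (cases "y \<in> K")
        case True
        \<comment> \<open>For \<open>y\<close> in the support of \<open>\<phi>\<close> the translate
          is a test function, and the coordinate sum is the weak equation tested with it. For all
          other \<open>y\<close> the factor \<open>z y\<close> is 0.\<close>
        note t = N[OF that True]
        have "(\<Sum>i\<in>Basis. \<integral>x. (\<sigma> x \<bullet> i) * ?d\<rho> n i (x - y) \<partial>M) = (\<integral>x. \<sigma> x \<bullet> grad (\<lambda>x. mollifier n (x - y)) x \<partial>M)"
          unfolding integral_inner_Basis[OF \<sigma> test_functions_L2(2)[OF t]]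
          by (simp add: grad_inner_Basis partial_deriv_mollifier_translate)
        also have "\<dots> = (\<integral>x. f x * mollifier n (x - y) \<partial>M)" by (rule eq[OF t])
        finally show ?thesis by (simp add: sum_distrib_left[symmetric])
      qed (use zK in simp)
    qed
    also have "\<dots> = mollified_form n f z" by (rule mollified_form_swap[OF f zL, symmetric])
    finally show ?thesis .
  qed
  have "(\<lambda>n. \<Sum>i\<in>Basis. mollified_form n (\<lambda>x. \<sigma> x \<bullet> i) (\<lambda>x. G x \<bullet> i))
      \<longlonglongrightarrow> (\<Sum>i\<in>Basis. \<integral>x. (\<sigma> x \<bullet> i) * (G x \<bullet> i) \<partial>M)"
    by (intro tendsto_sum mollified_form_tendsto L2_inner_Basis \<sigma> GL)
  then have "(\<lambda>n. mollified_form n f z) \<longlonglongrightarrow> (\<Sum>i\<in>Basis. \<integral>x. (\<sigma> x \<bullet> i) * (G x \<bullet> i) \<partial>M)"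
    by (rule Lim_transform_eventually) (use eq_n in \<open>auto intro!: eventually_sequentiallyI[of N]\<close>)
  with mollified_form_tendsto[OF f zL]
  have "(\<integral>x. f x * z x \<partial>M) = (\<Sum>i\<in>Basis. \<integral>x. (\<sigma> x \<bullet> i) * (G x \<bullet> i) \<partial>M)"
    by (rule LIMSEQ_unique)
  then show ?thesis by (simp add: integral_inner_Basis[OF \<sigma> GL] z_def[symmetric] G_def[symmetric])
qed

lemma weak_gradient_product:
  assumes u: "has_weak_gradient D u g" "AE x in M. \<bar>u x\<bar> \<le> K"
    and v: "has_weak_gradient D v h" "AE x in M. \<bar>v x\<bar> \<le> L"
  shows "has_weak_gradient D (\<lambda>x. u x * v x) (\<lambda>x. u x *\<^sub>R h x + v x *\<^sub>R g x)"
  unfolding has_weak_gradient_def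
proof (intro conjI ballI)
  note U = has_weak_gradientD[OF u(1)] and V = has_weak_gradientD[OF v(1)]
  show "(\<lambda>x. u x * v x) \<in> L2 D"
    using L2_bounded_scaleR(1)[OF V(1) L2_measurable[OF U(1)] u(2)] by simp
  show "(\<lambda>x. u x *\<^sub>R h x + v x *\<^sub>R g x) \<in> L2 D"
    by (intro L2_add L2_bounded_scaleR(1)[OF V(2) L2_measurable[OF U(1)] u(2)]
        L2_bounded_scaleR(1)[OF U(2) L2_measurable[OF V(1)] v(2)])
  fix \<phi> and i :: 'a assume \<phi>: "\<phi> \<in> test_functions D" and i: "i \<in> Basis"
  have ui: "(\<lambda>x. u x *\<^sub>R i) \<in> L2 D" by (rule L2_scaleR_bounded[OF U(1), of _ "norm i"]) auto
  have gi: "(\<lambda>x. - (g x \<bullet> i)) \<in> L2 D" using L2_scaleR[OF L2_inner_Basis[OF U(2) i], of "-1"] by simp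
  have "(\<integral>x. (u x *\<^sub>R i) \<bullet> (\<phi> x *\<^sub>R h x + v x *\<^sub>R grad \<phi> x) \<partial>M) = (\<integral>x. - (g x \<bullet> i) * (v x * \<phi> x) \<partial>M)"
  proof (rule weak_divergence_product[OF ui gi _ v(1) \<phi>])
    fix \<psi> assume \<psi>: "\<psi> \<in> test_functions D"
    show "(\<integral>x. (u x *\<^sub>R i) \<bullet> grad \<psi> x \<partial>M) = (\<integral>x. - (g x \<bullet> i) * \<psi> x \<partial>M)"
      using U(3)[OF \<psi> i] by (simp add: inner_commute[of i] grad_inner_Basis[OF i])
  qed
  moreover have "(\<integral>x. (u x *\<^sub>R i) \<bullet> (\<phi> x *\<^sub>R h x + v x *\<^sub>R grad \<phi> x) \<partial>M)
      = (\<integral>x. (u x * (h x \<bullet> i)) * \<phi> x + (u x * v x) * partial_deriv i \<phi> x \<partial>M)"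
    by (rule Bochner_Integration.integral_cong[OF refl])
       (simp add: inner_add_right inner_commute[of i] grad_inner_Basis[OF i] algebra_simps)
  moreover have I: "integrable M (\<lambda>x. (u x * (h x \<bullet> i)) * \<phi> x)" "integrable M (\<lambda>x. (v x * (g x \<bullet> i)) * \<phi> x)"
      "integrable M (\<lambda>x. (u x * v x) * partial_deriv i \<phi> x)"
    using L2_bounded_scaleR(1)[OF L2_inner_Basis[OF V(2) i] L2_measurable[OF U(1)] u(2)]
      L2_bounded_scaleR(1)[OF L2_inner_Basis[OF U(2) i] L2_measurable[OF V(1)] v(2)]
      L2_bounded_scaleR(1)[OF V(1) L2_measurable[OF U(1)] u(2)]
    by (auto intro!: L2_mult_integrable test_functions_L2[OF \<phi>])
  ultimately have "(\<integral>x. (u x * (h x \<bullet> i)) * \<phi> x \<partial>M) + (\<integral>x. (u x * v x) * partial_deriv i \<phi> x \<partial>M)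
      = - (\<integral>x. (v x * (g x \<bullet> i)) * \<phi> x \<partial>M)"
    by (simp add: mult_ac)
  moreover have "(\<integral>x. ((u x *\<^sub>R h x + v x *\<^sub>R g x) \<bullet> i) * \<phi> x \<partial>M)
      = (\<integral>x. (u x * (h x \<bullet> i)) * \<phi> x \<partial>M) + (\<integral>x. (v x * (g x \<bullet> i)) * \<phi> x \<partial>M)"
    using Bochner_Integration.integral_add[OF I(1,2)] by (simp add: inner_add_left distrib_right)
  ultimately show "(\<integral>x. (u x * v x) * partial_deriv i \<phi> x \<partial>M) = - (\<integral>x. ((u x *\<^sub>R h x + v x *\<^sub>R g x) \<bullet> i) * \<phi> x \<partial>M)"
    by simp
qed

section \<open>Limits, powers and the reciprocal\<close>

lemma weak_gradient_cong_AE: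
  assumes "has_weak_gradient D u g" "v \<in> borel_measurable M" "h \<in> borel_measurable M"
    "AE x in M. u x = v x" "AE x in M. g x = h x"
  shows "has_weak_gradient D v h"
  unfolding has_weak_gradient_def
proof (intro conjI ballI)
  note G = has_weak_gradientD[OF assms(1)]
  show v: "v \<in> L2 D" by (rule L2_dominated[OF G(1) assms(2)]) (use assms(4) in \<open>auto elim: eventually_mono\<close>)
  show h: "h \<in> L2 D" by (rule L2_dominated[OF G(2) assms(3)]) (use assms(5) in \<open>auto elim: eventually_mono\<close>)
  fix \<phi> and i :: 'a assume \<phi>: "\<phi> \<in> test_functions D" "i \<in> Basis"
  note t = L2_measurable[OF test_functions_L2(1)[OF \<phi>(1)]] L2_measurable[OF test_functions_L2(3)[OF \<phi>(1)]]
  have "(\<integral>x. u x * partial_deriv i \<phi> x \<partial>M) = (\<integral>x. v x * partial_deriv i \<phi> x \<partial>M)"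
    by (rule integral_cong_AE) (use t assms(2,4) L2_measurable[OF G(1)] in \<open>auto elim: eventually_mono\<close>)
  moreover have "(\<integral>x. (g x \<bullet> i) * \<phi> x \<partial>M) = (\<integral>x. (h x \<bullet> i) * \<phi> x \<partial>M)"
    by (rule integral_cong_AE) (use t assms(3,5) L2_measurable[OF G(2)] in \<open>auto elim: eventually_mono\<close>)
  ultimately show "(\<integral>x. v x * partial_deriv i \<phi> x \<partial>M) = - (\<integral>x. (h x \<bullet> i) * \<phi> x \<partial>M)"
    using G(3)[OF \<phi>] by simp
qed

text \<open>The weak gradient is a closed operator: for a fixed test function both sides of the
  defining identity are continuous in \<open>L2\<close>.\<close>

lemma weak_gradient_limit:
  assumes "\<And>n. has_weak_gradient D (u n) (g n)" "L2_tendsto D u v" "L2_tendsto D g h"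
  shows "has_weak_gradient D v h"
  unfolding has_weak_gradient_def
proof (intro conjI ballI)
  show "v \<in> L2 D" "h \<in> L2 D" using L2_tendstoD(2) assms(2,3) by blast+
  fix \<phi> and i :: 'a assume \<phi>: "\<phi> \<in> test_functions D" "i \<in> Basis"
  have "(\<lambda>x. \<phi> x *\<^sub>R i) \<in> L2 D"
    by (rule L2_scaleR_bounded[OF test_functions_L2(1)[OF \<phi>(1)], of _ "norm i"]) auto
  from L2_tendsto_inner[OF assms(3) this]
  have "(\<lambda>n. - (\<integral>x. (g n x \<bullet> i) * \<phi> x \<partial>M)) \<longlonglongrightarrow> - (\<integral>x. (h x \<bullet> i) * \<phi> x \<partial>M)"
    by (intro tendsto_minus) (simp add: mult.commute)
  moreover have "(\<lambda>n. - (\<integral>x. (g n x \<bullet> i) * \<phi> x \<partial>M)) \<longlonglongrightarrow> (\<integral>x. v x * partial_deriv i \<phi> x \<partial>M)"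
    using L2_tendsto_mult[OF assms(2) test_functions_L2(3)[OF \<phi>(1), of i]]
    by (simp add: has_weak_gradientD(3)[OF assms(1) \<phi>])
  ultimately show "(\<integral>x. v x * partial_deriv i \<phi> x \<partial>M) = - (\<integral>x. (h x \<bullet> i) * \<phi> x \<partial>M)"
    using LIMSEQ_unique by blast
qed

text \<open>The bound 1 is inherited by all powers, so the product rule for bounded functions
  applies at each step of the induction.\<close>

lemma weak_gradient_power:
  assumes c: "has_weak_gradient D c g" "AE x in M. \<bar>c x\<bar> \<le> 1"
  shows "has_weak_gradient D (\<lambda>x. c x ^ Suc n) (\<lambda>x. (real (Suc n) * c x ^ n) *\<^sub>R g x)"
proof (induction n)
  case (Suc n)
  have "AE x in M. \<bar>c x ^ Suc n\<bar> \<le> 1"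
    using c(2) by eventually_elim (metis abs_ge_zero power_abs power_le_one)
  from weak_gradient_product[OF c Suc.IH this]
  have "has_weak_gradient D (\<lambda>x. c x * c x ^ Suc n) (\<lambda>x. c x *\<^sub>R (real (Suc n) * c x ^ n) *\<^sub>R g x + c x ^ Suc n *\<^sub>R g x)" .
  moreover have "c x *\<^sub>R (real (Suc n) * c x ^ n) *\<^sub>R g x + c x ^ Suc n *\<^sub>R g x
      = (real (Suc (Suc n)) * c x ^ Suc n) *\<^sub>R g x" for x
    by (simp add: scaleR_left_distrib[symmetric]) (simp add: algebra_simps)
  ultimately show ?case by simp
qed (use c(1) in simp)

lemma weak_gradient_sum:
  fixes n :: nat
  assumes "\<And>j. has_weak_gradient D (u j) (g j)"
  shows "has_weak_gradient D (\<lambda>x. \<Sum>j<n. u j x) (\<lambda>x. \<Sum>j<n. g j x)"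
proof (induction n)
  case 0
  show ?case using weak_gradient_const[of 0] by simp
next
  case (Suc n)
  from weak_gradient_linear[OF Suc assms[of n], of 1 1] show ?case by simp
qed

text \<open>\<open>c / (1 - c)\<close> is the sum of the powers of \<open>c\<close> from the first
  on. The partial sums and their derivatives converge under fixed majorants because \<open>c\<close>
  stays away from 1, so closedness of the weak gradient applies.\<close>

lemma weak_gradient_geometric:
  assumes c: "has_weak_gradient D c g" "AE x in M. 0 \<le> c x \<and> c x \<le> k" and k: "k < 1"
  shows "has_weak_gradient D (\<lambda>x. c x / (1 - c x)) (\<lambda>x. (1 / (1 - c x)\<^sup>2) *\<^sub>R g x)"
proof -
  \<comment> \<open>A negative \<open>k\<close> is consistent with the assumption when
    \<open>D\<close> is a null set, whereas the bounds for the series need a nonnegative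
    radius.\<close>
  define k' where "k' = max k 0"
  have k': "0 \<le> k'" "k' < 1" using k by (auto simp: k'_def)
  have ck: "AE x in M. 0 \<le> c x \<and> c x \<le> k'" using c(2) by eventually_elim (auto simp: k'_def)
  have c1: "AE x in M. \<bar>c x\<bar> \<le> 1" using ck by eventually_elim (use k' in auto)
  define S where "S n t = (\<Sum>j<n. t ^ Suc j)" for n and t :: real
  define T where "T n t = (\<Sum>j<n. real (Suc j) * t ^ j)" for n and t :: real
  note C = has_weak_gradientD[OF c(1)]
  note cm[measurable] = L2_measurable[OF C(1)] L2_measurable[OF C(2)]
  have Ssums: "(\<lambda>n. S n t) \<longlonglongrightarrow> t / (1 - t)" if "0 \<le> t" "t < 1" for t
  proof -
    have "(\<lambda>j. t * t ^ j) sums (t * (1 / (1 - t)))" using that by (intro sums_mult geometric_sums) simp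
    then show ?thesis by (simp add: S_def sums_def)
  qed
  have Tsums: "(\<lambda>n. T n t) \<longlonglongrightarrow> 1 / (1 - t)\<^sup>2" if "0 \<le> t" "t < 1" for t
    using geometric_deriv_sums[of t] that by (simp add: T_def sums_def)
  \<comment> \<open>The full sum of the derivative series at \<open>k'\<close>. It bounds
    \<open>T\<close> because the terms increase with \<open>t\<close>, and \<open>S\<close> because
    \<open>t ^ Suc j \<le> real (Suc j) * t ^ j\<close> for \<open>t\<close> below 1.\<close>
  define B where "B = 1 / (1 - k')\<^sup>2"
  have TB: "0 \<le> T n t \<and> T n t \<le> B" if "0 \<le> t" "t \<le> k'" for n t
  proof -
    have "T n t \<le> T n k'" unfolding T_def using that by (intro sum_mono mult_left_mono power_mono) auto
    moreover have "T n k' \<le> B"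
      unfolding T_def B_def using geometric_deriv_sums[of k'] k'
      by (intro sum_le_suminf[of "\<lambda>j. real (Suc j) * k' ^ j" "{..<n}", THEN order_trans])
         (auto simp: sums_iff)
    ultimately show ?thesis using that by (auto simp: T_def intro!: sum_nonneg)
  qed
  have SB: "0 \<le> S n t \<and> S n t \<le> B" if "0 \<le> t" "t \<le> k'" for n t
  proof -
    have "S n t \<le> T n t" unfolding S_def T_def
    proof (rule sum_mono)
      fix j
      have "t * t ^ j \<le> real (Suc j) * t ^ j" using that k' by (intro mult_right_mono) auto
      then show "t ^ Suc j \<le> real (Suc j) * t ^ j" by simp
    qed
    then show ?thesis using TB[OF that, of n] that by (auto simp: S_def intro!: sum_nonneg)
  qed
  show ?thesis
  proof (rule weak_gradient_limit)
    show "has_weak_gradient D (\<lambda>x. S n (c x)) (\<lambda>x. T n (c x) *\<^sub>R g x)" for n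
      using weak_gradient_sum[OF weak_gradient_power[OF c(1) c1], where n = n]
      by (simp add: S_def T_def scaleR_sum_left)
    show "L2_tendsto D (\<lambda>n x. S n (c x)) (\<lambda>x. c x / (1 - c x))"
    proof (rule L2_tendsto_dominated[OF L2_const[of B]])
      show "(\<lambda>x. S n (c x)) \<in> borel_measurable M" for n unfolding S_def by measurable
      show "AE x in M. (\<lambda>n. S n (c x)) \<longlonglongrightarrow> c x / (1 - c x)"
        using ck by eventually_elim (use Ssums k' in auto)
      show "AE x in M. norm (S n (c x)) \<le> norm B" for n
        using ck
      proof eventually_elim
        case (elim x)
        then show ?case using SB[of "c x" n] by simp
      qed
    qed measurable
    show "L2_tendsto D (\<lambda>n x. T n (c x) *\<^sub>R g x) (\<lambda>x. (1 / (1 - c x)\<^sup>2) *\<^sub>R g x)"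
    proof (rule L2_tendsto_dominated[OF L2_scaleR[OF C(2), of B]])
      show "(\<lambda>x. T n (c x) *\<^sub>R g x) \<in> borel_measurable M" for n unfolding T_def by measurable
      show "AE x in M. (\<lambda>n. T n (c x) *\<^sub>R g x) \<longlonglongrightarrow> (1 / (1 - c x)\<^sup>2) *\<^sub>R g x"
        using ck
      proof eventually_elim
        case (elim x)
        then show ?case using k' by (intro tendsto_scaleR Tsums tendsto_const) auto
      qed
      show "AE x in M. norm (T n (c x) *\<^sub>R g x) \<le> norm (B *\<^sub>R g x)" for n
        using ck
      proof eventually_elim
        case (elim x)
        then show ?case using TB[of "c x" n] by (auto intro!: mult_right_mono)
      qed
    qed measurable
  qed
qed

text \<open>With \<open>c = 1 - a / Lam\<close>, which lies in \<open>[0, 1 - lam / Lam]\<close>,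
  one has \<open>1 / a = (1 + c / (1 - c)) / Lam\<close>, so the rule for the geometric series
  applies.\<close>

lemma weak_gradient_inverse:
  assumes a: "has_weak_gradient D a g" "AE x in M. lam \<le> a x \<and> a x \<le> Lam" and lam: "0 < lam" "0 < Lam"
  shows "has_weak_gradient D (\<lambda>x. 1 / a x) (\<lambda>x. (- (1 / (a x)\<^sup>2)) *\<^sub>R g x)"
proof -
  let ?c = "\<lambda>x. 1 - a x / Lam"
  note A = has_weak_gradientD[OF a(1)]
  note [measurable] = L2_measurable[OF A(1)] L2_measurable[OF A(2)]
  have "has_weak_gradient D ?c (\<lambda>x. (- (1 / Lam)) *\<^sub>R g x)"
    using weak_gradient_linear[OF weak_gradient_const[of 1] a(1), of 1 "- (1 / Lam)"] by simp
  moreover have "AE x in M. 0 \<le> ?c x \<and> ?c x \<le> 1 - lam / Lam"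
    using a(2) by eventually_elim (use lam in \<open>auto simp: field_simps\<close>)
  ultimately have "has_weak_gradient D (\<lambda>x. ?c x / (1 - ?c x)) (\<lambda>x. (1 / (1 - ?c x)\<^sup>2) *\<^sub>R (- (1 / Lam)) *\<^sub>R g x)"
    by (rule weak_gradient_geometric) (use lam in simp)
  from weak_gradient_linear[OF weak_gradient_const[of 1] this, of "1 / Lam" "1 / Lam"]
  have 1: "has_weak_gradient D (\<lambda>x. 1 / Lam + 1 / Lam * (?c x / (1 - ?c x)))
      (\<lambda>x. (1 / Lam) *\<^sub>R (1 / (1 - ?c x)\<^sup>2) *\<^sub>R (- (1 / Lam)) *\<^sub>R g x)"
    by simp
  show ?thesis
  proof (rule weak_gradient_cong_AE[OF 1])
    show "AE x in M. 1 / Lam + 1 / Lam * (?c x / (1 - ?c x)) = 1 / a x"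
      using a(2)
    proof eventually_elim
      case (elim x)
      then have "a x > 0" using lam by linarith
      then show ?case using lam by (simp add: divide_simps)
    qed
    show "AE x in M. (1 / Lam) *\<^sub>R (1 / (1 - ?c x)\<^sup>2) *\<^sub>R (- (1 / Lam)) *\<^sub>R g x = (- (1 / (a x)\<^sup>2)) *\<^sub>R g x"
      using a(2)
    proof eventually_elim
      case (elim x)
      then have "a x > 0" using lam by linarith
      then have "(1 / Lam) * ((1 / (1 - ?c x)\<^sup>2) * (- (1 / Lam))) = - (1 / (a x)\<^sup>2)"
        using lam by (simp add: power2_eq_square)
      then show ?case by (metis scaleR_scaleR)
    qed
  qed measurable
qed

end

section \<open>Approximation by test functions\<close>

text \<open>Membership in \<open>H10\<close> with an explicit gradient \<open>g\<close>, freed from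
  the choice in \<open>wgrad\<close>. Almost everywhere convergence is included so that products and
  compositions can be handled by dominated convergence.\<close>

definition test_approx ::
  "'a::euclidean_space set \<Rightarrow> (nat \<Rightarrow> 'a \<Rightarrow> real) \<Rightarrow> ('a \<Rightarrow> real) \<Rightarrow> ('a \<Rightarrow> 'a) \<Rightarrow> bool" where
  "test_approx D \<phi> v g \<longleftrightarrow> (\<forall>n. \<phi> n \<in> test_functions D) \<and> L2_tendsto D \<phi> v \<and>
     L2_tendsto D (\<lambda>n. grad (\<phi> n)) g \<and> (AE x in lebesgue_on D. (\<lambda>n. \<phi> n x) \<longlonglongrightarrow> v x)"

lemma test_approxD:
  assumes "test_approx D \<phi> v g"
  shows "\<phi> n \<in> test_functions D" "L2_tendsto D \<phi> v" "L2_tendsto D (\<lambda>n. grad (\<phi> n)) g"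
    "AE x in lebesgue_on D. (\<lambda>n. \<phi> n x) \<longlonglongrightarrow> v x"
  using assms by (auto simp: test_approx_def)

lemma grad_comp:
  assumes "f differentiable (at x)" "(G has_real_derivative G') (at (f x))"
  shows "grad (\<lambda>x. G (f x)) x = G' *\<^sub>R grad f x"
  by (rule grad_eqI) (simp add: partial_deriv_comp[OF assms] grad_inner_Basis)

lemma real_sin_scaled_tendsto: "(\<lambda>n. real (Suc n) * sin (t / real (Suc n))) \<longlonglongrightarrow> t"
proof -
  have "((\<lambda>s. sin (s * t)) has_real_derivative t) (at 0)"
    by (auto intro!: derivative_eq_intros)
  then have "((\<lambda>s. sin (s * t) / s) \<longlongrightarrow> t) (at 0)"
    by (simp add: DERIV_def)
  moreover have "filterlim (\<lambda>n. 1 / real (Suc n)) (at 0) sequentially"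
    unfolding filterlim_at using LIMSEQ_Suc[OF lim_1_over_n] by auto
  ultimately have "(\<lambda>n. sin (1 / real (Suc n) * t) / (1 / real (Suc n))) \<longlonglongrightarrow> t"
    by (rule filterlim_compose)
  then show ?thesis by (simp add: mult.commute)
qed

context bounded_open
begin

section \<open>Approximating sequences for \<open>H10\<close>\<close>

lemma test_approx_subseq:
  assumes "test_approx D \<phi> v g" "strict_mono r"
  shows "test_approx D (\<lambda>n. \<phi> (r n)) v g"
  unfolding test_approx_def
proof (intro conjI allI)
  note T = test_approxD[OF assms(1)]
  show "\<phi> (r n) \<in> test_functions D" for n by (rule T(1))
  show "L2_tendsto D (\<lambda>n. \<phi> (r n)) v" "L2_tendsto D (\<lambda>n. grad (\<phi> (r n))) g"
    using L2_tendsto_subseq[OF T(2) assms(2)] L2_tendsto_subseq[OF T(3) assms(2)] by auto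
  show "AE x in M. (\<lambda>n. \<phi> (r n) x) \<longlonglongrightarrow> v x"
    using T(4) by eventually_elim (use LIMSEQ_subseq_LIMSEQ[OF _ assms(2)] in \<open>auto simp: o_def\<close>)
qed

lemma H10_test_approx:
  assumes u: "u \<in> H10 D"
  obtains \<phi> where "test_approx D \<phi> u (wgrad D u)"
proof -
  obtain \<phi> where \<phi>: "\<And>n::nat. \<phi> n \<in> test_functions D" "(\<lambda>n. H1_norm D (\<lambda>x. \<phi> n x - u x)) \<longlonglongrightarrow> 0"
    using u by (auto simp: H10_def)
  note W = wgrad[OF H10_imp_H1[OF u]]
  have eq: "L2_norm D (wgrad D (\<lambda>x. \<phi> n x - u x)) = L2_norm D (\<lambda>x. grad (\<phi> n) x - wgrad D u x)" for n
    by (rule L2_norm_wgrad[OF weak_gradient_diff[OF test_function_weak_gradient[OF \<phi>(1)] W]])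
  have le: "L2_norm D (\<lambda>x. \<phi> n x - u x) \<le> H1_norm D (\<lambda>x. \<phi> n x - u x)"
    "L2_norm D (\<lambda>x. grad (\<phi> n) x - wgrad D u x) \<le> H1_norm D (\<lambda>x. \<phi> n x - u x)" for n
    unfolding H1_norm_def eq by (auto intro!: real_le_rsqrt)
  have 1: "L2_tendsto D \<phi> u" "L2_tendsto D (\<lambda>n. grad (\<phi> n)) (wgrad D u)"
    unfolding L2_tendsto_def
    using test_functions_L2[OF \<phi>(1)] has_weak_gradientD(1,2)[OF W] null_squeeze[OF L2_norm_nonneg le(1) \<phi>(2)]
      null_squeeze[OF L2_norm_nonneg le(2) \<phi>(2)] by auto
  obtain r where r: "strict_mono r" "AE x in M. (\<lambda>n. \<phi> (r n) x) \<longlonglongrightarrow> u x"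
    using L2_tendsto_AE_subseq[OF 1(1)] by blast
  have "test_approx D (\<lambda>n. \<phi> (r n)) u (wgrad D u)"
    using \<phi>(1) L2_tendsto_subseq[OF 1(1) r(1)] L2_tendsto_subseq[OF 1(2) r(1)] r(2)
    by (auto simp: test_approx_def)
  then show ?thesis by (rule that)
qed

lemma test_functions_H10:
  assumes \<phi>: "\<phi> \<in> test_functions D"
  shows "\<phi> \<in> H10 D"
proof -
  have "H1_norm D (\<lambda>x. \<phi> x - \<phi> x) = 0"
    using H1_norm_scale[OF H1I[OF test_function_weak_gradient[OF \<phi>]], of 0] by simp
  then show ?thesis
    unfolding H10_def using \<phi> H1I[OF test_function_weak_gradient[OF \<phi>]]
    by (auto intro!: exI[of _ "\<lambda>n. \<phi>"])
qed

text \<open>Both sides of the equation are \<open>L2\<close> pairings, hence pass to the limit along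
  the approximating sequence.\<close>

lemma test_approx_equation:
  fixes \<sigma> :: "'a \<Rightarrow> 'a"
  assumes "test_approx D \<phi> v g" "\<sigma> \<in> L2 D" "f \<in> L2 D"
    and eq: "\<And>\<psi>. \<psi> \<in> test_functions D \<Longrightarrow> (\<integral>x. \<sigma> x \<bullet> grad \<psi> x \<partial>M) = (\<integral>x. f x * \<psi> x \<partial>M)"
  shows "(\<integral>x. \<sigma> x \<bullet> g x \<partial>M) = (\<integral>x. f x * v x \<partial>M)"
proof -
  note T = test_approxD[OF assms(1)]
  have "(\<lambda>n. \<integral>x. \<sigma> x \<bullet> grad (\<phi> n) x \<partial>M) \<longlonglongrightarrow> (\<integral>x. \<sigma> x \<bullet> g x \<partial>M)"
    using L2_tendsto_inner[OF T(3) assms(2)] by (simp add: inner_commute)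
  moreover have "(\<lambda>n. \<integral>x. \<sigma> x \<bullet> grad (\<phi> n) x \<partial>M) \<longlonglongrightarrow> (\<integral>x. f x * v x \<partial>M)"
    unfolding eq[OF T(1)] using L2_tendsto_mult[OF T(2) assms(3)] by (simp add: mult.commute)
  ultimately show ?thesis by (rule LIMSEQ_unique)
qed

text \<open>The chain rule is applied to test functions only. The gradient error splits into
  \<open>G'(\<psi>) (grad \<psi> - g)\<close>, small because \<open>G'\<close> is bounded, and
  \<open>(G'(\<psi>) - G'(v)) g\<close>, small by dominated convergence because \<open>G'\<close> is
  continuous and bounded.\<close>

lemma test_approx_comp:
  assumes T: "test_approx D \<phi> v g" and G: "smooth_real G" "G 0 = 0"
    and d: "\<And>t. (G has_real_derivative G' t) (at t)" "continuous_on UNIV G'" "\<And>t. \<bar>G' t\<bar> \<le> L"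
  shows "\<exists>r. strict_mono r \<and> test_approx D (\<lambda>n x. G (\<phi> (r n) x)) (\<lambda>x. G (v x)) (\<lambda>x. G' (v x) *\<^sub>R g x)"
proof -
  note T0 = test_approxD[OF T]
  have L: "L \<ge> 0" using d(3)[of 0] by linarith
  obtain r where r: "strict_mono r" "AE x in M. (\<lambda>n. \<phi> (r n) x) \<longlonglongrightarrow> v x"
    using L2_tendsto_AE_subseq[OF T0(2)] by blast
  note T1 = test_approxD[OF test_approx_subseq[OF T r(1)]]
  define \<psi> where "\<psi> n = \<phi> (r n)" for n
  note T1 = T1[folded \<psi>_def]
  have [measurable]: "G' \<in> borel_measurable borel" by (rule borel_measurable_continuous_onI[OF d(2)])
  have Gc: "continuous_on UNIV G" by (intro continuous_at_imp_continuous_on ballI DERIV_isCont[OF d(1)])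
  have [measurable]: "G \<in> borel_measurable borel" by (rule borel_measurable_continuous_onI[OF Gc])
  note L2 = L2_tendstoD[OF T1(2)] L2_tendstoD[OF T1(3)]
  note [measurable] = L2_measurable[OF L2(1)] L2_measurable[OF L2(2)] L2_measurable[OF L2(4)] L2_measurable[OF L2(5)]
  have Glip: "\<bar>G s - G t\<bar> \<le> L * \<bar>s - t\<bar>" for s t
  proof -
    have "norm (G s - G t) \<le> L * norm (s - t)"
      by (rule field_differentiable_bound[of UNIV G G']) (use d in auto)
    then show ?thesis by simp
  qed
  have tests: "(\<lambda>x. G (\<psi> n x)) \<in> test_functions D" for n by (rule test_functions_comp[OF T1(1) G])
  have tests_L2: "(\<lambda>x. G (\<psi> n x)) \<in> L2 D" for n by (rule test_functions_L2(1)[OF tests])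
  have GvL2: "(\<lambda>x. G (v x)) \<in> L2 D"
    by (rule L2_dominated[OF L2_scaleR[OF L2(2), of L]]) (use Glip[of _ 0] G(2) L in \<open>auto simp: abs_mult\<close>)
  have 1: "L2_tendsto D (\<lambda>n x. G (\<psi> n x)) (\<lambda>x. G (v x))"
    unfolding L2_tendsto_def
  proof (intro conjI allI tests_L2 GvL2)
    have "L2_norm D (\<lambda>x. G (\<psi> n x) - G (v x)) \<le> L2_norm D (\<lambda>x. L *\<^sub>R (\<psi> n x - v x))" for n
      by (rule L2_norm_mono[OF L2_scaleR[OF L2_diff[OF L2(1,2)]]]) (use Glip L in \<open>auto simp: abs_mult\<close>)
    then have "L2_norm D (\<lambda>x. G (\<psi> n x) - G (v x)) \<le> L * L2_norm D (\<lambda>x. \<psi> n x - v x)" for n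
      using L by (simp only: L2_norm_scaleR abs_of_nonneg)
    moreover have "(\<lambda>n. L * L2_norm D (\<lambda>x. \<psi> n x - v x)) \<longlonglongrightarrow> 0"
      using tendsto_mult_left[OF L2(3), of L] by simp
    ultimately show "(\<lambda>n. L2_norm D (\<lambda>x. G (\<psi> n x) - G (v x))) \<longlonglongrightarrow> 0"
      by (rule null_squeeze[OF L2_norm_nonneg])
  qed
  have gr: "grad (\<lambda>x. G (\<psi> n x)) = (\<lambda>x. G' (\<psi> n x) *\<^sub>R grad (\<psi> n) x)" for n
    by (rule ext) (rule grad_comp[OF smooth_differentiable[OF test_functionsD(1)[OF T1(1)]] d(1)])
  have A: "L2_tendsto D (\<lambda>n x. G' (\<psi> n x) *\<^sub>R (grad (\<psi> n) x - g x)) (\<lambda>x. 0)"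
    unfolding L2_tendsto_def
  proof (intro conjI allI L2_zero)
    note df = L2_diff[OF L2(4,5)]
    show "(\<lambda>x. G' (\<psi> n x) *\<^sub>R (grad (\<psi> n) x - g x)) \<in> L2 D" for n
      by (rule L2_bounded_scaleR(1)[OF df, where K = L]) (use d(3) in auto)
    have "L2_norm D (\<lambda>x. G' (\<psi> n x) *\<^sub>R (grad (\<psi> n) x - g x) - 0) \<le> L * L2_norm D (\<lambda>x. grad (\<psi> n) x - g x)" for n
      using L2_bounded_scaleR(2)[OF df _ _ L, of "\<lambda>x. G' (\<psi> n x)"] d(3) by simp
    moreover have "(\<lambda>n. L * L2_norm D (\<lambda>x. grad (\<psi> n) x - g x)) \<longlonglongrightarrow> 0"
      using tendsto_mult_left[OF L2(6), of L] by simp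
    ultimately show "(\<lambda>n. L2_norm D (\<lambda>x. G' (\<psi> n x) *\<^sub>R (grad (\<psi> n) x - g x) - 0)) \<longlonglongrightarrow> 0"
      by (rule null_squeeze[OF L2_norm_nonneg])
  qed
  have B: "L2_tendsto D (\<lambda>n x. G' (\<psi> n x) *\<^sub>R g x) (\<lambda>x. G' (v x) *\<^sub>R g x)"
  proof (rule L2_tendsto_dominated[OF L2_scaleR[OF L2(5), of L]])
    show "AE x in M. (\<lambda>n. G' (\<psi> n x) *\<^sub>R g x) \<longlonglongrightarrow> G' (v x) *\<^sub>R g x"
      using r(2)
    proof eventually_elim
      case (elim x)
      have "isCont G' (v x)" using d(2) by (simp add: continuous_on_eq_continuous_at)
      from isCont_tendsto_compose[OF this elim] show ?case
        unfolding \<psi>_def by (intro tendsto_scaleR tendsto_const)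
    qed
    show "AE x in M. norm (G' (\<psi> n x) *\<^sub>R g x) \<le> norm (L *\<^sub>R g x)" for n
      using d(3) L by (auto intro!: mult_right_mono)
  qed measurable
  have 2: "L2_tendsto D (\<lambda>n. grad (\<lambda>x. G (\<psi> n x))) (\<lambda>x. G' (v x) *\<^sub>R g x)"
    using L2_tendsto_add[OF A B] by (simp add: gr scaleR_diff_right)
  have 3: "AE x in M. (\<lambda>n. G (\<psi> n x)) \<longlonglongrightarrow> G (v x)"
    using r(2)
  proof eventually_elim
    case (elim x)
    show ?case unfolding \<psi>_def by (rule isCont_tendsto_compose[OF DERIV_isCont[OF d(1)] elim])
  qed
  show ?thesis
    using tests 1 2 3 r(1) unfolding test_approx_def \<psi>_def by blast
qed

text \<open>The function \<open>m sin (u / m)\<close> truncates \<open>u\<close> smoothly; it converges to \<open>u\<close> as \<open>m\<close> grows.\<close>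

proposition weak_divergence_bounded_product:
  fixes \<sigma> :: "'a \<Rightarrow> 'a"
  assumes \<sigma>: "\<sigma> \<in> L2 D" and f: "f \<in> L2 D"
    and eq: "\<And>\<psi>. \<psi> \<in> test_functions D \<Longrightarrow> (\<integral>x. \<sigma> x \<bullet> grad \<psi> x \<partial>M) = (\<integral>x. f x * \<psi> x \<partial>M)"
    and w: "has_weak_gradient D w g" "AE x in M. \<bar>w x\<bar> \<le> K"
    and u: "test_approx D \<phi> u p" "AE x in M. \<bar>u x\<bar> \<le> U"
  shows "(\<integral>x. \<sigma> x \<bullet> (u x *\<^sub>R g x + w x *\<^sub>R p x) \<partial>M) = (\<integral>x. f x * (w x * u x) \<partial>M)"
proof -
  note W = has_weak_gradientD[OF w(1)]
  note U0 = test_approxD[OF u(1)]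
  note uL2 = L2_tendstoD(2)[OF U0(2)] and pL2 = L2_tendstoD(2)[OF U0(3)]
  note [measurable] = L2_measurable[OF W(1)] L2_measurable[OF W(2)] L2_measurable[OF uL2] L2_measurable[OF pL2]
    L2_measurable[OF \<sigma>] L2_measurable[OF f]
  have w\<sigma>: "(\<lambda>x. w x *\<^sub>R \<sigma> x) \<in> L2 D" by (rule L2_bounded_scaleR(1)[OF \<sigma> _ w(2)]) measurable
  have fw: "(\<lambda>x. w x * f x) \<in> L2 D" using L2_bounded_scaleR(1)[OF f _ w(2)] by simp
  have \<sigma>g: "integrable M (\<lambda>x. \<sigma> x \<bullet> g x)" by (rule L2_inner_integrable[OF \<sigma> W(2)])
  have wsp: "integrable M (\<lambda>x. p x \<bullet> (w x *\<^sub>R \<sigma> x))" by (rule L2_inner_integrable[OF pL2 w\<sigma>])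
  have ufw: "integrable M (\<lambda>x. u x * (w x * f x))" by (rule L2_mult_integrable[OF uL2 fw])
  \<comment> \<open>The function \<open>\<sigma> . g\<close> is only integrable, so convergence in
    \<open>L2\<close> of the test functions does not control its integral against them. The
    truncation bounds them by \<open>m + 1\<close> uniformly in \<open>n\<close>, which permits
    dominated convergence; \<open>m\<close> is sent to infinity afterwards.\<close>
  have trunc: "(\<integral>x. (real (Suc m) * sin (u x / real (Suc m))) * (\<sigma> x \<bullet> g x) \<partial>M)
      + (\<integral>x. cos (u x / real (Suc m)) * (p x \<bullet> (w x *\<^sub>R \<sigma> x)) \<partial>M)
      = (\<integral>x. (real (Suc m) * sin (u x / real (Suc m))) * (w x * f x) \<partial>M)" for m
  proof -
    define G where "G t = real (Suc m) * sin (1 / real (Suc m) * t)" for t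
    have Gm: "\<bar>G t\<bar> \<le> real (Suc m)" for t
      using mult_left_mono[OF abs_sin_le_one[of "1 / real (Suc m) * t"], of "real (Suc m)"] by (simp add: G_def abs_mult)
    have deriv: "(G has_real_derivative cos (t / real (Suc m))) (at t)" for t
      unfolding G_def by (auto intro!: derivative_eq_intros simp del: of_nat_Suc)
    have smG: "smooth_real G" unfolding G_def by (rule smooth_real_sin)
    have cont: "continuous_on UNIV (\<lambda>t. cos (t / real (Suc m)))"
      by (intro continuous_intros) simp
    have G0: "G 0 = 0" by (simp add: G_def)
    obtain r where r: "test_approx D (\<lambda>n x. G (\<phi> (r n) x)) (\<lambda>x. G (u x)) (\<lambda>x. cos (u x / real (Suc m)) *\<^sub>R p x)"
      using test_approx_comp[OF u(1) smG G0 deriv cont abs_cos_le_one] by blast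
    note R = test_approxD[OF r]
    define \<psi> where "\<psi> n x = G (\<phi> (r n) x)" for n x
    note R = R[folded \<psi>_def]
    have \<psi>b: "\<bar>\<psi> n x\<bar> \<le> real (Suc m)" for n x using Gm by (simp add: \<psi>_def)
    have \<psi>m[measurable]: "\<psi> n \<in> borel_measurable M" for n by (rule L2_measurable[OF test_functions_L2(1)[OF R(1)]])
    have Gum[measurable]: "(\<lambda>x. G (u x)) \<in> borel_measurable M" by (rule L2_measurable[OF L2_tendstoD(2)[OF R(2)]])
    have split: "(\<integral>x. \<psi> n x * (\<sigma> x \<bullet> g x) \<partial>M) + (\<integral>x. grad (\<psi> n) x \<bullet> (w x *\<^sub>R \<sigma> x) \<partial>M)
        = (\<integral>x. \<psi> n x * (w x * f x) \<partial>M)" for n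
    proof -
      have i1: "integrable M (\<lambda>x. \<psi> n x * (\<sigma> x \<bullet> g x))"
        using L2_inner_integrable[OF \<sigma> test_scaleR_L2[OF R(1) W(2)], of n] by simp
      have i2: "integrable M (\<lambda>x. grad (\<psi> n) x \<bullet> (w x *\<^sub>R \<sigma> x))"
        by (rule L2_inner_integrable[OF test_functions_L2(2)[OF R(1)] w\<sigma>])
      have "(\<integral>x. \<sigma> x \<bullet> (\<psi> n x *\<^sub>R g x + w x *\<^sub>R grad (\<psi> n) x) \<partial>M) = (\<integral>x. f x * (w x * \<psi> n x) \<partial>M)"
        by (rule weak_divergence_product[OF \<sigma> f eq w(1) R(1)])
      moreover have "(\<integral>x. \<sigma> x \<bullet> (\<psi> n x *\<^sub>R g x + w x *\<^sub>R grad (\<psi> n) x) \<partial>M)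
          = (\<integral>x. \<psi> n x * (\<sigma> x \<bullet> g x) \<partial>M) + (\<integral>x. grad (\<psi> n) x \<bullet> (w x *\<^sub>R \<sigma> x) \<partial>M)"
        unfolding Bochner_Integration.integral_add[OF i1 i2, symmetric]
        by (rule Bochner_Integration.integral_cong[OF refl]) (simp add: inner_add_right inner_commute)
      ultimately show ?thesis by (simp add: mult_ac)
    qed
    have l1: "(\<lambda>n. \<integral>x. \<psi> n x * (\<sigma> x \<bullet> g x) \<partial>M) \<longlonglongrightarrow> (\<integral>x. G (u x) * (\<sigma> x \<bullet> g x) \<partial>M)"
    proof (rule integral_dominated_convergence)
      show "integrable M (\<lambda>x. real (Suc m) * \<bar>\<sigma> x \<bullet> g x\<bar>)" using \<sigma>g by simp
      show "AE x in M. (\<lambda>n. \<psi> n x * (\<sigma> x \<bullet> g x)) \<longlonglongrightarrow> G (u x) * (\<sigma> x \<bullet> g x)"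
        using R(4) by eventually_elim (rule tendsto_mult_right)
      show "AE x in M. norm (\<psi> n x * (\<sigma> x \<bullet> g x)) \<le> real (Suc m) * \<bar>\<sigma> x \<bullet> g x\<bar>" for n
        using mult_right_mono[OF \<psi>b abs_ge_zero] by (simp add: abs_mult)
    qed measurable
    have l2: "(\<lambda>n. \<integral>x. grad (\<psi> n) x \<bullet> (w x *\<^sub>R \<sigma> x) \<partial>M)
        \<longlonglongrightarrow> (\<integral>x. (cos (u x / real (Suc m)) *\<^sub>R p x) \<bullet> (w x *\<^sub>R \<sigma> x) \<partial>M)"
      by (rule L2_tendsto_inner[OF R(3) w\<sigma>])
    have l3: "(\<lambda>n. \<integral>x. \<psi> n x * (w x * f x) \<partial>M) \<longlonglongrightarrow> (\<integral>x. G (u x) * (w x * f x) \<partial>M)"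
      by (rule L2_tendsto_mult[OF R(2) fw])
    from LIMSEQ_unique[OF tendsto_add[OF l1 l2, unfolded split] l3]
    show ?thesis by (simp add: G_def mult.left_commute)
  qed
  have sinb: "\<bar>real (Suc m) * sin (t / real (Suc m))\<bar> \<le> \<bar>t\<bar>" for m t
  proof -
    have "real (Suc m) * \<bar>sin (t / real (Suc m))\<bar> \<le> real (Suc m) * \<bar>t / real (Suc m)\<bar>"
      by (intro mult_left_mono abs_sin_x_le_abs_x) simp
    then show ?thesis by (simp add: abs_mult del: of_nat_Suc)
  qed
  \<comment> \<open>Here the sup bound on \<open>u\<close> enters:
    \<open>|m sin (u / m)| \<le> |u| \<le> U\<close> gives the integrable majorant.\<close>
  have k1: "(\<lambda>m. \<integral>x. (real (Suc m) * sin (u x / real (Suc m))) * (\<sigma> x \<bullet> g x) \<partial>M) \<longlonglongrightarrow> (\<integral>x. u x * (\<sigma> x \<bullet> g x) \<partial>M)"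
  proof (rule integral_dominated_convergence)
    show "integrable M (\<lambda>x. U * \<bar>\<sigma> x \<bullet> g x\<bar>)" using \<sigma>g by simp
    show "AE x in M. (\<lambda>m. (real (Suc m) * sin (u x / real (Suc m))) * (\<sigma> x \<bullet> g x)) \<longlonglongrightarrow> u x * (\<sigma> x \<bullet> g x)"
      by (intro AE_I2 tendsto_mult_right real_sin_scaled_tendsto)
    show "AE x in M. norm ((real (Suc m) * sin (u x / real (Suc m))) * (\<sigma> x \<bullet> g x)) \<le> U * \<bar>\<sigma> x \<bullet> g x\<bar>" for m
      using u(2)
    proof eventually_elim
      case (elim x)
      from mult_right_mono[OF order_trans[OF sinb elim] abs_ge_zero] show ?case unfolding real_norm_def abs_mult .
    qed
  qed measurable
  \<comment> \<open>The cosine is the derivative of the truncation and tends to 1.\<close>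
  have k2: "(\<lambda>m. \<integral>x. cos (u x / real (Suc m)) * (p x \<bullet> (w x *\<^sub>R \<sigma> x)) \<partial>M) \<longlonglongrightarrow> (\<integral>x. 1 * (p x \<bullet> (w x *\<^sub>R \<sigma> x)) \<partial>M)"
  proof (rule integral_dominated_convergence)
    show "integrable M (\<lambda>x. \<bar>p x \<bullet> (w x *\<^sub>R \<sigma> x)\<bar>)" using wsp by simp
    show "AE x in M. (\<lambda>m. cos (u x / real (Suc m)) * (p x \<bullet> (w x *\<^sub>R \<sigma> x))) \<longlonglongrightarrow> 1 * (p x \<bullet> (w x *\<^sub>R \<sigma> x))"
    proof (intro AE_I2 tendsto_mult_right)
      fix x
      have "(\<lambda>m. u x / real (Suc m)) \<longlonglongrightarrow> 0"
        using LIMSEQ_Suc[OF lim_const_over_n[of "u x"]] by simp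
      from tendsto_cos[OF this] show "(\<lambda>m. cos (u x / real (Suc m))) \<longlonglongrightarrow> 1" by simp
    qed
    show "AE x in M. norm (cos (u x / real (Suc m)) * (p x \<bullet> (w x *\<^sub>R \<sigma> x))) \<le> \<bar>p x \<bullet> (w x *\<^sub>R \<sigma> x)\<bar>" for m
      using mult_right_mono[OF abs_cos_le_one abs_ge_zero] by (simp only: real_norm_def abs_mult mult_1) simp
  qed measurable
  have k3: "(\<lambda>m. \<integral>x. (real (Suc m) * sin (u x / real (Suc m))) * (w x * f x) \<partial>M) \<longlonglongrightarrow> (\<integral>x. u x * (w x * f x) \<partial>M)"
  proof (rule integral_dominated_convergence)
    show "integrable M (\<lambda>x. \<bar>u x * (w x * f x)\<bar>)" using ufw by simp
    show "AE x in M. (\<lambda>m. (real (Suc m) * sin (u x / real (Suc m))) * (w x * f x)) \<longlonglongrightarrow> u x * (w x * f x)"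
      by (intro AE_I2 tendsto_mult_right real_sin_scaled_tendsto)
    show "AE x in M. norm ((real (Suc m) * sin (u x / real (Suc m))) * (w x * f x)) \<le> \<bar>u x * (w x * f x)\<bar>" for m
    proof (rule AE_I2)
      fix x
      from mult_right_mono[OF sinb[of m "u x"] abs_ge_zero[of "w x * f x"]]
      show "norm ((real (Suc m) * sin (u x / real (Suc m))) * (w x * f x)) \<le> \<bar>u x * (w x * f x)\<bar>"
        unfolding real_norm_def abs_mult .
    qed
  qed measurable
  note lim = LIMSEQ_unique[OF tendsto_add[OF k1 k2, unfolded trunc] k3]
  have iu: "integrable M (\<lambda>x. u x * (\<sigma> x \<bullet> g x))"
  proof (rule Bochner_Integration.integrable_bound[of _ "\<lambda>x. U * \<bar>\<sigma> x \<bullet> g x\<bar>"])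
    show "AE x in M. norm (u x * (\<sigma> x \<bullet> g x)) \<le> norm (U * \<bar>\<sigma> x \<bullet> g x\<bar>)"
      using u(2)
    proof eventually_elim
      case (elim x)
      from mult_right_mono[OF this abs_ge_zero[of "\<sigma> x \<bullet> g x"]] show ?case using elim by (simp add: abs_mult)
    qed
  qed (use \<sigma>g in auto)
  have "(\<integral>x. \<sigma> x \<bullet> (u x *\<^sub>R g x + w x *\<^sub>R p x) \<partial>M) = (\<integral>x. u x * (\<sigma> x \<bullet> g x) + p x \<bullet> (w x *\<^sub>R \<sigma> x) \<partial>M)"
    by (simp add: inner_add_right inner_commute)
  also have "\<dots> = (\<integral>x. u x * (\<sigma> x \<bullet> g x) \<partial>M) + (\<integral>x. p x \<bullet> (w x *\<^sub>R \<sigma> x) \<partial>M)"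
    by (rule Bochner_Integration.integral_add[OF iu wsp])
  finally show ?thesis using lim by (simp add: mult_ac)
qed

end

section \<open>Nash inequality\<close>

lemma smooth_real_affine:
  assumes "smooth_real G"
  shows "smooth_real (\<lambda>t. c * G (\<alpha> * t + \<beta>))"
proof -
  obtain d where d: "d 0 = G" "\<And>j t. (d j has_real_derivative d (Suc j) t) (at t)"
    using assms unfolding smooth_real_def by blast
  have "((\<lambda>t. c * \<alpha> ^ j * d j (\<alpha> * t + \<beta>)) has_real_derivative c * \<alpha> ^ Suc j * d (Suc j) (\<alpha> * t + \<beta>)) (at t)" for j t
    by (rule derivative_eq_intros DERIV_chain2[OF d(2)] refl | simp)+
  then show ?thesis
    unfolding smooth_real_def using d(1)
    by (intro exI[of _ "\<lambda>j t. c * \<alpha> ^ j * d j (\<alpha> * t + \<beta>)"]) auto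
qed

definition flat_exp' :: "real \<Rightarrow> real" where
  "flat_exp' t = (1 / t)\<^sup>2 * flat_exp t"

lemma flat_exp_deriv: "(flat_exp has_real_derivative flat_exp' t) (at t)"
  using flat_exp_poly_deriv[of 1 t] by (simp add: flat_exp'_def power2_eq_square)

lemma continuous_flat_exp': "continuous_on UNIV flat_exp'"
proof (intro continuous_at_imp_continuous_on ballI)
  fix t
  show "isCont flat_exp' t"
    using DERIV_isCont[OF flat_exp_poly_deriv[of "[:0, 0, 1:]" t]]
    by (simp add: flat_exp'_def[abs_def] power2_eq_square)
qed

lemma flat_exp_nonneg: "0 \<le> flat_exp t" by (simp add: flat_exp_def)

text \<open>With \<open>y = 1 / t\<close> the upper bound reads \<open>y^2 \<le> exp y\<close>,
  which follows from \<open>y \<le> 1 + y/2 + y^2/8 \<le> exp (y/2)\<close>. The constant 1 matters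
  in the energy estimate, where it gives \<open>G'^2 \<le> G'\<close>.\<close>

lemma flat_exp'_bounds: "0 \<le> flat_exp' t" "flat_exp' t \<le> 1"
proof -
  show "0 \<le> flat_exp' t" by (simp add: flat_exp'_def flat_exp_nonneg)
  show "flat_exp' t \<le> 1"
  proof (cases "t > 0")
    case True
    define y where "y = 1 / t"
    have y: "y > 0" using True by (simp add: y_def)
    have "1 + y / 2 + (y / 2)\<^sup>2 / 2 \<le> exp (y / 2)" using y by (intro exp_lower_Taylor_quadratic) simp
    moreover have "y \<le> 1 + y / 2 + (y / 2)\<^sup>2 / 2"
      using zero_le_power2[of "y - 2"] by (simp add: power2_eq_square algebra_simps)
    ultimately have "y \<le> exp (y / 2)" by linarith
    then have "y\<^sup>2 \<le> (exp (y / 2))\<^sup>2" using y by (intro power_mono) auto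
    also have "\<dots> = exp y" by (simp add: power2_eq_square exp_add[symmetric])
    finally have "y\<^sup>2 * exp (- y) \<le> 1" by (simp add: exp_minus field_simps)
    then show ?thesis using True by (simp add: flat_exp'_def flat_exp_def y_def)
  qed (simp add: flat_exp'_def flat_exp_def)
qed

lemma flat_exp_ge: "t \<ge> 1 \<Longrightarrow> exp (- 1) \<le> flat_exp t"
  by (simp add: flat_exp_def)

text \<open>The segment from 0 to \<open>h\<close> is cut into \<open>N\<close> equal steps.
  Cauchy-Schwarz for the telescoping sum costs a factor \<open>N\<close>, and by translation
  invariance all steps contribute equally; as \<open>N\<close> grows the difference quotients become
  the directional derivative.\<close>

lemma translation_estimate:
  fixes f :: "'a::euclidean_space \<Rightarrow> real"
  assumes f: "smooth f" "compact (closure {x. f x \<noteq> 0})"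
  shows "(\<integral>x. (f (x + h) - f x)\<^sup>2 \<partial>lborel) \<le> (norm h)\<^sup>2 * (\<integral>x. (norm (grad f x))\<^sup>2 \<partial>lborel)"
proof -
  have cont: "continuous_on UNIV f" by (rule smooth_continuous[OF f(1)])
  have fm[measurable]: "f \<in> borel_measurable borel" by (rule borel_measurable_continuous_onI[OF cont])
  have gm[measurable]: "grad f \<in> borel_measurable borel"
    by (rule borel_measurable_continuous_onI[OF smooth_continuous_grad[OF f(1)]])
  have contc: "continuous_on UNIV (\<lambda>x. f (x + c))" for c
    by (rule continuous_on_compose2[OF cont]) (auto intro!: continuous_intros)
  obtain B R where B: "B > 0" and BR:
    "\<And>n x. \<bar>real (Suc n) * (f (x + (1 / real (Suc n)) *\<^sub>R h) - f x)\<bar> \<le> B * indicator (cball 0 R) x"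
    using difference_quotient_bound[OF f, of h] by metis
  define q where "q n x = (real (Suc n) * (f (x + (1 / real (Suc n)) *\<^sub>R h) - f x))\<^sup>2" for n x
  have qm[measurable]: "q n \<in> borel_measurable borel" for n unfolding q_def by measurable
  have qi: "integrable lborel (q n)" for n
  proof (rule continuous_compact_support_integrable[of _ "cball 0 R"])
    show "continuous_on UNIV (q n)" unfolding q_def by (intro continuous_intros contc cont)
    show "q n x = 0" if "x \<notin> cball 0 R" for x using BR[of n x] that by (simp add: q_def)
  qed simp
  have le: "(\<integral>x. (f (x + h) - f x)\<^sup>2 \<partial>lborel) \<le> (\<integral>x. q n x \<partial>lborel)" for n
  proof -
    define N where "N = Suc n"
    define s where "s j = (real j / real N) *\<^sub>R h" for j
    have N: "real N > 0" by (simp add: N_def)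
    \<comment> \<open>The share of step \<open>j\<close>: a translate of \<open>q n\<close> divided
      by \<open>N\<close>, which equals \<open>N\<close> times the squared increment. The shares add
      up to the Cauchy-Schwarz bound.\<close>
    define t where "t j x = q n (x + s j) / real N" for j x
    have step: "s (Suc j) = s j + (1 / real N) *\<^sub>R h" for j
      by (simp add: s_def scaleR_left_distrib[symmetric] add_divide_distrib)
    have ends: "s 0 = 0" "s N = h" using N by (simp_all add: s_def)
    have t: "t j x = real N * (f (x + s (Suc j)) - f (x + s j))\<^sup>2" for j x
      unfolding t_def q_def step N_def[symmetric] using N by (simp add: power_mult_distrib power2_eq_square add.assoc)
    have sq: "(f (x + h) - f x)\<^sup>2 \<le> (\<Sum>j<N. t j x)" for x
    proof -
      have "f (x + h) - f x = (\<Sum>j<N. f (x + s (Suc j)) - f (x + s j))"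
        using sum_lessThan_telescope[of "\<lambda>j. f (x + s j)" N] ends by simp
      then have "(f (x + h) - f x)\<^sup>2 \<le> (\<Sum>j<N. (f (x + s (Suc j)) - f (x + s j))\<^sup>2) * real (card {..<N})"
        using sum_squared_le_sum_of_squares[of "\<lambda>j. f (x + s (Suc j)) - f (x + s j)" "{..<N}"] by (simp add: mult.commute)
      then show ?thesis by (simp add: t sum_distrib_left[symmetric] mult.commute)
    qed
    have ti: "integrable lborel (t j)" for j
      unfolding t_def using lborel_integrable_translate[OF qm qi, of n "s j"] by simp
    have tint: "(\<integral>x. t j x \<partial>lborel) = (\<integral>x. q n x \<partial>lborel) / real N" for j
      unfolding t_def using lborel_integral_translate[OF qm, of n "s j"] by simp
    \<comment> \<open>\<open>q 0\<close> has step size 1 and is the integrand itself.\<close>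
    have "integrable lborel (\<lambda>x. (f (x + h) - f x)\<^sup>2)"
      using qi[of 0] by (simp add: q_def[abs_def])
    then have "(\<integral>x. (f (x + h) - f x)\<^sup>2 \<partial>lborel) \<le> (\<integral>x. (\<Sum>j<N. t j x) \<partial>lborel)"
      by (rule integral_mono) (use sq ti in auto)
    also have "\<dots> = (\<Sum>j<N. \<integral>x. t j x \<partial>lborel)" using ti by (intro Bochner_Integration.integral_sum)
    also have "\<dots> = (\<integral>x. q n x \<partial>lborel)" using N by (simp add: tint)
    finally show ?thesis .
  qed
  have "(\<lambda>n. \<integral>x. q n x \<partial>lborel) \<longlonglongrightarrow> (\<integral>x. (grad f x \<bullet> h)\<^sup>2 \<partial>lborel)"
  proof (rule integral_dominated_convergence)
    show "integrable lborel (\<lambda>x::'a. B\<^sup>2 * indicator (cball 0 R) x)"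
      using emeasure_bounded_finite[of "cball (0::'a) R"]
      by (intro integrable_mult_right integrable_real_indicator) auto
    show "AE x in lborel. (\<lambda>n. q n x) \<longlonglongrightarrow> (grad f x \<bullet> h)\<^sup>2"
      unfolding q_def by (intro AE_I2 tendsto_power difference_quotient_tendsto smooth_differentiable f)
    show "AE x in lborel. norm (q n x) \<le> B\<^sup>2 * indicator (cball 0 R) x" for n
    proof (rule AE_I2)
      fix x
      have "(\<bar>real (Suc n) * (f (x + (1 / real (Suc n)) *\<^sub>R h) - f x)\<bar>)\<^sup>2 \<le> (B * indicator (cball 0 R) x)\<^sup>2"
        by (rule power_mono[OF BR]) simp
      then show "norm (q n x) \<le> B\<^sup>2 * indicator (cball 0 R) x"
        unfolding q_def by (cases "norm x \<le> R") (simp_all del: of_nat_Suc)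
    qed
  qed measurable
  then have "(\<integral>x. (f (x + h) - f x)\<^sup>2 \<partial>lborel) \<le> (\<integral>x. (grad f x \<bullet> h)\<^sup>2 \<partial>lborel)"
    using le by (intro LIMSEQ_le_const) auto
  also have "\<dots> \<le> (\<integral>x. (norm h)\<^sup>2 * (norm (grad f x))\<^sup>2 \<partial>lborel)"
  proof (rule integral_mono)
    have g0: "grad f x = 0" if "x \<notin> closure {x. f x \<noteq> 0}" for x by (rule grad_zero_outside[OF that])
    show "integrable lborel (\<lambda>x. (grad f x \<bullet> h)\<^sup>2)"
      by (rule continuous_compact_support_integrable[OF _ f(2)])
         (use g0 in \<open>auto intro!: continuous_intros smooth_continuous_grad[OF f(1)]\<close>)
    show "integrable lborel (\<lambda>x. (norm h)\<^sup>2 * (norm (grad f x))\<^sup>2)"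
      by (rule continuous_compact_support_integrable[OF _ f(2)])
         (use g0 in \<open>auto intro!: continuous_intros smooth_continuous_grad[OF f(1)]\<close>)
    fix x
    have "\<bar>grad f x \<bullet> h\<bar>\<^sup>2 \<le> (norm (grad f x) * norm h)\<^sup>2" by (intro power_mono Cauchy_Schwarz_ineq2) simp
    then show "(grad f x \<bullet> h)\<^sup>2 \<le> (norm h)\<^sup>2 * (norm (grad f x))\<^sup>2" by (simp add: power_mult_distrib mult.commute)
  qed
  finally show ?thesis by simp
qed

text \<open>Expanding the square in the translation estimate bounds the squared \<open>L2\<close>
  norm by the autocorrelation of \<open>|f|\<close> at \<open>h\<close> plus
  \<open>|h|^2 / 2\<close> times the gradient term. Integrating over \<open>h\<close> in a cube of
  side \<open>r\<close>, and enlarging the autocorrelation integral to the whole space, produces the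
  squared \<open>L1\<close> norm.\<close>

lemma Nash_smooth:
  fixes f :: "'a::euclidean_space \<Rightarrow> real"
  assumes f: "smooth f" "compact (closure {x. f x \<noteq> 0})" and r: "r > 0"
  shows "r ^ DIM('a) * (\<integral>x. (f x)\<^sup>2 \<partial>lborel) \<le> (\<integral>x. \<bar>f x\<bar> \<partial>lborel)\<^sup>2
    + r ^ DIM('a) * (real DIM('a) * r\<^sup>2 / 2 * (\<integral>x. (norm (grad f x))\<^sup>2 \<partial>lborel))"
proof -
  let ?S = "\<integral>x. (f x)\<^sup>2 \<partial>lborel" and ?G = "\<integral>x. (norm (grad f x))\<^sup>2 \<partial>lborel"
  have cont: "continuous_on UNIV f" by (rule smooth_continuous[OF f(1)])
  have fm[measurable]: "f \<in> borel_measurable borel" by (rule borel_measurable_continuous_onI[OF cont])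
  have G: "?G \<ge> 0" by simp
  obtain R where R: "closure {x. f x \<noteq> 0} \<subseteq> cball 0 R"
    using f(2) by (meson bounded_subset_ballD compact_imp_bounded ball_subset_cball subset_trans)
  have out: "f x = 0" if "x \<notin> cball 0 R" for x using zero_outside_support[of x f] R that by blast
  have fi: "integrable lborel f" "integrable lborel (\<lambda>x. (f x)\<^sup>2)" "integrable lborel (\<lambda>x. \<bar>f x\<bar>)"
    by (rule continuous_compact_support_integrable[of _ "cball 0 R"]; use out cont in \<open>auto intro!: continuous_intros\<close>)+
  define c where "c h = (\<integral>x. \<bar>f x\<bar> * \<bar>f (x + h)\<bar> \<partial>lborel)" for h
  have corr: "?S \<le> c h + (norm h)\<^sup>2 / 2 * ?G" for h
  proof -
    have i2: "integrable lborel (\<lambda>x. (f (x + h))\<^sup>2)"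
      using lborel_integrable_translate[OF _ fi(2), of h] by simp
    have e2: "(\<integral>x. (f (x + h))\<^sup>2 \<partial>lborel) = ?S" by (rule lborel_integral_translate) measurable
    have contc: "continuous_on UNIV (\<lambda>x. f (x + h))"
      by (rule continuous_on_compose2[OF cont]) (auto intro!: continuous_intros)
    have ip: "integrable lborel (\<lambda>x. \<bar>f x\<bar> * \<bar>f (x + h)\<bar>)"
      by (rule continuous_compact_support_integrable[of _ "cball 0 R"])
         (use out in \<open>auto intro!: continuous_intros contc cont\<close>)
    have "2 * ?S - 2 * c h = (\<integral>x. (f (x + h))\<^sup>2 + (f x)\<^sup>2 - 2 * (\<bar>f x\<bar> * \<bar>f (x + h)\<bar>) \<partial>lborel)"
      unfolding c_def using i2 fi(2) ip e2 by simp
    also have "\<dots> \<le> (\<integral>x. (f (x + h) - f x)\<^sup>2 \<partial>lborel)"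
    proof (rule integral_mono)
      show "integrable lborel (\<lambda>x. (f (x + h))\<^sup>2 + (f x)\<^sup>2 - 2 * (\<bar>f x\<bar> * \<bar>f (x + h)\<bar>))"
        using i2 fi(2) ip by simp
      have "integrable lborel (\<lambda>x. f x * f (x + h))"
        by (rule continuous_compact_support_integrable[of _ "cball 0 R"])
          (use out in \<open>auto intro!: continuous_intros contc cont\<close>)
      then have "integrable lborel (\<lambda>x. (f (x + h))\<^sup>2 + (f x)\<^sup>2 - 2 * (f x * f (x + h)))"
        using i2 fi(2) by simp
      then show "integrable lborel (\<lambda>x. (f (x + h) - f x)\<^sup>2)"
        by (simp add: power2_diff mult_ac)
      fix x
      have "f x * f (x + h) \<le> \<bar>f x\<bar> * \<bar>f (x + h)\<bar>" by (simp add: abs_mult[symmetric])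
      then show "(f (x + h))\<^sup>2 + (f x)\<^sup>2 - 2 * (\<bar>f x\<bar> * \<bar>f (x + h)\<bar>) \<le> (f (x + h) - f x)\<^sup>2"
        by (simp add: power2_diff mult.commute)
    qed
    also have "\<dots> \<le> (norm h)\<^sup>2 * ?G" by (rule translation_estimate[OF f])
    finally show ?thesis by simp
  qed
  have kern: "integrable (lborel \<Otimes>\<^sub>M lborel) (\<lambda>(h, x). \<bar>f x\<bar> * \<bar>f (x + h)\<bar>)"
    unfolding lborel_prod
  proof (rule continuous_compact_support_integrable[of _ "cball 0 (2 * R) \<times> cball 0 R"])
    show "continuous_on UNIV (\<lambda>(h, x). \<bar>f x\<bar> * \<bar>f (x + h)\<bar>)"
      unfolding split_beta by (intro continuous_intros continuous_on_compose2[OF cont]) auto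
    show "compact (cball (0::'a) (2 * R) \<times> cball (0::'a) R)" by (intro compact_Times compact_cball)
    fix p :: "'a \<times> 'a" assume p: "p \<notin> cball 0 (2 * R) \<times> cball 0 R"
    obtain h x where hx: "p = (h, x)" by (cases p)
    have "f x = 0 \<or> f (x + h) = 0"
    proof (rule ccontr)
      assume "\<not> ?thesis"
      then have "norm x \<le> R" "norm (x + h) \<le> R" using out[of x] out[of "x + h"] by auto
      then have "norm h \<le> 2 * R" using norm_triangle_ineq4[of "x + h" x] by simp
      then show False using p hx \<open>norm x \<le> R\<close> by simp
    qed
    then show "(case p of (h, x) \<Rightarrow> \<bar>f x\<bar> * \<bar>f (x + h)\<bar>) = 0" by (auto simp: hx)
  qed
  have ci: "integrable lborel c"
    using lborel_pair.integrable_fst[OF kern] by (simp add: c_def[abs_def])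
  \<comment> \<open>Integrating over all shifts decouples the two factors, by Fubini and translation
    invariance.\<close>
  have cint: "(\<integral>h. c h \<partial>lborel) = (\<integral>x. \<bar>f x\<bar> \<partial>lborel)\<^sup>2"
  proof -
    have "(\<integral>h. c h \<partial>lborel) = (\<integral>x. (\<integral>h. \<bar>f x\<bar> * \<bar>f (x + h)\<bar> \<partial>lborel) \<partial>lborel)"
      unfolding c_def using lborel_pair.Fubini_integral[OF kern] by simp
    also have "\<dots> = (\<integral>x. \<bar>f x\<bar> * (\<integral>h. \<bar>f (h + x)\<bar> \<partial>lborel) \<partial>lborel)" by (simp add: add.commute)
    also have "\<dots> = (\<integral>x. \<bar>f x\<bar> * (\<integral>h. \<bar>f h\<bar> \<partial>lborel) \<partial>lborel)"
      using lborel_integral_translate[of "\<lambda>x. \<bar>f x\<bar>"] by simp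
    finally show ?thesis by (simp add: power2_eq_square)
  qed
  \<comment> \<open>A cube with one corner at 0: its measure is exactly \<open>r ^ DIM('a)\<close>,
    and the squared norm is at most \<open>DIM('a)\<close> times \<open>r^2\<close> on it.\<close>
  define Q where "Q = cbox (0::'a) (\<Sum>i\<in>Basis. r *\<^sub>R i)"
  have Qi: "(\<Sum>i\<in>Basis. r *\<^sub>R i) \<bullet> b = r" if "b \<in> Basis" for b :: 'a
    using that by (simp add: inner_sum_left inner_Basis if_distrib cong: if_cong)
  have em: "emeasure lborel Q = ennreal (r ^ DIM('a))"
    unfolding Q_def using r Qi by (subst emeasure_lborel_cbox) auto
  have mQ: "measure lborel Q = r ^ DIM('a)" using em r by (simp add: measure_def)
  have iQ: "integrable lborel (indicat_real Q)"
    using em by (intro integrable_real_indicator) (auto simp: Q_def)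
  have normQ: "(norm h)\<^sup>2 \<le> real DIM('a) * r\<^sup>2" if "h \<in> Q" for h
  proof -
    have "(norm h)\<^sup>2 = (\<Sum>i\<in>Basis. (h \<bullet> i)\<^sup>2)"
      unfolding power2_norm_eq_inner by (subst euclidean_inner) (simp add: power2_eq_square)
    also have "\<dots> \<le> (\<Sum>i\<in>(Basis::'a set). r\<^sup>2)"
      using that Qi by (intro sum_mono power_mono) (auto simp: Q_def mem_box)
    finally show ?thesis by simp
  qed
  have "r ^ DIM('a) * ?S = (\<integral>h. indicat_real Q h * ?S \<partial>lborel)"
    using iQ mQ by (simp add: Q_def)
  also have "\<dots> \<le> (\<integral>h. c h + indicat_real Q h * (real DIM('a) * r\<^sup>2 / 2 * ?G) \<partial>lborel)"
  proof (rule integral_mono)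
    fix h :: 'a
    have c0: "c h \<ge> 0" unfolding c_def by simp
    show "indicat_real Q h * ?S \<le> c h + indicat_real Q h * (real DIM('a) * r\<^sup>2 / 2 * ?G)"
    proof (cases "h \<in> Q")
      case True
      have "(norm h)\<^sup>2 / 2 * ?G \<le> real DIM('a) * r\<^sup>2 / 2 * ?G"
        using normQ[OF True] G by (intro mult_right_mono) auto
      with corr[of h] have "?S \<le> c h + real DIM('a) * r\<^sup>2 / 2 * ?G" by linarith
      then show ?thesis using True by simp
    qed (use c0 in simp)
  qed (use iQ ci in auto)
  also have "\<dots> = (\<integral>x. \<bar>f x\<bar> \<partial>lborel)\<^sup>2 + r ^ DIM('a) * (real DIM('a) * r\<^sup>2 / 2 * ?G)"
    using iQ ci mQ cint by (simp add: Q_def)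
  finally show ?thesis .
qed

section \<open>Boundedness of weak solutions\<close>

lemma Linf_bound:
  assumes "f \<in> Linf D"
  shows "AE x in lebesgue_on D. \<bar>f x\<bar> \<le> Linf_norm D f" "0 \<le> Linf_norm D f" "f \<in> borel_measurable (lebesgue_on D)"
proof -
  let ?M = "lebesgue_on D" and ?e = "esssup (lebesgue_on D) (\<lambda>x. ereal \<bar>f x\<bar>)"
  show m: "f \<in> borel_measurable ?M" using assms by (simp add: Linf_def)
  then have m': "(\<lambda>x. ereal \<bar>f x\<bar>) \<in> borel_measurable ?M" by measurable
  have fin: "?e < \<infinity>" using assms by (simp add: Linf_def)
  have ae: "AE x in ?M. ereal \<bar>f x\<bar> \<le> ?e" by (rule esssup_AE)
  have "(AE x in ?M. \<bar>f x\<bar> \<le> Linf_norm D f) \<and> 0 \<le> Linf_norm D f"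
  proof (cases "emeasure ?M (space ?M) = 0")
    case True
    \<comment> \<open>On a null domain the essential supremum is minus infinity, which
      \<open>real_of_ereal\<close> sends to 0.\<close>
    then have "?e = - \<infinity>" by (rule esssup_zero_space[OF _ m'])
    then have "Linf_norm D f = 0" by (simp add: Linf_norm_def)
    moreover have "AE x in ?M. \<bar>f x\<bar> \<le> Linf_norm D f"
      by (rule AE_I[of _ _ "space ?M"]) (use True in auto)
    ultimately show ?thesis by simp
  next
    case False
    have "esssup ?M (\<lambda>x. 0 :: ereal) \<le> ?e" by (rule esssup_mono) auto
    then have "0 \<le> ?e" using esssup_const[OF False, of "0 :: ereal"] by simp
    then have e: "ereal (Linf_norm D f) = ?e" "0 \<le> Linf_norm D f"
      using fin by (auto simp: Linf_norm_def ereal_real real_of_ereal_pos)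
    from ae have "AE x in ?M. \<bar>f x\<bar> \<le> Linf_norm D f"
      unfolding e(1)[symmetric] by simp
    then show ?thesis using e(2) by simp
  qed
  then show "AE x in ?M. \<bar>f x\<bar> \<le> Linf_norm D f" "0 \<le> Linf_norm D f" by auto
qed

context bounded_open
begin

section \<open>The Nash inequality in \<open>H10\<close> and superlevel sets\<close>

lemma Linf_L2: "f \<in> Linf D \<Longrightarrow> f \<in> L2 D"
  using Linf_bound[of f D] by (intro L2_finite_measureI[OF lmeasurable_D, of _ "Linf_norm D f"]) auto

lemma L2_norm_test:
  assumes "\<phi> \<in> test_functions D"
  shows "(L2_norm D \<phi>)\<^sup>2 = (\<integral>x. (\<phi> x)\<^sup>2 \<partial>lborel)" "(L2_norm D (grad \<phi>))\<^sup>2 = (\<integral>x. (norm (grad \<phi> x))\<^sup>2 \<partial>lborel)"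
    "(\<integral>x. \<bar>\<phi> x\<bar> \<partial>M) = (\<integral>x. \<bar>\<phi> x\<bar> \<partial>lborel)"
proof -
  note t = test_functionsD[OF assms]
  note [measurable] = borel_measurable_continuous_onI[OF smooth_continuous[OF t(1)]]
    borel_measurable_continuous_onI[OF smooth_continuous_grad[OF t(1)]]
  have "(\<integral>x. (norm (\<phi> x))\<^sup>2 \<partial>M) = (\<integral>x. (norm (\<phi> x))\<^sup>2 \<partial>lborel)"
    by (rule integral_lebesgue_on_open[OF open_D]) (use t(4) in auto)
  then show "(L2_norm D \<phi>)\<^sup>2 = (\<integral>x. (\<phi> x)\<^sup>2 \<partial>lborel)" by (simp add: L2_norm_sq)
  show "(L2_norm D (grad \<phi>))\<^sup>2 = (\<integral>x. (norm (grad \<phi> x))\<^sup>2 \<partial>lborel)" unfolding L2_norm_sq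
    by (rule integral_lebesgue_on_open[OF open_D]) (use t(5) in auto)
  show "(\<integral>x. \<bar>\<phi> x\<bar> \<partial>M) = (\<integral>x. \<bar>\<phi> x\<bar> \<partial>lborel)"
    by (rule integral_lebesgue_on_open[OF open_D]) (use t(4) in auto)
qed

lemma Nash_test_approx:
  assumes T: "test_approx D \<phi> v g" and r: "r > 0"
  shows "r ^ DIM('a) * (L2_norm D v)\<^sup>2 \<le> (\<integral>x. \<bar>v x\<bar> \<partial>M)\<^sup>2
    + r ^ DIM('a) * (real DIM('a) * r\<^sup>2 / 2 * (L2_norm D g)\<^sup>2)"
proof (rule LIMSEQ_le)
  note T = test_approxD[OF T]
  show "(\<lambda>n. r ^ DIM('a) * (L2_norm D (\<phi> n))\<^sup>2) \<longlonglongrightarrow> r ^ DIM('a) * (L2_norm D v)\<^sup>2"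
    by (intro tendsto_mult_left tendsto_power L2_tendsto_norm T)
  have "(\<lambda>n. \<integral>x. \<bar>\<phi> n x\<bar> \<partial>M) \<longlonglongrightarrow> (\<integral>x. \<bar>v x\<bar> \<partial>M)"
    using L2_tendsto_mult[OF L2_tendsto_abs[OF T(2)] L2_const[of 1]] by simp
  then show "(\<lambda>n. (\<integral>x. \<bar>\<phi> n x\<bar> \<partial>M)\<^sup>2
      + r ^ DIM('a) * (real DIM('a) * r\<^sup>2 / 2 * (L2_norm D (grad (\<phi> n)))\<^sup>2))
    \<longlonglongrightarrow> (\<integral>x. \<bar>v x\<bar> \<partial>M)\<^sup>2 + r ^ DIM('a) * (real DIM('a) * r\<^sup>2 / 2 * (L2_norm D g)\<^sup>2)"
    by (intro tendsto_add tendsto_mult_left tendsto_power L2_tendsto_norm T)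
  show "\<exists>N. \<forall>n\<ge>N. r ^ DIM('a) * (L2_norm D (\<phi> n))\<^sup>2 \<le> (\<integral>x. \<bar>\<phi> n x\<bar> \<partial>M)\<^sup>2
      + r ^ DIM('a) * (real DIM('a) * r\<^sup>2 / 2 * (L2_norm D (grad (\<phi> n)))\<^sup>2)"
    unfolding L2_norm_test[OF T(1)]
    using Nash_smooth[OF test_functionsD(1,2)[OF T(1)] r] by blast
qed

definition super_level :: "('a \<Rightarrow> real) \<Rightarrow> real \<Rightarrow> real" where
  "super_level u k = measure M {x \<in> space M. k < u x}"

lemma super_level_nonneg: "0 \<le> super_level u k" by (simp add: super_level_def)

lemma super_level_integral:
  assumes "u \<in> borel_measurable M"
  shows "(\<lambda>x. indicat_real {x \<in> space M. k < u x} x) \<in> L2 D"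
    "(\<integral>x. indicat_real {x \<in> space M. k < u x} x \<partial>M) = super_level u k"
proof -
  have [measurable]: "{x \<in> space M. k < u x} \<in> sets M"
    using assms by measurable
  show "(\<lambda>x. indicat_real {x \<in> space M. k < u x} x) \<in> L2 D"
  proof (rule L2_finite_measureI[OF lmeasurable_D, of _ 1])
    show "indicat_real {x \<in> space M. k < u x} \<in> borel_measurable M"
      by (rule borel_measurable_indicator) measurable
  qed (simp add: indicator_def)
  show "(\<integral>x. indicat_real {x \<in> space M. k < u x} x \<partial>M) = super_level u k"
  proof -
    have "{x \<in> D. k < u x} \<inter> D = {x \<in> D. k < u x}" by auto
    then show ?thesis by (simp add: super_level_def)
  qed
qed

text \<open>One step of the iteration, tested with \<open>v = G(u)\<close>, a smooth stand-in for
  the positive part of \<open>u - k\<close>. At radius \<open>r\<close> the Nash inequality bounds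
  \<open>v\<close> by its gradient once the \<open>L1\<close> term is absorbed, which the bound on
  the measure of \<open>{u > k}\<close> allows. The energy estimate then bounds \<open>V^2\<close>
  by a multiple of \<open>V\<close>, where \<open>V\<close> is the integral of
  \<open>v\<close>.\<close>

lemma level_set_estimate:
  assumes T: "test_approx D \<phi> u p" and a: "a \<in> admissible D lam Lam" "0 < lam"
    and f: "f \<in> L2 D" "AE x in M. \<bar>f x\<bar> \<le> F" and F: "0 < F"
    and eq: "\<And>\<psi>. \<psi> \<in> test_functions D \<Longrightarrow> (\<integral>x. (a x *\<^sub>R p x) \<bullet> grad \<psi> x \<partial>M) = (\<integral>x. f x * \<psi> x \<partial>M)"
    and k: "0 \<le> k" "k < h" and r: "0 < r" "2 * super_level u k \<le> r ^ DIM('a)"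
  shows "(h - k) * exp (- 1) * super_level u h \<le> real DIM('a) * F / lam * r\<^sup>2 * super_level u k"
proof -
  let ?d = "real DIM('a)"
  note A = admissibleD[OF a(1)]
  note T0 = test_approxD[OF T]
  note uL = L2_tendstoD(2)[OF T0(2)] and pL = L2_tendstoD(2)[OF T0(3)]
  note [measurable] = L2_measurable[OF uL] L2_measurable[OF pL] A(1) L2_measurable[OF f(1)]
  \<comment> \<open>The dilation makes \<open>G\<close> vanish up to \<open>k\<close> and be at
    least \<open>(h - k) / e\<close> above \<open>h\<close>, with slope between 0 and 1 whatever the
    gap \<open>h - k\<close> is.\<close>
  define G where "G t = (h - k) * flat_exp (1 / (h - k) * t + (- k / (h - k)))" for t
  define G' where "G' t = flat_exp' (1 / (h - k) * t + (- k / (h - k)))" for t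
  have arg: "1 / (h - k) * t + (- k / (h - k)) = (t - k) / (h - k)" for t
    by (simp add: diff_divide_distrib)
  have smG: "smooth_real G" unfolding G_def by (rule smooth_real_affine[OF smooth_real_flat_exp])
  have G0: "G t = 0" if "t \<le> k" for t
    using k that unfolding G_def arg by (simp add: flat_exp_def divide_nonpos_pos not_less[symmetric]) (simp add: zero_less_divide_iff)
  have Gn: "0 \<le> G t" for t using k by (simp add: G_def flat_exp_nonneg)
  have Gh: "(h - k) * exp (- 1) \<le> G t" if "h < t" for t
    unfolding G_def arg using k that by (intro mult_left_mono flat_exp_ge) auto
  have deriv: "(G has_real_derivative G' t) (at t)" for t
  proof -
    have "((\<lambda>t. 1 / (h - k) * t + (- k / (h - k))) has_real_derivative 1 / (h - k)) (at t)"
      by (rule derivative_eq_intros refl | simp)+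
    then have "(G has_real_derivative (h - k) * (G' t * (1 / (h - k)))) (at t)"
      unfolding G_def G'_def by (intro DERIV_cmult DERIV_chain2[OF flat_exp_deriv])
    moreover have "(h - k) * (G' t * (1 / (h - k))) = G' t" using k(2) by simp
    ultimately show ?thesis by simp
  qed
  have contG': "continuous_on UNIV G'" unfolding G'_def
    by (rule continuous_on_compose2[OF continuous_flat_exp']) (use k in \<open>auto intro!: continuous_intros\<close>)
  have G'b: "0 \<le> G' t" "G' t \<le> 1" "\<bar>G' t\<bar> \<le> 1" for t
    using flat_exp'_bounds unfolding G'_def by (auto simp: abs_le_iff intro: order_trans[of _ 0])
  define v g where "v x = G (u x)" and "g x = G' (u x) *\<^sub>R p x" for x
  obtain s where "test_approx D (\<lambda>n x. G (\<phi> (s n) x)) v g"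
    unfolding v_def[abs_def] g_def[abs_def]
    using test_approx_comp[OF T smG G0[OF k(1)] deriv contG' G'b(3)] by blast
  note Tv = this
  note vL = L2_tendstoD(2)[OF test_approxD(2)[OF Tv]] and gL = L2_tendstoD(2)[OF test_approxD(3)[OF Tv]]
  note [measurable] = L2_measurable[OF vL] L2_measurable[OF gL]
  have vn: "0 \<le> v x" for x by (simp add: v_def Gn)
  have vi: "integrable M v" by (rule L2_imp_integrable[OF lmeasurable_D vL])
  define V where "V = (\<integral>x. v x \<partial>M)"
  have V0: "0 \<le> V" unfolding V_def using vn by simp
  have ap: "(\<lambda>x. a x *\<^sub>R p x) \<in> L2 D" by (rule L2_bounded_scaleR(1)[OF pL A(1) A(3)[OF a(2)]])
  have ag: "(\<lambda>x. a x *\<^sub>R g x) \<in> L2 D" by (rule L2_bounded_scaleR(1)[OF gL A(1) A(3)[OF a(2)]])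
  \<comment> \<open>As \<open>0 \<le> G' \<le> 1\<close>, the energy density of \<open>v\<close> is
    at most \<open>a p . g\<close>, whose integral the equation for \<open>u\<close>, tested with
    \<open>v\<close>, evaluates.\<close>
  have energy: "lam * (L2_norm D g)\<^sup>2 \<le> F * V"
  proof -
    have "lam * (L2_norm D g)\<^sup>2 \<le> (\<integral>x. a x * (g x \<bullet> g x) \<partial>M)" by (rule coercive[OF a gL])
    also have "\<dots> \<le> (\<integral>x. (a x *\<^sub>R p x) \<bullet> g x \<partial>M)"
    proof (rule integral_mono_AE)
      show "integrable M (\<lambda>x. a x * (g x \<bullet> g x))" using L2_inner_integrable[OF ag gL] by simp
      show "integrable M (\<lambda>x. (a x *\<^sub>R p x) \<bullet> g x)" by (rule L2_inner_integrable[OF ap gL])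
      show "AE x in M. a x * (g x \<bullet> g x) \<le> (a x *\<^sub>R p x) \<bullet> g x"
        using A(2)
      proof eventually_elim
        case (elim x)
        have "G' (u x) * (G' (u x) * (p x \<bullet> p x)) \<le> 1 * (G' (u x) * (p x \<bullet> p x))"
          using G'b by (intro mult_right_mono mult_nonneg_nonneg) auto
        from mult_left_mono[OF this, of "a x"] show ?case using elim a(2) by (simp add: g_def)
      qed
    qed
    also have "\<dots> = (\<integral>x. f x * v x \<partial>M)" by (rule test_approx_equation[OF Tv ap f(1) eq])
    also have "\<dots> \<le> (\<integral>x. F * v x \<partial>M)"
    proof (rule integral_mono_AE)
      show "integrable M (\<lambda>x. f x * v x)" by (rule L2_mult_integrable[OF f(1) vL])
      show "AE x in M. f x * v x \<le> F * v x"
        using f(2) by eventually_elim (use vn in \<open>auto intro!: mult_right_mono\<close>)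
    qed (use vi in simp)
    finally show ?thesis by (simp add: V_def)
  qed
  let ?I = "\<lambda>x. indicat_real {x \<in> space M. k < u x} x" and ?J = "\<lambda>x. indicat_real {x \<in> space M. h < u x} x"
  note I = super_level_integral[OF L2_measurable[OF uL], of k] and J = super_level_integral[OF L2_measurable[OF uL], of h]
  \<comment> \<open>\<open>v\<close> vanishes off \<open>{u > k}\<close>, so Cauchy-Schwarz gains
    the measure of that set.\<close>
  have CS: "V\<^sup>2 \<le> super_level u k * (L2_norm D v)\<^sup>2"
  proof -
    have "V = (\<integral>x. v x * ?I x \<partial>M)"
      unfolding V_def by (rule Bochner_Integration.integral_cong[OF refl]) (auto simp: v_def indicator_def G0)
    also have "\<dots> \<le> L2_norm D v * L2_norm D ?I" using L2_Cauchy_Schwarz[OF vL I(1)] by simp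
    finally have "V\<^sup>2 \<le> (L2_norm D v * L2_norm D ?I)\<^sup>2" using V0 by (rule power_mono)
    moreover have "(L2_norm D ?I)\<^sup>2 = super_level u k"
      unfolding L2_norm_sq I(2)[symmetric]
      by (rule Bochner_Integration.integral_cong[OF refl]) (simp add: indicator_def)
    ultimately show ?thesis by (simp add: power_mult_distrib mult.commute)
  qed
  have rd: "0 < r ^ DIM('a)" using r by simp
  have "r ^ DIM('a) * (L2_norm D v)\<^sup>2 \<le> V\<^sup>2 + r ^ DIM('a) * (?d * r\<^sup>2 / 2 * (L2_norm D g)\<^sup>2)"
    using Nash_test_approx[OF Tv r(1)] vn by (simp add: V_def)
  \<comment> \<open>By the assumption on \<open>r\<close> the \<open>L1\<close> term is at most half
    of the left side of the Nash inequality and can be absorbed.\<close>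
  moreover have "V\<^sup>2 \<le> r ^ DIM('a) / 2 * (L2_norm D v)\<^sup>2"
    using CS mult_right_mono[of "super_level u k" "r ^ DIM('a) / 2" "(L2_norm D v)\<^sup>2"] r(2) by simp
  ultimately have "r ^ DIM('a) * (L2_norm D v)\<^sup>2 \<le> r ^ DIM('a) * (?d * r\<^sup>2 * (L2_norm D g)\<^sup>2)"
    by (simp add: field_simps)
  then have "(L2_norm D v)\<^sup>2 \<le> ?d * r\<^sup>2 * (L2_norm D g)\<^sup>2"
    using rd by simp
  also have "\<dots> \<le> ?d * r\<^sup>2 * (F * V / lam)"
    using energy a(2) by (intro mult_left_mono) (auto simp: field_simps)
  finally have "super_level u k * (L2_norm D v)\<^sup>2 \<le> super_level u k * (?d * r\<^sup>2 * (F * V / lam))"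
    by (rule mult_left_mono[OF _ super_level_nonneg])
  with CS have VV: "V * V \<le> (?d * F / lam * r\<^sup>2 * super_level u k) * V"
    by (simp add: power2_eq_square mult_ac)
  have V: "V \<le> ?d * F / lam * r\<^sup>2 * super_level u k"
  proof (cases "V = 0")
    case True
    then show ?thesis using F a(2) super_level_nonneg[of u k] by simp
  next
    case False
    then have "V > 0" using V0 by simp
    with VV show ?thesis by (rule mult_right_le_imp_le)
  qed
  have "(h - k) * exp (- 1) * super_level u h = (\<integral>x. (h - k) * exp (- 1) * ?J x \<partial>M)"
    using J(2) by simp
  also have "\<dots> \<le> V" unfolding V_def
  proof (rule integral_mono)
    show "integrable M (\<lambda>x. (h - k) * exp (- 1) * ?J x)"
      using L2_imp_integrable[OF lmeasurable_D J(1)] by simp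
    show "(h - k) * exp (- 1) * ?J x \<le> v x" for x
      using Gh[of "u x"] Gn[of "u x"] by (simp add: indicator_def v_def)
  qed (rule vi)
  finally show ?thesis using V by linarith
qed

text \<open>Stampacchia's iteration over the levels \<open>\<kappa> (1 + 1/4 + \<dots> + 1/4\<^sup>n)\<close>.\<close>

lemma solution_upper_bound_pos:
  assumes T: "test_approx D \<phi> u p" and a: "a \<in> admissible D lam Lam" "0 < lam"
    and f: "f \<in> L2 D" "AE x in M. \<bar>f x\<bar> \<le> F" and F: "0 < F"
    and eq: "\<And>\<psi>. \<psi> \<in> test_functions D \<Longrightarrow> (\<integral>x. (a x *\<^sub>R p x) \<bullet> grad \<psi> x \<partial>M) = (\<integral>x. f x * \<psi> x \<partial>M)"
    and R: "0 < R" "2 * measure M (space M) \<le> R ^ DIM('a)"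
  shows "AE x in M. u x \<le> 2 * (exp 1 * real DIM('a) * R\<^sup>2 * 2 ^ DIM('a) / lam) * F"
proof -
  let ?d = "real DIM('a)"
  interpret finite_measure M by (rule finite_measure_D)
  \<comment> \<open>The constant is dictated by the induction step below: it makes the gap between
    consecutive levels, divided by \<open>e\<close>, equal to \<open>2 ^ DIM('a)\<close> times the
    factor in the level set estimate.\<close>
  define \<kappa> where "\<kappa> = (exp 1 * ?d * R\<^sup>2 * 2 ^ DIM('a) / lam) * F"
  have \<kappa>: "\<kappa> > 0" using R F a(2) by (simp add: \<kappa>_def)
  define K where "K n = \<kappa> * (\<Sum>j<n. (1 / 4) ^ j)" for n :: nat
  have um[measurable]: "u \<in> borel_measurable M" by (rule L2_measurable[OF L2_tendstoD(2)[OF test_approxD(2)[OF T]]])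
  \<comment> \<open>The radius at step \<open>n\<close> is \<open>R / 2 ^ n\<close>. Its square and
    the level gap both scale like \<open>1 / 4 ^ n\<close>, so they cancel, and each step gains
    exactly the factor \<open>2 ^ DIM('a)\<close> by which the power of the radius shrinks.\<close>
  have iter: "2 * super_level u (K n) \<le> (R / 2 ^ n) ^ DIM('a)" for n
  proof (induction n)
    case 0
    have "super_level u (K 0) \<le> measure M (space M)"
      unfolding super_level_def by (rule finite_measure_mono) auto
    then show ?case using R by simp
  next
    case (Suc n)
    have r: "0 < R / 2 ^ n" using R by simp
    have Kn: "0 \<le> K n" using \<kappa> by (auto simp: K_def intro!: mult_nonneg_nonneg sum_nonneg)
    have KS: "K (Suc n) - K n = \<kappa> / 4 ^ n" by (simp add: K_def distrib_left power_one_over field_simps)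
    then have KnS: "K n < K (Suc n)" using \<kappa> by (smt (verit) divide_pos_pos zero_less_power)
    have c: "?d * F / lam * R\<^sup>2 > 0" using F a(2) R by simp
    have "(K (Suc n) - K n) * exp (- 1) * super_level u (K (Suc n)) \<le> ?d * F / lam * (R / 2 ^ n)\<^sup>2 * super_level u (K n)"
      by (rule level_set_estimate[OF T a f F eq Kn KnS r Suc.IH])
    also have "(K (Suc n) - K n) * exp (- 1) = (?d * F / lam * R\<^sup>2) / 4 ^ n * 2 ^ DIM('a)"
      unfolding KS \<kappa>_def by (simp add: exp_minus field_simps)
    also have "?d * F / lam * (R / 2 ^ n)\<^sup>2 = (?d * F / lam * R\<^sup>2) / 4 ^ n"
      by (simp add: power_divide power_mult[symmetric] mult.commute[of n] power_mult)
    finally have "(?d * F / lam * R\<^sup>2) / 4 ^ n * (2 ^ DIM('a) * super_level u (K (Suc n)))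
        \<le> (?d * F / lam * R\<^sup>2) / 4 ^ n * super_level u (K n)"
      by (simp only: mult.assoc)
    then have "2 ^ DIM('a) * super_level u (K (Suc n)) \<le> super_level u (K n)"
      by (rule mult_left_le_imp_le) (rule divide_pos_pos[OF c], simp)
    then have "2 ^ DIM('a) * (2 * super_level u (K (Suc n))) \<le> (R / 2 ^ n) ^ DIM('a)"
      using Suc.IH by simp
    also have "\<dots> = 2 ^ DIM('a) * (R / 2 ^ Suc n) ^ DIM('a)"
      by (simp add: power_mult_distrib[symmetric])
    finally show ?case by simp
  qed
  have Kle: "K n \<le> 2 * \<kappa>" for n
  proof -
    \<comment> \<open>The bound 2 is strengthened by \<open>2 * (1 / 4) ^ n\<close> so that the
      induction closes.\<close>
    have "(\<Sum>j<n. (1 / 4 :: real) ^ j) \<le> 2 - 2 * (1 / 4) ^ n"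
    proof (induction n)
      case (Suc n)
      have "(\<Sum>j<Suc n. (1 / 4 :: real) ^ j) \<le> 2 - 2 * (1 / 4) ^ n + (1 / 4) ^ n" using Suc by simp
      also have "\<dots> \<le> 2 - 2 * (1 / 4) ^ Suc n" by simp
      finally show ?case .
    qed simp
    then have "(\<Sum>j<n. (1 / 4 :: real) ^ j) \<le> 2"
      by (rule order_trans) simp
    then show ?thesis using \<kappa> by (simp add: K_def mult.commute)
  qed
  have "super_level u (2 * \<kappa>) \<le> e" if "e > 0" for e
  proof -
    have "(\<lambda>n. (R ^ DIM('a)) * ((1 / 2) ^ n) ^ DIM('a)) \<longlonglongrightarrow> R ^ DIM('a) * 0 ^ DIM('a)"
      by (intro tendsto_mult_left tendsto_power LIMSEQ_realpow_zero) auto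
    then have "(\<lambda>n. (R / 2 ^ n) ^ DIM('a)) \<longlonglongrightarrow> 0"
      by (simp add: power_divide power_one_over zero_power)
    then have "eventually (\<lambda>n. (R / 2 ^ n) ^ DIM('a) < e) sequentially"
      by (rule order_tendstoD) (rule that)
    then obtain n where n: "(R / 2 ^ n) ^ DIM('a) < e" using eventually_happens'[OF sequentially_bot] by blast
    have "super_level u (2 * \<kappa>) \<le> super_level u (K n)"
      unfolding super_level_def
    proof (rule finite_measure_mono)
      show "{x \<in> space M. K n < u x} \<in> sets M" by measurable
    qed (use Kle[of n] in auto)
    then show ?thesis using iter[of n] n super_level_nonneg[of u "K n"] by linarith
  qed
  then have "super_level u (2 * \<kappa>) \<le> 0" by (rule field_le_epsilon[of _ 0, simplified])
  then have "super_level u (2 * \<kappa>) = 0" using super_level_nonneg[of u "2 * \<kappa>"] by linarith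
  then have "emeasure M {x \<in> space M. 2 * \<kappa> < u x} = 0"
    by (simp add: super_level_def emeasure_eq_measure)
  moreover have "{x \<in> space M. 2 * \<kappa> < u x} \<in> sets M" by measurable
  ultimately have "AE x in M. \<not> 2 * \<kappa> < u x"
    by (subst AE_iff_measurable[OF _ refl]) simp_all
  then show ?thesis by eventually_elim (simp add: \<kappa>_def mult.assoc)
qed

text \<open>The iteration needs a positive \<open>F\<close> to have strictly increasing levels. It
  is therefore run with \<open>F + 1 / (n + 1)\<close> for every \<open>n\<close>, and
  \<open>n\<close> is sent to infinity.\<close>

lemma solution_upper_bound:
  assumes T: "test_approx D \<phi> u p" and a: "a \<in> admissible D lam Lam" "0 < lam"
    and f: "f \<in> L2 D" "AE x in M. \<bar>f x\<bar> \<le> F" and F: "0 \<le> F"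
    and eq: "\<And>\<psi>. \<psi> \<in> test_functions D \<Longrightarrow> (\<integral>x. (a x *\<^sub>R p x) \<bullet> grad \<psi> x \<partial>M) = (\<integral>x. f x * \<psi> x \<partial>M)"
    and R: "0 < R" "2 * measure M (space M) \<le> R ^ DIM('a)"
  shows "AE x in M. u x \<le> 2 * (exp 1 * real DIM('a) * R\<^sup>2 * 2 ^ DIM('a) / lam) * F"
proof -
  let ?C = "2 * (exp 1 * real DIM('a) * R\<^sup>2 * 2 ^ DIM('a) / lam)"
  have "AE x in M. u x \<le> ?C * (F + 1 / real (Suc n))" for n
  proof (rule solution_upper_bound_pos[OF T a f(1) _ _ eq R])
    show "AE x in M. \<bar>f x\<bar> \<le> F + 1 / real (Suc n)"
      using f(2) by eventually_elim (simp add: add_increasing2)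
    show "0 < F + 1 / real (Suc n)" using F by (simp add: add_nonneg_pos)
  qed
  then have "AE x in M. \<forall>n. u x \<le> ?C * (F + 1 / real (Suc n))"
    unfolding AE_all_countable by blast
  then show ?thesis
  proof eventually_elim
    case (elim x)
    have "(\<lambda>n. ?C * (F + 1 / real (Suc n))) \<longlonglongrightarrow> ?C * (F + 0)"
      by (intro tendsto_intros LIMSEQ_Suc[OF lim_1_over_n])
    then show ?case using elim by (intro LIMSEQ_le_const[where X = "\<lambda>n. ?C * (F + 1 / real (Suc n))"]) auto
  qed
qed

lemma test_approx_minus:
  assumes "test_approx D \<phi> u p"
  shows "test_approx D (\<lambda>n x. - \<phi> n x) (\<lambda>x. - u x) (\<lambda>x. - p x)"
proof -
  note T = test_approxD[OF assms]
  have gr: "grad (\<lambda>x. - \<phi> n x) = (\<lambda>x. - grad (\<phi> n) x)" for n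
  proof
    fix x
    have "(uminus has_real_derivative - 1) (at (\<phi> n x))" by (rule DERIV_minus[OF DERIV_ident])
    from grad_comp[OF smooth_differentiable[OF test_functionsD(1)[OF T(1)]] this]
    show "grad (\<lambda>x. - \<phi> n x) x = - grad (\<phi> n) x" by simp
  qed
  have tf: "(\<lambda>x. - \<phi> n x) \<in> test_functions D" for n
    using test_functions_scale[OF T(1), of "-1"] by simp
  have neg: "L2_tendsto D (\<lambda>n x. - h n x) (\<lambda>x. - k x)" if "L2_tendsto D h k"
    for h :: "nat \<Rightarrow> 'a \<Rightarrow> 'b::euclidean_space" and k
    using L2_tendsto_bounded_scaleR[OF that, of "\<lambda>x. -1" 1] by simp
  show ?thesis
    unfolding test_approx_def gr
    using tf neg[OF T(2)] neg[OF T(3)] T(4) by (auto intro: tendsto_minus elim!: eventually_mono)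
qed

text \<open>The lower bound is the upper bound for \<open>- u\<close>, which solves the equation
  with right side \<open>- f\<close>.\<close>

proposition solution_bound:
  assumes T: "test_approx D \<phi> u p" and a: "a \<in> admissible D lam Lam" "0 < lam"
    and f: "f \<in> L2 D" "AE x in M. \<bar>f x\<bar> \<le> F" and F: "0 \<le> F"
    and eq: "\<And>\<psi>. \<psi> \<in> test_functions D \<Longrightarrow> (\<integral>x. (a x *\<^sub>R p x) \<bullet> grad \<psi> x \<partial>M) = (\<integral>x. f x * \<psi> x \<partial>M)"
    and R: "0 < R" "2 * measure M (space M) \<le> R ^ DIM('a)"
  shows "AE x in M. \<bar>u x\<bar> \<le> 2 * (exp 1 * real DIM('a) * R\<^sup>2 * 2 ^ DIM('a) / lam) * F"
proof -
  have "AE x in M. - u x \<le> 2 * (exp 1 * real DIM('a) * R\<^sup>2 * 2 ^ DIM('a) / lam) * F"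
  proof (rule solution_upper_bound[OF test_approx_minus[OF T] a _ _ F _ R, where f = "\<lambda>x. - f x"])
    show "(\<lambda>x. - f x) \<in> L2 D" using L2_scaleR[OF f(1), of "-1"] by simp
    show "(\<integral>x. (a x *\<^sub>R - p x) \<bullet> grad \<psi> x \<partial>M) = (\<integral>x. - f x * \<psi> x \<partial>M)"
      if "\<psi> \<in> test_functions D" for \<psi>
      using eq[OF that] by simp
  qed (use f(2) in simp)
  moreover have "AE x in M. u x \<le> 2 * (exp 1 * real DIM('a) * R\<^sup>2 * 2 ^ DIM('a) / lam) * F"
    by (rule solution_upper_bound[OF T a f F eq R])
  ultimately show ?thesis by eventually_elim auto
qed

end

section \<open>The second estimate\<close>

context bounded_open
begin

text \<open>For a test function the chosen \<open>wgrad\<close> agrees almost everywhere with the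
  classical gradient, which is the form of the equation that the approximation arguments
  require.\<close>

lemma weak_solution_test:
  assumes u: "weak_solution D a (functional_of D f) u" and a: "a \<in> admissible D lam Lam" and \<psi>: "\<psi> \<in> test_functions D"
  shows "(\<integral>x. (a x *\<^sub>R wgrad D u x) \<bullet> grad \<psi> x \<partial>M) = (\<integral>x. f x * \<psi> x \<partial>M)"
proof -
  note U = weak_solutionD[OF u]
  note W = wgrad_unique[OF test_function_weak_gradient[OF \<psi>]]
  note [measurable] = L2_measurable[OF U(3)] admissibleD(1)[OF a] L2_measurable[OF test_functions_L2(2)[OF \<psi>]]
    L2_measurable[OF has_weak_gradientD(2)[OF wgrad[OF H10_imp_H1[OF test_functions_H10[OF \<psi>]]]]]
  have "(\<integral>x. (a x *\<^sub>R wgrad D u x) \<bullet> grad \<psi> x \<partial>M) = (\<integral>x. a x * (wgrad D u x \<bullet> wgrad D \<psi> x) \<partial>M)"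
    by (rule integral_cong_AE) (measurable, use W in eventually_elim, simp)
  also have "\<dots> = functional_of D f \<psi>" by (rule U(4)[OF test_functions_H10[OF \<psi>]])
  finally show ?thesis by (simp add: functional_of_def)
qed

text \<open>The witness is \<open>w = 1 - b / a\<close>, with gradient
  \<open>b grad a / a^2 - grad b / a\<close> by the product rule and the rule for
  \<open>1 / a\<close>. The two terms account for the constants \<open>Lam / lam^2\<close> and
  \<open>1 / lam\<close>.\<close>

lemma ratio_weak_gradient:
  assumes lam: "0 < lam" "0 < Lam" and a: "a \<in> admissible D lam Lam" "a \<in> H1 D" and b: "b \<in> admissible D lam Lam" "b \<in> H1 D"
  obtains w g where "has_weak_gradient D w g" "AE x in M. a x * w x = a x - b x"
    "AE x in M. \<bar>w x\<bar> \<le> 1 + Lam / lam"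
    "L2_norm D g \<le> (Lam / lam\<^sup>2 + 1 / lam) * max (L2_norm D (wgrad D a)) (L2_norm D (wgrad D b))"
proof -
  note A = admissibleD[OF a(1)] and B = admissibleD[OF b(1)]
  note ga = wgrad[OF a(2)] and gb = wgrad[OF b(2)]
  note [measurable] = A(1) B(1) L2_measurable[OF has_weak_gradientD(2)[OF ga]] L2_measurable[OF has_weak_gradientD(2)[OF gb]]
  let ?m = "max (L2_norm D (wgrad D a)) (L2_norm D (wgrad D b))"
  have inv: "AE x in M. \<bar>1 / a x\<bar> \<le> 1 / lam"
    using A(2) by eventually_elim (use lam in \<open>auto simp: frac_le\<close>)
  define w where "w x = 1 - b x * (1 / a x)" for x
  define g1 where "g1 x = b x *\<^sub>R (- (1 / (a x)\<^sup>2)) *\<^sub>R wgrad D a x" for x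
  define g2 where "g2 x = (1 / a x) *\<^sub>R wgrad D b x" for x
  have g1m: "AE x in M. \<bar>b x * (- (1 / (a x)\<^sup>2))\<bar> \<le> Lam / lam\<^sup>2"
    using A(2) B(2)
  proof eventually_elim
    case (elim x)
    have "lam\<^sup>2 \<le> (a x)\<^sup>2" using elim lam by (intro power_mono) auto
    then have "\<bar>b x\<bar> / (a x)\<^sup>2 \<le> Lam / lam\<^sup>2" using elim lam by (intro frac_le) auto
    then show ?case by (simp add: abs_mult)
  qed
  have g1: "g1 \<in> L2 D" "L2_norm D g1 \<le> Lam / lam\<^sup>2 * L2_norm D (wgrad D a)"
    using L2_bounded_scaleR[OF has_weak_gradientD(2)[OF ga] _ g1m] lam by (simp_all add: g1_def[abs_def])
  have g2: "g2 \<in> L2 D" "L2_norm D g2 \<le> 1 / lam * L2_norm D (wgrad D b)"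
    using L2_bounded_scaleR[OF has_weak_gradientD(2)[OF gb] _ inv] lam by (simp_all add: g2_def[abs_def])
  have "has_weak_gradient D (\<lambda>x. b x * (1 / a x)) (\<lambda>x. g1 x + g2 x)"
    unfolding g1_def g2_def
    by (rule weak_gradient_product[OF gb B(3)[OF lam(1)] weak_gradient_inverse[OF ga A(2) lam] inv])
  from weak_gradient_diff[OF weak_gradient_const[of 1] this]
  have 1: "has_weak_gradient D w (\<lambda>x. 0 - (g1 x + g2 x))" unfolding w_def[abs_def] .
  have 2: "AE x in M. a x * w x = a x - b x"
    using A(2) by eventually_elim (use lam in \<open>auto simp: w_def right_diff_distrib\<close>)
  have 3: "AE x in M. \<bar>w x\<bar> \<le> 1 + Lam / lam"
    using A(2) B(2)
  proof eventually_elim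
    case (elim x)
    have "0 \<le> b x / a x" "b x / a x \<le> Lam / lam"
      using elim lam by (auto intro!: frac_le divide_nonneg_nonneg)
    then show ?case by (simp add: w_def)
  qed
  have "L2_norm D (\<lambda>x. 0 - (g1 x + g2 x)) = L2_norm D (\<lambda>x. g1 x + g2 x)"
    using L2_norm_minus[of D "\<lambda>x. g1 x + g2 x"] by simp
  also have "\<dots> \<le> L2_norm D g1 + L2_norm D g2" by (rule L2_norm_triangle[OF g1(1) g2(1)])
  also have "\<dots> \<le> Lam / lam\<^sup>2 * ?m + 1 / lam * ?m"
    using lam by (intro add_mono order_trans[OF g1(2)] order_trans[OF g2(2)] mult_left_mono) auto
  finally have "L2_norm D (\<lambda>x. 0 - (g1 x + g2 x)) \<le> (Lam / lam\<^sup>2 + 1 / lam) * ?m"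
    by (simp add: distrib_right)
  with 1 2 3 show ?thesis by (rule that)
qed

text \<open>\<open>V\<close> stands for the gradient of \<open>w ua\<close>. Three weak equations
  are combined: that of \<open>ua\<close> tested with \<open>w ua\<close> and with
  \<open>w^2 ua\<close>, and that of \<open>ub\<close> tested with \<open>w ua\<close>. Both
  equations tested with \<open>w ua\<close> have the same right side, so \<open>f\<close> survives
  only in the one tested with \<open>w^2 ua\<close>.\<close>

lemma weighted_energy_identity:
  fixes V :: "'a \<Rightarrow> 'a"
  assumes lam: "0 < lam" and a: "a \<in> admissible D lam Lam" and b: "b \<in> admissible D lam Lam" and f: "f \<in> L2 D"
    and ua: "weak_solution D a (functional_of D f) ua" and ub: "weak_solution D b (functional_of D f) ub"
    and w: "has_weak_gradient D w g" "AE x in M. \<bar>w x\<bar> \<le> K" "AE x in M. a x * w x = a x - b x"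
    and U: "AE x in M. \<bar>ua x\<bar> \<le> U"
  defines "V \<equiv> \<lambda>x. ua x *\<^sub>R g x + w x *\<^sub>R wgrad D ua x"
  shows "V \<in> L2 D"
    "(\<integral>x. (a x - b x)\<^sup>2 / (a x)\<^sup>2 * (a x * (norm (wgrad D ua x))\<^sup>2 + f x * ua x) \<partial>M)
      = - 2 * (\<integral>x. (b x *\<^sub>R (wgrad D ua x - wgrad D ub x)) \<bullet> V x \<partial>M)"
proof -
  define p q where "p = wgrad D ua" and "q = wgrad D ub"
  note A = admissibleD[OF a] and B = admissibleD[OF b]
  note Ua = weak_solutionD[OF ua, folded p_def] and Ub = weak_solutionD[OF ub, folded q_def]
  note W = has_weak_gradientD[OF w(1)]
  have uL: "ua \<in> L2 D" by (rule has_weak_gradientD(1)[OF wgrad[OF Ua(2)]])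
  obtain \<phi> where \<phi>: "test_approx D \<phi> ua p" using H10_test_approx[OF Ua(1)] unfolding p_def by blast
  have apL: "(\<lambda>x. a x *\<^sub>R p x) \<in> L2 D" by (rule L2_bounded_scaleR(1)[OF Ua(3) A(1) A(3)[OF lam]])
  have bqL: "(\<lambda>x. b x *\<^sub>R q x) \<in> L2 D" by (rule L2_bounded_scaleR(1)[OF Ub(3) B(1) B(3)[OF lam]])
  have bpL: "(\<lambda>x. b x *\<^sub>R (p x - q x)) \<in> L2 D"
    by (rule L2_bounded_scaleR(1)[OF L2_diff[OF Ua(3) Ub(3)] B(1) B(3)[OF lam]])
  have VL: "V \<in> L2 D"
    unfolding V_def p_def[symmetric]
    by (intro L2_add L2_bounded_scaleR(1)[OF W(2) L2_measurable[OF uL] U] L2_bounded_scaleR(1)[OF Ua(3) L2_measurable[OF W(1)] w(2)])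
  then show "V \<in> L2 D" .
  have ww: "has_weak_gradient D (\<lambda>x. w x * w x) (\<lambda>x. w x *\<^sub>R g x + w x *\<^sub>R g x)"
    by (rule weak_gradient_product[OF w(1,2) w(1,2)])
  have wwK: "AE x in M. \<bar>w x * w x\<bar> \<le> K * K"
    using w(2)
  proof eventually_elim
    case (elim x)
    from mult_mono[OF elim elim order_trans[OF abs_ge_zero elim] abs_ge_zero] show ?case
      by (simp only: abs_mult)
  qed
  \<comment> \<open>The gradient of \<open>w^2 ua\<close>, written with the gradient of
    \<open>w^2\<close> as the product rule delivers it.\<close>
  define V2 where "V2 x = ua x *\<^sub>R (w x *\<^sub>R g x + w x *\<^sub>R g x) + (w x * w x) *\<^sub>R p x" for x
  have V2L: "V2 \<in> L2 D"
    unfolding V2_def[abs_def]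
    by (intro L2_add[OF L2_bounded_scaleR(1)[OF has_weak_gradientD(2)[OF ww] L2_measurable[OF uL] U]
          L2_bounded_scaleR(1)[OF Ua(3) L2_measurable[OF has_weak_gradientD(1)[OF ww]] wwK]])
  have wwu: "(\<lambda>x. (w x * w x) * ua x) \<in> L2 D"
    using L2_bounded_scaleR(1)[OF uL L2_measurable[OF has_weak_gradientD(1)[OF ww]] wwK] by simp
  have I1: "(\<integral>x. (a x *\<^sub>R p x) \<bullet> V2 x \<partial>M) = (\<integral>x. f x * ((w x * w x) * ua x) \<partial>M)"
    unfolding V2_def
    by (rule weak_divergence_bounded_product[OF apL f _ ww wwK \<phi> U]) (use weak_solution_test[OF ua a] p_def in simp)
  have I2: "(\<integral>x. (a x *\<^sub>R p x) \<bullet> V x \<partial>M) = (\<integral>x. f x * (w x * ua x) \<partial>M)"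
    unfolding V_def p_def[symmetric]
    by (rule weak_divergence_bounded_product[OF apL f _ w(1,2) \<phi> U]) (use weak_solution_test[OF ua a] p_def in simp)
  have I3: "(\<integral>x. (b x *\<^sub>R q x) \<bullet> V x \<partial>M) = (\<integral>x. f x * (w x * ua x) \<partial>M)"
    unfolding V_def p_def[symmetric]
    by (rule weak_divergence_bounded_product[OF bqL f _ w(1,2) \<phi> U]) (use weak_solution_test[OF ub b] q_def in simp)
  note i1 = L2_inner_integrable[OF apL V2L] and i2 = L2_inner_integrable[OF apL VL] and i3 = L2_inner_integrable[OF bqL VL]
    and i4 = L2_inner_integrable[OF bpL VL] and i5 = L2_mult_integrable[OF f wwu]
  \<comment> \<open>A pointwise identity whose first two and last two terms cancel after
    integration, by the three equations. It rests on
    \<open>2 (a - b) p . V - a p . V2 = a w^2 |p|^2\<close>, where the cross terms with the gradient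
    of \<open>w\<close> drop out.\<close>
  have "(\<integral>x. (a x - b x)\<^sup>2 / (a x)\<^sup>2 * (a x * (norm (p x))\<^sup>2 + f x * ua x) \<partial>M)
      = (\<integral>x. 2 * ((a x *\<^sub>R p x) \<bullet> V x) - 2 * ((b x *\<^sub>R q x) \<bullet> V x) - 2 * ((b x *\<^sub>R (p x - q x)) \<bullet> V x)
          - (a x *\<^sub>R p x) \<bullet> V2 x + f x * ((w x * w x) * ua x) \<partial>M)"
  proof (rule integral_cong_AE)
    note [measurable] = A(1) B(1) L2_measurable[OF Ua(3)] L2_measurable[OF f] L2_measurable[OF uL]
    show "(\<lambda>x. (a x - b x)\<^sup>2 / (a x)\<^sup>2 * (a x * (norm (p x))\<^sup>2 + f x * ua x)) \<in> borel_measurable M" by measurable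
    show "(\<lambda>x. 2 * ((a x *\<^sub>R p x) \<bullet> V x) - 2 * ((b x *\<^sub>R q x) \<bullet> V x) - 2 * ((b x *\<^sub>R (p x - q x)) \<bullet> V x)
          - (a x *\<^sub>R p x) \<bullet> V2 x + f x * ((w x * w x) * ua x)) \<in> borel_measurable M"
      using i1 i2 i3 i4 i5 by (intro borel_measurable_integrable) simp
    show "AE x in M. (a x - b x)\<^sup>2 / (a x)\<^sup>2 * (a x * (norm (p x))\<^sup>2 + f x * ua x)
      = 2 * ((a x *\<^sub>R p x) \<bullet> V x) - 2 * ((b x *\<^sub>R q x) \<bullet> V x) - 2 * ((b x *\<^sub>R (p x - q x)) \<bullet> V x)
          - (a x *\<^sub>R p x) \<bullet> V2 x + f x * ((w x * w x) * ua x)"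
      using A(2) w(3)
    proof eventually_elim
      case (elim x)
      have a0: "a x \<noteq> 0" using elim lam by auto
      have eq: "(a x - b x)\<^sup>2 / (a x)\<^sup>2 = w x * w x"
        unfolding elim(2)[symmetric] using a0 by (simp add: power2_eq_square)
      have b: "b x = a x - a x * w x" using elim(2) by simp
      show ?case unfolding eq b V_def V2_def p_def[symmetric]
        using a0 by (simp add: power2_norm_eq_inner inner_add_right inner_diff_left power2_eq_square[of "w x"]
            power2_eq_square[of "a x"] power2_eq_square[of "a x * w x"] algebra_simps)
    qed
  qed
  also have "\<dots> = 2 * (\<integral>x. (a x *\<^sub>R p x) \<bullet> V x \<partial>M) - 2 * (\<integral>x. (b x *\<^sub>R q x) \<bullet> V x \<partial>M)
      - 2 * (\<integral>x. (b x *\<^sub>R (p x - q x)) \<bullet> V x \<partial>M)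
      - (\<integral>x. (a x *\<^sub>R p x) \<bullet> V2 x \<partial>M) + (\<integral>x. f x * ((w x * w x) * ua x) \<partial>M)"
    using i1 i2 i3 i4 i5 by (simp only: Bochner_Integration.integral_add Bochner_Integration.integral_diff
        Bochner_Integration.integrable_add Bochner_Integration.integrable_diff integrable_mult_right integral_mult_right_zero)
  finally show "(\<integral>x. (a x - b x)\<^sup>2 / (a x)\<^sup>2 * (a x * (norm (wgrad D ua x))\<^sup>2 + f x * ua x) \<partial>M)
      = - 2 * (\<integral>x. (b x *\<^sub>R (wgrad D ua x - wgrad D ub x)) \<bullet> V x \<partial>M)"
    unfolding I1 I2 I3 p_def[symmetric] q_def[symmetric] by simp
qed

text \<open>In the equation tested with \<open>u\<close> itself, the product \<open>f u\<close> is
  controlled by the two sup bounds and the measure of \<open>D\<close>. The sup bound on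
  \<open>u\<close> is linear in the norm of \<open>f\<close>, so the square root is linear
  again.\<close>

lemma energy_bound:
  assumes lam: "0 < lam" and a: "a \<in> admissible D lam Lam" and f: "f \<in> Linf D"
    and u: "weak_solution D a (functional_of D f) u"
    and U: "AE x in M. \<bar>u x\<bar> \<le> C * Linf_norm D f" and C: "0 \<le> C"
  shows "L2_norm D (wgrad D u) \<le> sqrt (C * measure M (space M) / lam) * Linf_norm D f"
proof -
  let ?F = "Linf_norm D f"
  interpret finite_measure M by (rule finite_measure_D)
  note W = weak_solutionD[OF u] and L = Linf_bound[OF f]
  have uL: "u \<in> L2 D" by (rule has_weak_gradientD(1)[OF wgrad[OF W(2)]])
  have "lam * (L2_norm D (wgrad D u))\<^sup>2 \<le> (\<integral>x. a x * (wgrad D u x \<bullet> wgrad D u x) \<partial>M)"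
    by (rule coercive[OF a lam W(3)])
  also have "\<dots> = (\<integral>x. f x * u x \<partial>M)" using W(4)[OF W(1)] by (simp add: functional_of_def)
  also have "\<dots> \<le> (\<integral>x. ?F * (C * ?F) \<partial>M)"
  proof (rule integral_mono_AE)
    show "integrable M (\<lambda>x. f x * u x)" by (rule L2_mult_integrable[OF Linf_L2[OF f] uL])
    show "AE x in M. f x * u x \<le> ?F * (C * ?F)"
      using L(1) U
    proof eventually_elim
      case (elim x)
      have "f x * u x \<le> \<bar>f x\<bar> * \<bar>u x\<bar>" by (simp add: abs_mult[symmetric])
      also have "\<dots> \<le> ?F * (C * ?F)" using elim L(2) by (intro mult_mono) auto
      finally show ?case .
    qed
  qed simp
  also have "\<dots> = C * measure M (space M) * ?F\<^sup>2" by (simp add: power2_eq_square mult_ac)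
  finally have "(L2_norm D (wgrad D u))\<^sup>2 \<le> C * measure M (space M) / lam * ?F\<^sup>2"
    using lam by (simp add: field_simps)
  then have "L2_norm D (wgrad D u) \<le> sqrt (C * measure M (space M) / lam * ?F\<^sup>2)" by (rule real_le_rsqrt)
  then show ?thesis using L(2) by (simp only: real_sqrt_mult[of _ "?F\<^sup>2"] real_sqrt_abs abs_of_nonneg)
qed

text \<open>\<open>C\<close> is quantified before coefficients and data. It is
  \<open>2 * Lam * C1\<close>, where \<open>C1\<close> is built from \<open>lam\<close>,
  \<open>Lam\<close>, the dimension and the measure of \<open>D\<close> alone.\<close>

theorem weighted_stability_estimate:
  assumes lam: "0 < lam" "0 < Lam"
  shows "\<exists>C. \<forall>a\<in>admissible D lam Lam. \<forall>b\<in>admissible D lam Lam. a \<in> H1 D \<longrightarrow> b \<in> H1 D \<longrightarrow>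
    (\<forall>f\<in>Linf D. \<forall>ua ub. weak_solution D a (functional_of D f) ua \<longrightarrow> weak_solution D b (functional_of D f) ub \<longrightarrow>
      (\<integral>x. (a x - b x)\<^sup>2 / (a x)\<^sup>2 * (a x * (norm (wgrad D ua x))\<^sup>2 + f x * ua x) \<partial>M)
      \<le> C * Linf_norm D f * (1 + max (L2_norm D (wgrad D a)) (L2_norm D (wgrad D b))) * H10_norm D (\<lambda>x. ua x - ub x))"
proof -
  define \<mu> where "\<mu> = measure M (space M)"
  have \<mu>: "0 \<le> \<mu>" by (simp add: \<mu>_def)
  \<comment> \<open>A radius of at least 1 and above twice the measure of \<open>D\<close> can start
    the iteration, because then \<open>R \<le> R ^ DIM('a)\<close>.\<close>
  define R where "R = 2 * \<mu> + 1"
  have "R ^ 1 \<le> R ^ DIM('a)" using \<mu> DIM_positive[where 'a='a] by (intro power_increasing) (auto simp: R_def Suc_le_eq)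
  then have R: "0 < R" "2 * \<mu> \<le> R ^ DIM('a)" using \<mu> by (auto simp: R_def)
  define C0 where "C0 = 2 * (exp 1 * real DIM('a) * R\<^sup>2 * 2 ^ DIM('a) / lam)"
  \<comment> \<open>The summands belong to the two parts of the gradient of \<open>w ua\<close>: the
    sup bound handles \<open>ua\<close> times the gradient of \<open>w\<close>, the energy bound
    handles \<open>w\<close> times the gradient of \<open>ua\<close>.\<close>
  define C1 where "C1 = C0 * (Lam / lam\<^sup>2 + 1 / lam) + (1 + Lam / lam) * sqrt (C0 * \<mu> / lam)"
  have C0: "0 \<le> C0" using lam by (simp add: C0_def)
  have main: "(\<integral>x. (a x - b x)\<^sup>2 / (a x)\<^sup>2 * (a x * (norm (wgrad D ua x))\<^sup>2 + f x * ua x) \<partial>M)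
      \<le> 2 * Lam * C1 * Linf_norm D f * (1 + max (L2_norm D (wgrad D a)) (L2_norm D (wgrad D b))) * H10_norm D (\<lambda>x. ua x - ub x)"
    if a: "a \<in> admissible D lam Lam" "a \<in> H1 D" and b: "b \<in> admissible D lam Lam" "b \<in> H1 D" and f: "f \<in> Linf D"
      and ua: "weak_solution D a (functional_of D f) ua" and ub: "weak_solution D b (functional_of D f) ub"
    for a b f ua ub
  proof -
    define F m where "F = Linf_norm D f" and "m = max (L2_norm D (wgrad D a)) (L2_norm D (wgrad D b))"
    have m: "0 \<le> m" by (simp add: m_def le_max_iff_disj)
    note L = Linf_bound[OF f, folded F_def]
    note Ua = weak_solutionD[OF ua] and Ub = weak_solutionD[OF ub]
    obtain \<phi> where \<phi>: "test_approx D \<phi> ua (wgrad D ua)" using H10_test_approx[OF Ua(1)] by blast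
    have U: "AE x in M. \<bar>ua x\<bar> \<le> C0 * F"
      unfolding C0_def
      by (rule solution_bound[OF \<phi> a(1) lam(1) Linf_L2[OF f] L(1,2) weak_solution_test[OF ua a(1)] R(1) R(2)[unfolded \<mu>_def]])
    have P: "L2_norm D (wgrad D ua) \<le> sqrt (C0 * \<mu> / lam) * F"
      using energy_bound[OF lam(1) a(1) f ua _ C0] U unfolding F_def \<mu>_def by blast
    obtain w g where w: "has_weak_gradient D w g" "AE x in M. a x * w x = a x - b x" "AE x in M. \<bar>w x\<bar> \<le> 1 + Lam / lam"
      and g: "L2_norm D g \<le> (Lam / lam\<^sup>2 + 1 / lam) * m"
      using ratio_weak_gradient[OF lam a b] unfolding m_def by blast
    let ?V = "\<lambda>x. ua x *\<^sub>R g x + w x *\<^sub>R wgrad D ua x" and ?E = "\<lambda>x. wgrad D ua x - wgrad D ub x"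
    note id = weighted_energy_identity[OF lam(1) a(1) b(1) Linf_L2[OF f] ua ub w(1,3,2) U]
    have E: "H10_norm D (\<lambda>x. ua x - ub x) = L2_norm D ?E"
      unfolding H10_norm_def by (rule L2_norm_wgrad[OF weak_gradient_diff[OF wgrad[OF Ua(2)] wgrad[OF Ub(2)]]])
    note uL = has_weak_gradientD(1)[OF wgrad[OF Ua(2)]]
    have "L2_norm D ?V \<le> L2_norm D (\<lambda>x. ua x *\<^sub>R g x) + L2_norm D (\<lambda>x. w x *\<^sub>R wgrad D ua x)"
      by (rule L2_norm_triangle[OF L2_bounded_scaleR(1)[OF has_weak_gradientD(2)[OF w(1)] L2_measurable[OF uL] U]
            L2_bounded_scaleR(1)[OF Ua(3) L2_measurable[OF has_weak_gradientD(1)[OF w(1)]] w(3)]])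
    also have "\<dots> \<le> (C0 * F) * L2_norm D g + (1 + Lam / lam) * L2_norm D (wgrad D ua)"
      using C0 L(2) lam
      by (intro add_mono L2_bounded_scaleR(2)[OF has_weak_gradientD(2)[OF w(1)] L2_measurable[OF uL] U]
            L2_bounded_scaleR(2)[OF Ua(3) L2_measurable[OF has_weak_gradientD(1)[OF w(1)]] w(3)]) auto
    also have "\<dots> \<le> (C0 * F) * ((Lam / lam\<^sup>2 + 1 / lam) * m) + (1 + Lam / lam) * (sqrt (C0 * \<mu> / lam) * F)"
      using C0 L(2) lam by (intro add_mono mult_left_mono g P) auto
    \<comment> \<open>The first term carries the factor \<open>m\<close> and the second the factor
      1; both are enlarged to \<open>1 + m\<close>, the factor in the claim.\<close>
    also have "\<dots> \<le> (C0 * F) * ((Lam / lam\<^sup>2 + 1 / lam) * (1 + m)) + (1 + Lam / lam) * (sqrt (C0 * \<mu> / lam) * F) * (1 + m)"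
    proof (rule add_mono)
      show "(C0 * F) * ((Lam / lam\<^sup>2 + 1 / lam) * m) \<le> (C0 * F) * ((Lam / lam\<^sup>2 + 1 / lam) * (1 + m))"
        using C0 L(2) lam by (intro mult_left_mono) auto
      have "0 \<le> (1 + Lam / lam) * (sqrt (C0 * \<mu> / lam) * F)" using C0 L(2) lam \<mu> by simp
      from mult_left_mono[OF _ this, of 1 "1 + m"] m
      show "(1 + Lam / lam) * (sqrt (C0 * \<mu> / lam) * F) \<le> (1 + Lam / lam) * (sqrt (C0 * \<mu> / lam) * F) * (1 + m)" by simp
    qed
    also have "\<dots> = C1 * F * (1 + m)" unfolding C1_def by algebra
    finally have V: "L2_norm D ?V \<le> C1 * F * (1 + m)" .
    note B = admissibleD[OF b(1)]
    note bE = L2_bounded_scaleR[OF L2_diff[OF Ua(3) Ub(3)] B(1) B(3)[OF lam(1)]]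
    have "(\<integral>x. (a x - b x)\<^sup>2 / (a x)\<^sup>2 * (a x * (norm (wgrad D ua x))\<^sup>2 + f x * ua x) \<partial>M)
        \<le> 2 * \<bar>\<integral>x. (b x *\<^sub>R ?E x) \<bullet> ?V x \<partial>M\<bar>"
      unfolding id(2) by linarith
    also have "\<dots> \<le> 2 * (L2_norm D (\<lambda>x. b x *\<^sub>R ?E x) * L2_norm D ?V)"
      using L2_Cauchy_Schwarz[OF bE(1) id(1)] by simp
    also have "\<dots> \<le> 2 * ((Lam * L2_norm D ?E) * (C1 * F * (1 + m)))"
      using bE(2) V lam by (intro mult_left_mono mult_mono) auto
    also have "\<dots> = 2 * Lam * C1 * F * (1 + m) * H10_norm D (\<lambda>x. ua x - ub x)" by (simp add: E mult_ac)
    finally show ?thesis by (simp add: F_def m_def)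
  qed
  then show ?thesis by blast
qed

end

section \<open>Both estimates on a Lipschitz domain, regarded as a bounded open set\<close>

theorem theorem2p2:
  fixes D :: "'a::euclidean_space set" and lam Lam :: real
  assumes "DIM('a) \<ge> 2" and "lipschitz_domain D" and "0 < lam" and "0 < Lam"
  shows
    "(\<forall>a\<in>admissible D lam Lam. \<forall>b\<in>admissible D lam Lam. \<forall>f\<in>Hminus1 D. \<forall>ua ub.
        weak_solution D a f ua \<longrightarrow> weak_solution D b f ub \<longrightarrow>
        \<bar>\<integral>x. (a x - b x) * (norm (wgrad D ua x))\<^sup>2 \<partial>(lebesgue_on D)\<bar>
          \<le> (Lam / lam) * Hminus1_norm D f * H10_norm D (\<lambda>x. ua x - ub x))
     \<and>
     (\<exists>C::real. \<forall>M>0. \<forall>a\<in>admissible_H1 D lam Lam M. \<forall>b\<in>admissible_H1 D lam Lam M. \<forall>f\<in>Linf D. \<forall>ua ub.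
        weak_solution D a (functional_of D f) ua \<longrightarrow>
        weak_solution D b (functional_of D f) ub \<longrightarrow>
        (\<integral>x. (a x - b x)\<^sup>2 / (a x)\<^sup>2 * (a x * (norm (wgrad D ua x))\<^sup>2 + f x * ua x) \<partial>(lebesgue_on D))
          \<le> C * Linf_norm D f * (1 + max (L2_norm D (wgrad D a)) (L2_norm D (wgrad D b)))
              * H10_norm D (\<lambda>x. ua x - ub x))"
proof -
  interpret bounded_open D
    using assms(2) by unfold_locales (auto simp: lipschitz_domain_def)
  show ?thesis
  proof
    show "\<forall>a\<in>admissible D lam Lam. \<forall>b\<in>admissible D lam Lam. \<forall>f\<in>Hminus1 D. \<forall>ua ub.
        weak_solution D a f ua \<longrightarrow> weak_solution D b f ub \<longrightarrow>
        \<bar>\<integral>x. (a x - b x) * (norm (wgrad D ua x))\<^sup>2 \<partial>(lebesgue_on D)\<bar>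
          \<le> (Lam / lam) * Hminus1_norm D f * H10_norm D (\<lambda>x. ua x - ub x)"
      using stability_estimate[OF assms(3,4)] by blast
  next
    obtain C where "\<forall>a\<in>admissible D lam Lam. \<forall>b\<in>admissible D lam Lam. a \<in> H1 D \<longrightarrow> b \<in> H1 D \<longrightarrow>
      (\<forall>f\<in>Linf D. \<forall>ua ub. weak_solution D a (functional_of D f) ua \<longrightarrow> weak_solution D b (functional_of D f) ub \<longrightarrow>
      (\<integral>x. (a x - b x)\<^sup>2 / (a x)\<^sup>2 * (a x * (norm (wgrad D ua x))\<^sup>2 + f x * ua x) \<partial>lebesgue_on D)
      \<le> C * Linf_norm D f * (1 + max (L2_norm D (wgrad D a)) (L2_norm D (wgrad D b))) * H10_norm D (\<lambda>x. ua x - ub x))"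
      using weighted_stability_estimate[OF assms(3,4)] by blast
    then show "\<exists>C::real. \<forall>M>0. \<forall>a\<in>admissible_H1 D lam Lam M. \<forall>b\<in>admissible_H1 D lam Lam M. \<forall>f\<in>Linf D. \<forall>ua ub.
        weak_solution D a (functional_of D f) ua \<longrightarrow>
        weak_solution D b (functional_of D f) ub \<longrightarrow>
        (\<integral>x. (a x - b x)\<^sup>2 / (a x)\<^sup>2 * (a x * (norm (wgrad D ua x))\<^sup>2 + f x * ua x) \<partial>(lebesgue_on D))
          \<le> C * Linf_norm D f * (1 + max (L2_norm D (wgrad D a)) (L2_norm D (wgrad D b)))
              * H10_norm D (\<lambda>x. ua x - ub x)"
      unfolding admissible_H1_def by (intro exI[of _ C]) simp
  qed
qed

end
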